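(* Let $B\subseteq M\subseteq \mathbb B(H)$ be a unital inclusion of von Neumann algebras where $B$ is countably decomposable. Then $$\mathcal{GN}_M(B)'=(B')^{\mathrm{Aut}_{M'}(B')}.$$
   Context: For a unital inclusion $B\subseteq M$ of von Neumann algebras, $\mathcal{GN}_M(B)$ (the groupoid normalisers of $B$ in $M$) is the set of partial isometries $v\in M$ with $vBv^*\subseteq B$ and $v^*Bv\subseteq B$. Commutants are taken in $\mathbb B(H)$, so $M'\subseteq B'$. For an inclusion $N\subseteq P$ of von Neumann algebras, $\mathrm{Aut}_N(P)$ is the group of ($*$-)automorphisms $\theta$ of $P$ with $\theta(n)=n$ for all $n\in N$, and for a group $G$ of automorphisms of $P$, $P^G=\{x\in P:\theta(x)=x\ \text{for all }\theta\in G\}$. All inclusions share the same unit. *)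

theory Defs
  imports "HOL-Analysis.Analysis"
begin

(* Complex Hilbert spaces, with the inner product linear in its first argument.
   Positive definiteness and the identity  norm x ^ 2 = cinner x x  are inherited from
   real_inner through the last axiom, since cinner x x is real by cinner_commute. *)
class complex_hilbert_space = real_inner + complete_space +
  fixes scaleC :: "complex \<Rightarrow> 'a \<Rightarrow> 'a"  (infixr "*\<^sub>C" 75)
    and cinner :: "'a \<Rightarrow> 'a \<Rightarrow> complex"
  assumes scaleC_add_right: "c *\<^sub>C (x + y) = c *\<^sub>C x + c *\<^sub>C y"
    and scaleC_add_left: "(c + d) *\<^sub>C x = c *\<^sub>C x + d *\<^sub>C x"
    and scaleC_scaleC: "c *\<^sub>C (d *\<^sub>C x) = (c * d) *\<^sub>C x"
    and scaleC_of_real: "complex_of_real r *\<^sub>C x = r *\<^sub>R x"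
    and cinner_commute: "cinner x y = cnj (cinner y x)"
    and cinner_add_left: "cinner (x + y) z = cinner x z + cinner y z"
    and cinner_scaleC_left: "cinner (c *\<^sub>C x) y = c * cinner x y"
    and Re_cinner: "Re (cinner x y) = inner x y"

instantiation complex :: complex_hilbert_space
begin

definition scaleC_complex :: "complex \<Rightarrow> complex \<Rightarrow> complex"
  where "scaleC_complex c x = c * x"

definition cinner_complex :: "complex \<Rightarrow> complex \<Rightarrow> complex"
  where "cinner_complex x y = x * cnj y"

instance
  by standard
    (simp_all add: scaleC_complex_def cinner_complex_def algebra_simps scaleR_conv_of_real
      inner_complex_def)

end

lemma norm_scaleC: "norm (c *\<^sub>C x) = cmod c * norm x"
  for x :: "'h::complex_hilbert_space"
proof -
  have self: "cinner y y = complex_of_real ((norm y)\<^sup>2)" for y :: 'h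
  proof (rule complex_eqI)
    show "Re (cinner y y) = Re (complex_of_real ((norm y)\<^sup>2))"
      by (simp add: Re_cinner power2_norm_eq_inner)
    have "Im (cinner y y) = - Im (cinner y y)"
      using cinner_commute[of y y] by (metis cnj.simps(2))
    then show "Im (cinner y y) = Im (complex_of_real ((norm y)\<^sup>2))"
      by simp
  qed
  have "cinner (c *\<^sub>C x) (c *\<^sub>C x) = c * cnj (cinner (c *\<^sub>C x) x)"
    by (metis cinner_commute cinner_scaleC_left)
  also have "\<dots> = (c * cnj c) * complex_of_real ((norm x)\<^sup>2)"
    by (simp add: cinner_scaleC_left self)
  also have "\<dots> = complex_of_real ((cmod c * norm x)\<^sup>2)"
    by (simp add: complex_norm_square[symmetric] power_mult_distrib)
  finally have "(norm (c *\<^sub>C x))\<^sup>2 = (cmod c * norm x)\<^sup>2"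
    unfolding self of_real_eq_iff .
  then show ?thesis
    by simp
qed

lemma bounded_linear_scaleC: "bounded_linear (\<lambda>x :: 'h::complex_hilbert_space. c *\<^sub>C x)"
proof (rule bounded_linear_intro)
  show "c *\<^sub>C (r *\<^sub>R x) = r *\<^sub>R (c *\<^sub>C x)" for r and x :: 'h
    by (simp add: scaleC_of_real[symmetric] scaleC_scaleC mult.commute)
  show "norm (c *\<^sub>C x) \<le> norm x * cmod c" for x :: 'h
    by (simp add: norm_scaleC mult.commute)
qed (rule scaleC_add_right)

lift_definition op_scaleC ::
    "complex \<Rightarrow> ('h::complex_hilbert_space \<Rightarrow>\<^sub>L 'h) \<Rightarrow> ('h \<Rightarrow>\<^sub>L 'h)"
  is "\<lambda>c T x. c *\<^sub>C T x"
  by (rule bounded_linear_compose[OF bounded_linear_scaleC])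

(* The library type of bounded operators consists of the real-linear ones; B(H) is the set of
   complex-linear operators among them. *)
definition bounded_ops :: "('h::complex_hilbert_space \<Rightarrow>\<^sub>L 'h) set"
  where "bounded_ops = {T. \<forall>c x. blinfun_apply T (c *\<^sub>C x) = c *\<^sub>C blinfun_apply T x}"

(* Only meaningful on bounded_ops, where existence is the Riesz representation theorem. *)
definition adj :: "('h::complex_hilbert_space \<Rightarrow>\<^sub>L 'h) \<Rightarrow> ('h \<Rightarrow>\<^sub>L 'h)"
  where "adj T = (THE S. \<forall>x y. cinner (blinfun_apply T x) y = cinner x (blinfun_apply S y))"

definition commutant ::
    "('h::complex_hilbert_space \<Rightarrow>\<^sub>L 'h) set \<Rightarrow> ('h \<Rightarrow>\<^sub>L 'h) set"
  where "commutant A = {T \<in> bounded_ops. \<forall>S\<in>A. T o\<^sub>L S = S o\<^sub>L T}"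

definition von_neumann_algebra :: "('h::complex_hilbert_space \<Rightarrow>\<^sub>L 'h) set \<Rightarrow> bool"
  where "von_neumann_algebra A \<longleftrightarrow>
    A \<subseteq> bounded_ops \<and>
    id_blinfun \<in> A \<and>
    (\<forall>S\<in>A. \<forall>T\<in>A. S + T \<in> A) \<and>
    (\<forall>c. \<forall>T\<in>A. op_scaleC c T \<in> A) \<and>
    (\<forall>S\<in>A. \<forall>T\<in>A. S o\<^sub>L T \<in> A) \<and>
    (\<forall>T\<in>A. adj T \<in> A) \<and>
    closedin (subtopology strong_operator_topology bounded_ops) A"

definition is_projection :: "('h::complex_hilbert_space \<Rightarrow>\<^sub>L 'h) \<Rightarrow> bool"
  where "is_projection p \<longleftrightarrow> p \<in> bounded_ops \<and> p o\<^sub>L p = p \<and> adj p = p"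

definition countably_decomposable :: "('h::complex_hilbert_space \<Rightarrow>\<^sub>L 'h) set \<Rightarrow> bool"
  where "countably_decomposable A \<longleftrightarrow>
    (\<forall>\<P>. \<P> \<subseteq> {p \<in> A. is_projection p \<and> p \<noteq> 0} \<and>
         (\<forall>p\<in>\<P>. \<forall>q\<in>\<P>. p \<noteq> q \<longrightarrow> p o\<^sub>L q = 0)
         \<longrightarrow> countable \<P>)"

definition partial_isometry :: "('h::complex_hilbert_space \<Rightarrow>\<^sub>L 'h) \<Rightarrow> bool"
  where "partial_isometry v \<longleftrightarrow> v \<in> bounded_ops \<and> is_projection (adj v o\<^sub>L v)"

definition groupoid_normalisers ::
    "('h::complex_hilbert_space \<Rightarrow>\<^sub>L 'h) set \<Rightarrow> ('h \<Rightarrow>\<^sub>L 'h) set \<Rightarrow> ('h \<Rightarrow>\<^sub>L 'h) set"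
  where "groupoid_normalisers M B = {v \<in> M. partial_isometry v \<and>
    (\<forall>b\<in>B. v o\<^sub>L b o\<^sub>L adj v \<in> B) \<and> (\<forall>b\<in>B. adj v o\<^sub>L b o\<^sub>L v \<in> B)}"

(* Automorphisms are maps on P only; as in HOL-Algebra's Bij, extensionality fixes the
   representing total function. No normality or spatiality is imposed. *)
definition automorphisms ::
    "('h::complex_hilbert_space \<Rightarrow>\<^sub>L 'h) set \<Rightarrow> (('h \<Rightarrow>\<^sub>L 'h) \<Rightarrow> ('h \<Rightarrow>\<^sub>L 'h)) set"
  where "automorphisms P = {\<theta> \<in> extensional P. bij_betw \<theta> P P \<and>
    (\<forall>x\<in>P. \<forall>y\<in>P. \<theta> (x + y) = \<theta> x + \<theta> y) \<and>
    (\<forall>c. \<forall>x\<in>P. \<theta> (op_scaleC c x) = op_scaleC c (\<theta> x)) \<and>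
    (\<forall>x\<in>P. \<forall>y\<in>P. \<theta> (x o\<^sub>L y) = \<theta> x o\<^sub>L \<theta> y) \<and>
    (\<forall>x\<in>P. \<theta> (adj x) = adj (\<theta> x))}"

definition automorphisms_fixing ::
    "('h::complex_hilbert_space \<Rightarrow>\<^sub>L 'h) set \<Rightarrow> ('h \<Rightarrow>\<^sub>L 'h) set
      \<Rightarrow> (('h \<Rightarrow>\<^sub>L 'h) \<Rightarrow> ('h \<Rightarrow>\<^sub>L 'h)) set"
  where "automorphisms_fixing N P = {\<theta> \<in> automorphisms P. \<forall>n\<in>N. \<theta> n = n}"

definition fixed_points :: "'a set \<Rightarrow> ('a \<Rightarrow> 'a) set \<Rightarrow> 'a set"
  where "fixed_points P G = {x \<in> P. \<forall>\<theta>\<in>G. \<theta> x = x}"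

end

theory Submission
  imports Defs "HOL-Library.Poly_Mapping"
begin

text \<open>Write \<open>N\<close> for the commutant of \<open>B\<close>.

  Let \<open>x\<close> commute with the groupoid normalisers and let \<open>\<theta>\<close> be an automorphism of \<open>N\<close> fixing the commutant of \<open>M\<close>.
  If \<open>t y = \<theta>(y) t\<close> for all \<open>y \<in> N\<close>, then the partial isometry \<open>v\<close> of the polar decomposition of \<open>t\<close> intertwines in
  the same way, hence is a groupoid normaliser, and \<open>(\<theta>(x) - x) v = x v - x v = 0\<close>. So \<open>\<theta>(x) = x\<close> once the ranges of
  intertwiners span the space, which follows if every \<open>\<xi> \<noteq> 0\<close> admits a nonzero intertwiner into the closure of
  \<open>N \<xi>\<close>. For this a projection \<open>q\<close> is found on which the state \<open>\<langle>\<theta>(\<cdot>)\<xi>, \<xi>\<rangle>\<close> is nonzero and dominated by a vector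
  functional \<open>C \<langle>\<cdot>\<eta>, \<eta>\<rangle>\<close>; then \<open>y q \<eta> \<mapsto> \<theta>(y q) \<xi>\<close> is bounded and intertwines.

  Conversely let \<open>x \<in> N\<close> be fixed by these automorphisms and let \<open>v\<close> be a groupoid normaliser. If \<open>v\<^sup>* v\<close> and \<open>v v\<^sup>*\<close>
  have the same central support \<open>z\<close>, conjugation by \<open>v\<close> induces an automorphism of \<open>N z\<close>, extended by the identity on
  \<open>N (1 - z)\<close>, and invariance of \<open>x\<close> under it gives \<open>x v = v x\<close>. In general \<open>v\<close> acts partially on the centre of
  \<open>B\<close>. Central projections \<open>c\<close> with \<open>c v c = 0\<close> are handled by the self-adjoint normaliser \<open>v c + c v\<^sup>*\<close>, and on the
  central projection \<open>q\<close> left over the action is trivial, so that \<open>v q\<close> falls under the first case.\<close>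

section \<open>Orthogonal projections and adjoints\<close>

text \<open>An automorphism of the commutant need not be implemented by a unitary, and nothing is
  assumed about its continuity. Partial intertwiners replace an implementing unitary, and positivity
  is carried across \<open>\<theta>\<close> by square roots. The inequality that defines the maximal
  \<open>r\<close> bounds a vector norm, which is continuous along chains, by a norm involving
  \<open>\<theta>\<close>, which only has to be monotone; so it survives suprema. Below
  \<open>s - r\<close> the reverse inequality must hold, for otherwise \<open>r\<close> could be
  enlarged.

  In the converse inclusion, conjugation by \<open>v\<close> only makes sense on corners. It
  transfers to the commutant because restriction to the corner of a projection of \<open>B\<close>
  is faithful under its central support. If source and range of \<open>v\<close> have different
  central supports, no automorphism results; cutting \<open>v\<close> by central projections
  restores equality.

  Operators are built real-linearly from \<open>inner\<close>; complex linearity is recovered as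
  commutation with scalar operators.\<close>

instance complex_hilbert_space \<subseteq> banach ..

text \<open>A minimising sequence for the distance to \<open>V\<close> is Cauchy by the
  parallelogram law. Completeness is asked of \<open>V\<close> rather than of the space because
  projections are later taken among finitely supported functions, a space that need not be
  complete.\<close>

lemma orthogonal_decomposition:
  fixes V :: "'a::real_inner set"
  assumes V: "subspace V" "complete V"
  obtains p where "p \<in> V" "\<And>k. k \<in> V \<Longrightarrow> inner (x - p) k = 0"
proof -
  define D where "D = (\<lambda>y. (norm (x - y))\<^sup>2) ` V"
  define d where "d = Inf D"
  have ne: "D \<noteq> {}" using subspace_0[OF V(1)] by (auto simp: D_def)
  have bdd: "bdd_below D" by (auto simp: D_def intro: bdd_belowI[of _ 0])
  have low: "d \<le> (norm (x - y))\<^sup>2" if "y \<in> V" for y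
    unfolding d_def using that by (intro cInf_lower bdd) (auto simp: D_def)
  have "\<exists>y\<in>V. (norm (x - y))\<^sup>2 < d + 1 / real (Suc n)" for n
    using cInf_lessD[OF ne, of "d + 1 / real (Suc n)"] unfolding d_def D_def by auto
  then obtain y where y: "\<And>n. y n \<in> V" "\<And>n. (norm (x - y n))\<^sup>2 < d + 1 / real (Suc n)"
    by metis
  have diff: "(norm (y m - y n))\<^sup>2 \<le> 2 / real (Suc m) + 2 / real (Suc n)" for m n
  proof -
    define z where "z = (1/2) *\<^sub>R (y m + y n)"
    have "z \<in> V" unfolding z_def using V(1) y(1) by (intro subspace_scale subspace_add)
    have "(norm (y m - y n))\<^sup>2 = 2 * (norm (x - y m))\<^sup>2 + 2 * (norm (x - y n))\<^sup>2 - 4 * (norm (x - z))\<^sup>2"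
      unfolding power2_norm_eq_inner z_def
      by (simp add: inner_diff_left inner_diff_right inner_add_left inner_add_right inner_commute algebra_simps)
    moreover have "2 / real (Suc m) = 2 * (1 / real (Suc m))" "2 / real (Suc n) = 2 * (1 / real (Suc n))" by auto
    ultimately show ?thesis using low[OF \<open>z \<in> V\<close>] y(2)[of m] y(2)[of n] by linarith
  qed
  have "Cauchy y"
  proof (rule metric_CauchyI)
    fix e :: real assume e: "0 < e"
    obtain N where N: "4 / e\<^sup>2 < real N" using reals_Archimedean2 by blast
    have *: "dist (y m) (y n) < e" if "m \<ge> N" "n \<ge> N" for m n
    proof -
      have b: "2 / real (Suc k) < e\<^sup>2 / 2" if "k \<ge> N" for k
      proof -
        have "4 / e\<^sup>2 < real (Suc k)" using N that by linarith
        then show ?thesis using e by (simp add: field_simps)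
      qed
      have "(norm (y m - y n))\<^sup>2 < e\<^sup>2" using diff[of m n] b[OF that(1)] b[OF that(2)] by linarith
      then show ?thesis using e by (simp add: dist_norm power2_less_imp_less)
    qed
    then show "\<exists>M. \<forall>m\<ge>M. \<forall>n\<ge>M. dist (y m) (y n) < e" by blast
  qed
  then obtain p where p: "p \<in> V" "y \<longlonglongrightarrow> p" using V(2) y(1) unfolding complete_def by blast
  have "(\<lambda>n. (norm (x - y n))\<^sup>2) \<longlonglongrightarrow> (norm (x - p))\<^sup>2" by (intro tendsto_intros p)
  moreover have "(\<lambda>n. d + 1 / real (Suc n)) \<longlonglongrightarrow> d + 0"
    by (intro tendsto_add tendsto_const LIMSEQ_Suc[OF lim_1_over_n])
  ultimately have pd: "(norm (x - p))\<^sup>2 \<le> d"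
    using y(2) by (intro LIMSEQ_le[where Y="\<lambda>n. d + 1 / real (Suc n)"]) (auto intro: less_imp_le)
  have "inner (x - p) k = 0" if k: "k \<in> V" for k
  proof (cases "k = 0")
    case False
    define c where "c = inner (x - p) k / inner k k"
    have kk: "inner k k > 0" using False by simp
    have "p + c *\<^sub>R k \<in> V" using V(1) p k by (intro subspace_add subspace_scale)
    from low[OF this] pd have "(norm (x - p))\<^sup>2 \<le> (norm (x - (p + c *\<^sub>R k)))\<^sup>2" by linarith
    also have "\<dots> = (norm (x - p))\<^sup>2 - 2 * c * inner (x - p) k + c * c * inner k k"
      unfolding power2_norm_eq_inner
      by (simp add: inner_diff_left inner_diff_right inner_add_left inner_add_right inner_commute algebra_simps)
    also have "c * c * inner k k = c * inner (x - p) k" using kk by (simp add: c_def)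
    finally have "c * inner (x - p) k \<le> 0" by simp
    then have "(inner (x - p) k)\<^sup>2 \<le> 0" using kk by (simp add: c_def power2_eq_square field_simps)
    then show ?thesis by simp
  qed simp
  with p(1) show ?thesis using that by blast
qed

definition orth_proj :: "'a::real_inner set \<Rightarrow> 'a \<Rightarrow>\<^sub>L 'a"
  where "orth_proj V = Blinfun (\<lambda>x. SOME p. p \<in> V \<and> (\<forall>k\<in>V. inner (x - p) k = 0))"

context
  fixes V :: "'a::real_inner set"
  assumes V: "subspace V" "complete V"
begin

lemma orth_proj_ex1: "\<exists>!p. p \<in> V \<and> (\<forall>k\<in>V. inner (x - p) k = 0)"
proof (rule ex_ex1I)
  show "\<exists>p. p \<in> V \<and> (\<forall>k\<in>V. inner (x - p) k = 0)"
    using orthogonal_decomposition[OF V] by metis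
next
  fix p q assume p: "p \<in> V \<and> (\<forall>k\<in>V. inner (x - p) k = 0)" and q: "q \<in> V \<and> (\<forall>k\<in>V. inner (x - q) k = 0)"
  then have "p - q \<in> V" using V(1) subspace_diff by blast
  then have "inner (x - q) (p - q) - inner (x - p) (p - q) = 0" using p q by simp
  then have "inner (p - q) (p - q) = 0" by (simp add: inner_diff_left)
  then show "p = q" by simp
qed

lemma orth_proj_spec:
  "orth_proj V x \<in> V \<and> (\<forall>k\<in>V. inner (x - orth_proj V x) k = 0)"
proof -
  define f where "f = (\<lambda>x. SOME p. p \<in> V \<and> (\<forall>k\<in>V. inner (x - p) k = 0))"
  have f: "f x \<in> V \<and> (\<forall>k\<in>V. inner (x - f x) k = 0)" for x
    unfolding f_def by (rule someI_ex) (use orth_proj_ex1 in blast)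
  have fI: "f x = p" if "p \<in> V" "\<And>k. k \<in> V \<Longrightarrow> inner (x - p) k = 0" for x p
    using orth_proj_ex1[of x] f[of x] that by blast
  have "bounded_linear f"
  proof (rule bounded_linear_intro[where K=1])
    show "f (x + y) = f x + f y" for x y
    proof (rule fI)
      show "f x + f y \<in> V" using f V(1) subspace_add by blast
      show "inner (x + y - (f x + f y)) k = 0" if "k \<in> V" for k
        using f[of x] f[of y] that by (simp add: inner_diff_left inner_add_left)
    qed
    show "f (r *\<^sub>R x) = r *\<^sub>R f x" for r x
    proof (rule fI)
      show "r *\<^sub>R f x \<in> V" using f V(1) subspace_scale by blast
      show "inner (r *\<^sub>R x - r *\<^sub>R f x) k = 0" if "k \<in> V" for k
        using f[of x] that by (simp add: inner_diff_left)
    qed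
    show "norm (f x) \<le> norm x * 1" for x
    proof -
      have "inner (x - f x) (f x) = 0" using f by blast
      then have "(norm (f x))\<^sup>2 = inner x (f x)" by (simp add: inner_diff_left power2_norm_eq_inner)
      also have "\<dots> \<le> norm x * norm (f x)" by (rule norm_cauchy_schwarz)
      finally show ?thesis by (cases "norm (f x) = 0") (simp_all add: power2_eq_square)
    qed
  qed
  then have "orth_proj V x = f x" unfolding orth_proj_def f_def by (simp add: bounded_linear_Blinfun_apply)
  with f show ?thesis by simp
qed

lemma orth_proj_in: "orth_proj V x \<in> V"
  using orth_proj_spec by blast

lemma orth_proj_orthogonal: "k \<in> V \<Longrightarrow> inner (x - orth_proj V x) k = 0"
  using orth_proj_spec by blast

lemma orth_proj_eqI: "\<lbrakk>p \<in> V; \<And>k. k \<in> V \<Longrightarrow> inner (x - p) k = 0\<rbrakk> \<Longrightarrow> orth_proj V x = p"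
  using orth_proj_ex1[of x] orth_proj_spec[of x] by blast

lemma orth_proj_fixed: "x \<in> V \<Longrightarrow> orth_proj V x = x"
  by (rule orth_proj_eqI) auto

lemma orth_proj_eq_0: "(\<And>k. k \<in> V \<Longrightarrow> inner x k = 0) \<Longrightarrow> orth_proj V x = 0"
  by (rule orth_proj_eqI) (auto simp: subspace_0[OF V(1)])

lemma orth_proj_inner: "inner (orth_proj V x) y = inner x (orth_proj V y)"
proof -
  have "inner (x - orth_proj V x) (orth_proj V y) = 0" "inner (y - orth_proj V y) (orth_proj V x) = 0"
    by (intro orth_proj_orthogonal orth_proj_in)+
  then show ?thesis unfolding inner_diff_left by (metis eq_iff_diff_eq_0 inner_commute)
qed

lemma orth_proj_idem: "orth_proj V o\<^sub>L orth_proj V = orth_proj V"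
  by (rule blinfun_eqI) (simp add: orth_proj_fixed orth_proj_in)

text \<open>The formal adjoint \<open>g\<close> turns invariance of \<open>V\<close> into invariance
  of its orthogonal complement under \<open>f\<close>. Plain functions are used so that scalar
  multiplications and amplifications are covered too.\<close>

lemma orth_proj_commute:
  assumes "\<And>x y. f (x - y) = f x - f y" "\<And>x y. inner (f x) y = inner x (g y)"
    and "\<And>k. k \<in> V \<Longrightarrow> f k \<in> V" "\<And>k. k \<in> V \<Longrightarrow> g k \<in> V"
  shows "orth_proj V (f x) = f (orth_proj V x)"
proof (rule orth_proj_eqI)
  show "f (orth_proj V x) \<in> V" by (intro assms orth_proj_in)
  show "inner (f x - f (orth_proj V x)) k = 0" if "k \<in> V" for k
    unfolding assms(1)[symmetric] assms(2) by (intro orth_proj_orthogonal assms that)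
qed

end

lemma riesz_representation:
  fixes f :: "'a::{real_inner,complete_space} \<Rightarrow> real"
  assumes "bounded_linear f"
  obtains k where "\<And>x. f x = inner x k"
proof (cases "\<forall>x. f x = 0")
  case True
  then show ?thesis using that[of 0] by simp
next
  case False
  then obtain x where x: "f x \<noteq> 0" by blast
  interpret f: bounded_linear f by fact
  define V where "V = {y. f y = 0}"
  have V: "subspace V" "complete V"
  proof -
    show "subspace V" unfolding V_def by (auto simp: subspace_def f.add f.scaleR f.zero)
    have "closed V" unfolding V_def
      by (intro closed_Collect_eq continuous_intros linear_continuous_on assms)
    then show "complete V" by (simp add: complete_eq_closed)
  qed
  define z where "z = x - orth_proj V x"
  have fz: "f z = f x" using orth_proj_in[OF V, of x] by (simp add: z_def f.diff V_def)
  have z: "inner z k = 0" if "f k = 0" for k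
    unfolding z_def by (rule orth_proj_orthogonal[OF V]) (use that in \<open>simp add: V_def\<close>)
  have zz: "inner z z \<noteq> 0" using fz x f.zero by force
  have "f y = inner y ((f x / inner z z) *\<^sub>R z)" for y
  proof -
    have "inner z (y - (f y / f x) *\<^sub>R z) = 0"
      using x by (intro z) (simp add: f.diff f.scaleR fz)
    then show ?thesis using zz x by (simp add: inner_diff_right inner_commute field_simps)
  qed
  then show ?thesis by (rule that)
qed

lemma real_adjoint_exists:
  fixes T :: "'a::{real_inner,complete_space} \<Rightarrow>\<^sub>L 'b::real_inner"
  obtains S :: "'b \<Rightarrow>\<^sub>L 'a" where "\<And>x y. inner (T x) y = inner x (S y)"
proof -
  have "\<exists>k. \<forall>x. inner (T x) y = inner x k" for y
  proof -
    have "bounded_linear (\<lambda>x. inner (T x) y)"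
      by (intro bounded_linear_compose[OF bounded_linear_inner_left] blinfun.bounded_linear_right)
    then obtain k where "\<And>x. inner (T x) y = inner x k" by (rule riesz_representation) blast
    then show ?thesis by blast
  qed
  then obtain s where s: "\<And>x y. inner (T x) y = inner x (s y)" by metis
  have eq: "u = v" if "\<And>x. inner x u = inner x v" for u v :: 'a
  proof -
    have "inner (u - v) (u - v) = 0" using that[of "u - v"] unfolding inner_diff_right by simp
    then show ?thesis by simp
  qed
  have "bounded_linear s"
  proof (rule bounded_linear_intro[where K="norm T"])
    show "s (x + y) = s x + s y" for x y
      by (rule eq) (simp add: s[symmetric] inner_add_right)
    show "s (r *\<^sub>R x) = r *\<^sub>R s x" for r x
      by (rule eq) (simp add: s[symmetric])
    show "norm (s x) \<le> norm x * norm T" for x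
    proof -
      have "(norm (s x))\<^sup>2 = inner (T (s x)) x" by (simp add: s power2_norm_eq_inner)
      also have "\<dots> \<le> norm (T (s x)) * norm x" by (rule norm_cauchy_schwarz)
      also have "\<dots> \<le> (norm T * norm (s x)) * norm x" by (intro mult_right_mono norm_blinfun) auto
      finally show ?thesis by (cases "norm (s x) = 0") (simp_all add: power2_eq_square mult.commute)
    qed
  qed
  then show ?thesis using s that[of "Blinfun s"] by (simp add: bounded_linear_Blinfun_apply)
qed

section \<open>Complex-linear operators and their adjoints\<close>

lemma blinfun_compose_assoc: "(a o\<^sub>L b) o\<^sub>L c = a o\<^sub>L (b o\<^sub>L c)"
  by (rule blinfun_eqI) simp

lemma blinfun_apply_op_scaleC [simp]: "blinfun_apply (op_scaleC c T) x = c *\<^sub>C blinfun_apply T x"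
  by (simp add: op_scaleC.rep_eq)

lemmas blinfun_apply_simps = blinfun.add_left blinfun.diff_left blinfun.minus_left blinfun.scaleR_left
  blinfun.add_right blinfun.diff_right blinfun.minus_right blinfun.scaleR_right blinfun.zero_left blinfun.zero_right

lemma compose_eq_apply: "a o\<^sub>L b = c o\<^sub>L d \<Longrightarrow> blinfun_apply a (blinfun_apply b x) = blinfun_apply c (blinfun_apply d x)"
  by (metis blinfun_apply_blinfun_compose)

lemma inner_left_eqI: "(\<And>x. inner x u = inner x v) \<Longrightarrow> u = v"
proof -
  assume "\<And>x. inner x u = inner x v"
  then have "inner (u - v) (u - v) = 0" unfolding inner_diff_right by simp
  then show ?thesis by simp
qed

lemma inner_scaleC_left: "inner (c *\<^sub>C x) y = inner x (cnj c *\<^sub>C y)"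
  for x y :: "'h::complex_hilbert_space"
proof -
  have "inner x (cnj c *\<^sub>C y) = Re (cnj (cinner (cnj c *\<^sub>C y) x))"
    by (metis Re_cinner cinner_commute)
  also have "\<dots> = Re (c * cinner x y)" by (metis cinner_scaleC_left cinner_commute complex_cnj_cnj complex_cnj_mult)
  finally show ?thesis by (simp add: Re_cinner[symmetric] cinner_scaleC_left)
qed

lemma bounded_ops_apply: "T \<in> bounded_ops \<Longrightarrow> blinfun_apply T (c *\<^sub>C x) = c *\<^sub>C blinfun_apply T x"
  by (simp add: bounded_ops_def)

lemma scaleC_diff_right: "c *\<^sub>C (x - y) = c *\<^sub>C x - c *\<^sub>C (y :: 'h::complex_hilbert_space)"
  by (rule linear_diff[OF bounded_linear.linear[OF bounded_linear_scaleC]])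

text \<open>The imaginary part of the complex product is the real product with \<open>-\<i>\<close>
  times the first argument, so for complex-linear \<open>T\<close> the real identity already
  characterises \<open>adj\<close>. Later computations can stay with \<open>inner\<close>.\<close>

lemma adj_eqI:
  assumes T: "T \<in> bounded_ops" and S: "\<And>x y. inner (blinfun_apply T x) y = inner x (blinfun_apply S y)"
  shows "adj T = S"
  unfolding adj_def
proof (rule the_equality)
  show "\<forall>x y. cinner (T x) y = cinner x (S y)"
  proof (intro allI complex_eqI)
    fix x y
    show "Re (cinner (T x) y) = Re (cinner x (S y))" by (simp add: Re_cinner S)
    have im: "Im (cinner a b) = inner ((-\<i>) *\<^sub>C a) b" for a b :: 'a
      by (simp add: Re_cinner[symmetric] cinner_scaleC_left)
    show "Im (cinner (T x) y) = Im (cinner x (S y))"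
      unfolding im by (simp add: bounded_ops_apply[OF T, symmetric] S)
  qed
next
  fix S' assume S': "\<forall>x y. cinner (T x) y = cinner x (blinfun_apply S' y)"
  show "S' = S"
  proof (rule blinfun_eqI, rule inner_left_eqI)
    fix x y
    show "inner y (S' x) = inner y (S x)" using S' S by (metis Re_cinner)
  qed
qed

lemma adj_inner: "T \<in> bounded_ops \<Longrightarrow> inner (blinfun_apply T x) y = inner x (blinfun_apply (adj T) y)"
  by (metis adj_eqI real_adjoint_exists)

lemma adj_inner': "T \<in> bounded_ops \<Longrightarrow> inner x (blinfun_apply T y) = inner (blinfun_apply (adj T) x) y"
  by (metis adj_inner inner_commute)

lemma bounded_ops_adj: "T \<in> bounded_ops \<Longrightarrow> adj T \<in> bounded_ops"
proof -
  assume T: "T \<in> bounded_ops"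
  have "adj T (c *\<^sub>C y) = c *\<^sub>C adj T y" for c y
  proof (rule inner_left_eqI)
    fix x
    have "inner x (adj T (c *\<^sub>C y)) = inner (cnj c *\<^sub>C T x) y"
      by (simp add: adj_inner[OF T, symmetric] inner_scaleC_left)
    also have "\<dots> = inner x (c *\<^sub>C adj T y)"
      by (simp add: bounded_ops_apply[OF T, symmetric] adj_inner[OF T] inner_scaleC_left)
    finally show "inner x (adj T (c *\<^sub>C y)) = inner x (c *\<^sub>C adj T y)" .
  qed
  then show ?thesis by (simp add: bounded_ops_def)
qed

lemma adj_adj: "T \<in> bounded_ops \<Longrightarrow> adj (adj T) = T"
  by (rule adj_eqI) (auto simp: bounded_ops_adj adj_inner')

lemma bounded_ops_compose: "\<lbrakk>S \<in> bounded_ops; T \<in> bounded_ops\<rbrakk> \<Longrightarrow> S o\<^sub>L T \<in> bounded_ops"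
  by (simp add: bounded_ops_def)

lemma bounded_ops_add: "\<lbrakk>S \<in> bounded_ops; T \<in> bounded_ops\<rbrakk> \<Longrightarrow> S + T \<in> bounded_ops"
  by (simp add: bounded_ops_def blinfun.add_left scaleC_add_right)

lemma bounded_ops_diff: "\<lbrakk>S \<in> bounded_ops; T \<in> bounded_ops\<rbrakk> \<Longrightarrow> S - T \<in> bounded_ops"
  by (simp add: bounded_ops_def blinfun.diff_left scaleC_diff_right)

lemma bounded_ops_op_scaleC: "T \<in> bounded_ops \<Longrightarrow> op_scaleC c T \<in> bounded_ops"
  by (simp add: bounded_ops_def scaleC_scaleC mult.commute)

lemma bounded_ops_id: "id_blinfun \<in> bounded_ops" and bounded_ops_0: "0 \<in> bounded_ops"
  using norm_scaleC[of _ 0] by (auto simp: bounded_ops_def)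

lemma adj_compose: "\<lbrakk>S \<in> bounded_ops; T \<in> bounded_ops\<rbrakk> \<Longrightarrow> adj (S o\<^sub>L T) = adj T o\<^sub>L adj S"
  by (rule adj_eqI) (auto simp: bounded_ops_compose adj_inner)

lemma adj_add: "\<lbrakk>S \<in> bounded_ops; T \<in> bounded_ops\<rbrakk> \<Longrightarrow> adj (S + T) = adj S + adj T"
  by (rule adj_eqI) (auto simp: bounded_ops_add adj_inner blinfun.add_left inner_add_left inner_add_right)

lemma adj_diff: "\<lbrakk>S \<in> bounded_ops; T \<in> bounded_ops\<rbrakk> \<Longrightarrow> adj (S - T) = adj S - adj T"
  by (rule adj_eqI) (auto simp: bounded_ops_diff adj_inner blinfun.diff_left inner_diff_left inner_diff_right)

lemma adj_op_scaleC: "T \<in> bounded_ops \<Longrightarrow> adj (op_scaleC c T) = op_scaleC (cnj c) (adj T)"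
  by (rule adj_eqI) (auto simp: bounded_ops_op_scaleC adj_inner inner_scaleC_left bounded_ops_apply bounded_ops_adj)

lemma adj_id: "adj id_blinfun = id_blinfun" and adj_0: "adj 0 = 0"
  by (auto intro!: adj_eqI simp: bounded_ops_id bounded_ops_0)

lemma scaleR_eq_op_scaleC: "r *\<^sub>R T = op_scaleC (complex_of_real r) T"
  by (rule blinfun_eqI) (simp add: scaleC_of_real blinfun.scaleR_left)

lemma orth_proj_bounded_ops:
  assumes "subspace V" "closed V" "\<And>c h. h \<in> V \<Longrightarrow> c *\<^sub>C h \<in> V"
  shows "orth_proj V \<in> bounded_ops"
  unfolding bounded_ops_def mem_Collect_eq
proof (intro allI)
  show "orth_proj V (c *\<^sub>C x) = c *\<^sub>C orth_proj V x" for c x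
    using assms by (intro orth_proj_commute[where g="\<lambda>x. cnj c *\<^sub>C x"])
      (auto simp: complete_eq_closed inner_scaleC_left scaleC_diff_right)
qed

lemma is_projection_orth_proj:
  assumes "subspace V" "closed V" "\<And>c h. h \<in> V \<Longrightarrow> c *\<^sub>C h \<in> V"
  shows "is_projection (orth_proj V)"
  unfolding is_projection_def using assms
  by (auto simp: orth_proj_bounded_ops orth_proj_idem complete_eq_closed orth_proj_inner intro!: adj_eqI)

section \<open>Closures of subspaces and extension of densely defined maps\<close>

lemma subspace_closure:
  fixes V :: "'a::real_normed_vector set"
  assumes V: "subspace V"
  shows "subspace (closure V)"
proof (rule subspaceI)
  show "0 \<in> closure V" using subspace_0[OF V] closure_subset by blast
next
  fix x y assume "x \<in> closure V" "y \<in> closure V"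
  then obtain f g where fg: "\<And>n::nat. f n \<in> V" "f \<longlonglongrightarrow> x" "\<And>n::nat. g n \<in> V" "g \<longlonglongrightarrow> y"
    unfolding closure_sequential by blast
  then show "x + y \<in> closure V" unfolding closure_sequential
    using subspace_add[OF V] by (intro exI[of _ "\<lambda>n. f n + g n"]) (auto intro: tendsto_add)
next
  fix c x assume "x \<in> closure V"
  then obtain f where f: "\<And>n::nat. f n \<in> V" "f \<longlonglongrightarrow> x"
    unfolding closure_sequential by blast
  then show "c *\<^sub>R x \<in> closure V" unfolding closure_sequential
    using subspace_scale[OF V] by (intro exI[of _ "\<lambda>n. c *\<^sub>R f n"]) (auto intro: tendsto_scaleR)
qed

lemma closure_invariant:
  assumes "continuous_on UNIV f" "\<And>x. x \<in> V \<Longrightarrow> f x \<in> W" "x \<in> closure V"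
  shows "f x \<in> closure W"
proof -
  have "f ` closure V \<subseteq> closure W"
    using assms by (intro image_closure_subset) (auto intro: continuous_on_subset closure_subset[THEN subsetD])
  then show ?thesis using assms(3) by blast
qed

lemma inner_closure_eq_0:
  assumes "\<And>k. k \<in> V \<Longrightarrow> inner x k = 0" "k \<in> closure V"
  shows "inner x k = 0"
proof -
  have "inner x k \<in> closure {0}"
    by (rule closure_invariant[of "inner x" V "{0}"]) (use assms in \<open>auto intro!: continuous_intros\<close>)
  then show ?thesis by simp
qed

text \<open>The closure of \<open>D\<close> and the orthogonal complement of \<open>D\<close> span
  the space, and continuity handles the closure. In the applications both operators vanish on the
  complement.\<close>

lemma blinfun_eq_on_orthogonal_decomposition:
  fixes S T :: "'a::{real_inner,complete_space} \<Rightarrow>\<^sub>L 'b::real_normed_vector"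
  assumes D: "subspace D" and "\<And>h. h \<in> D \<Longrightarrow> S h = T h"
    and "\<And>g. (\<And>h. h \<in> D \<Longrightarrow> inner g h = 0) \<Longrightarrow> S g = T g"
  shows "S = T"
proof (rule blinfun_eqI)
  fix x
  let ?P = "orth_proj (closure D)"
  have c: "subspace (closure D)" "complete (closure D)" using D by (auto simp: subspace_closure complete_eq_closed)
  have "(S - T) (?P x) \<in> closure {0}"
    by (rule closure_invariant[OF _ _ orth_proj_in[OF c]])
       (auto simp: assms(2) blinfun.diff_left intro!: continuous_intros)
  moreover have "S (x - ?P x) = T (x - ?P x)"
    by (intro assms(3) orth_proj_orthogonal[OF c]) (use closure_subset in blast)
  ultimately show "S x = T x" by (simp add: blinfun.diff_left blinfun.diff_right)
qed

text \<open>The bound makes \<open>R\<close> the graph of a map, since a pair over 0 has second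
  entry 0. Relations are the input because formulas such as \<open>y (q \<eta>)\<close> to
  \<open>\<theta> (y o\<^sub>L q) \<xi>\<close> are well defined only through the bound.\<close>

lemma linear_relation_extension:
  fixes R :: "('a::{real_inner,complete_space} \<times> 'b::banach) set"
  assumes R: "subspace R" and bd: "\<And>h k. (h, k) \<in> R \<Longrightarrow> norm k \<le> C * norm h"
  obtains T :: "'a \<Rightarrow>\<^sub>L 'b" where "\<And>h k. (h, k) \<in> R \<Longrightarrow> T h = k"
    and "\<And>g. (\<And>h k. (h, k) \<in> R \<Longrightarrow> inner g h = 0) \<Longrightarrow> T g = 0"
    and "\<And>g. T g \<in> closure (snd ` R)"
proof -
  have bd': "norm k \<le> C * norm h" if hk: "(h, k) \<in> closure R" for h k
  proof -
    have "(\<lambda>z. C * norm (fst z) - norm (snd z)) (h, k) \<in> closure {0..}"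
      by (rule closure_invariant[OF _ _ hk]) (use bd in \<open>auto intro!: continuous_intros\<close>)
    then show ?thesis by simp
  qed
  have R': "subspace (closure R)" by (rule subspace_closure[OF R])
  define V where "V = fst ` closure R"
  have V: "subspace V" unfolding V_def by (intro linear_subspace_image R' bounded_linear.linear bounded_linear_fst)
  have "\<exists>k. (h, k) \<in> closure R" if "h \<in> V" for h using that by (auto simp: V_def)
  then obtain f where f: "\<And>h. h \<in> V \<Longrightarrow> (h, f h) \<in> closure R" by metis
  have uniq: "k = k'" if "(h, k) \<in> closure R" "(h, k') \<in> closure R" for h k k'
    using bd'[of 0 "k - k'"] subspace_diff[OF R' that] by simp
  have fd: "norm (f h - f h') \<le> C * norm (h - h')" if "h \<in> V" "h' \<in> V" for h h'
    using subspace_diff[OF R' f[OF that(1)] f[OF that(2)]] bd' by simp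
  have "complete V" unfolding complete_def
  proof (intro allI impI)
    fix h assume h: "(\<forall>n. h n \<in> V) \<and> Cauchy h"
    then obtain l where l: "h \<longlonglongrightarrow> l" using Cauchy_convergent convergent_def by blast
    have "Cauchy (\<lambda>n. f (h n))"
    proof (rule metric_CauchyI)
      fix e :: real assume e: "0 < e"
      have pos: "0 < e / (\<bar>C\<bar> + 1)" using e by simp
      obtain N where N: "\<And>m n. m \<ge> N \<Longrightarrow> n \<ge> N \<Longrightarrow> dist (h m) (h n) < e / (\<bar>C\<bar> + 1)"
        using h pos unfolding Cauchy_def by meson
      have "dist (f (h m)) (f (h n)) < e" if "m \<ge> N" "n \<ge> N" for m n
      proof -
        have "norm (f (h m) - f (h n)) \<le> C * norm (h m - h n)" using fd h by blast
        also have "\<dots> \<le> (\<bar>C\<bar> + 1) * norm (h m - h n)" by (intro mult_right_mono) auto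
        also have "\<dots> < e" using N[OF that] by (simp add: dist_norm pos_less_divide_eq mult.commute)
        finally show ?thesis by (simp add: dist_norm)
      qed
      then show "\<exists>M. \<forall>m\<ge>M. \<forall>n\<ge>M. dist (f (h m)) (f (h n)) < e" by blast
    qed
    then obtain k where k: "(\<lambda>n. f (h n)) \<longlonglongrightarrow> k" using Cauchy_convergent convergent_def by blast
    have "(l, k) \<in> closure R"
      by (rule closed_sequentially[OF closed_closure _ tendsto_Pair[OF l k]]) (use f h in auto)
    then show "\<exists>l\<in>V. h \<longlonglongrightarrow> l" using l unfolding V_def by force
  qed
  note V = V this
  have fI: "f h = k" if "(h, k) \<in> closure R" for h k
  proof -
    have "h \<in> V" using that by (force simp: V_def)
    from f[OF this] that show ?thesis by (rule uniq)
  qed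
  define F where "F = (\<lambda>g. f (orth_proj V g))"
  have F: "(orth_proj V g, F g) \<in> closure R" for g unfolding F_def by (intro f orth_proj_in V)
  have C: "norm (orth_proj V g) \<le> norm g" for g
  proof -
    have "(norm (orth_proj V g))\<^sup>2 = inner g (orth_proj V g)"
      by (simp add: power2_norm_eq_inner orth_proj_inner[OF V] orth_proj_fixed[OF V] orth_proj_in[OF V])
    also have "\<dots> \<le> norm g * norm (orth_proj V g)" by (rule norm_cauchy_schwarz)
    finally show ?thesis by (cases "norm (orth_proj V g) = 0") (simp_all add: power2_eq_square)
  qed
  have "bounded_linear F"
  proof (rule bounded_linear_intro[where K="\<bar>C\<bar>"])
    show "F (x + y) = F x + F y" for x y
      unfolding F_def[of] blinfun.add_right
      using subspace_add[OF R' F[of x] F[of y]] by (intro fI) (simp add: F_def)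
    show "F (r *\<^sub>R x) = r *\<^sub>R F x" for r x
      unfolding F_def[of] blinfun.scaleR_right
      using subspace_scale[OF R' F[of x], of r] by (intro fI) (simp add: F_def)
    show "norm (F x) \<le> norm x * \<bar>C\<bar>" for x
    proof -
      have "norm (F x) \<le> C * norm (orth_proj V x)" by (rule bd'[OF F])
      also have "\<dots> \<le> \<bar>C\<bar> * norm (orth_proj V x)" by (intro mult_right_mono) auto
      also have "\<dots> \<le> \<bar>C\<bar> * norm x" by (intro mult_left_mono C) auto
      finally show ?thesis by (simp add: mult.commute)
    qed
  qed
  then have ap: "blinfun_apply (Blinfun F) = F" by (rule bounded_linear_Blinfun_apply)
  show ?thesis
  proof (rule that[of "Blinfun F"]; unfold ap)
    show "F h = k" if "(h, k) \<in> R" for h k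
    proof -
      have hk: "(h, k) \<in> closure R" using that closure_subset by blast
      then have "orth_proj V h = h" by (intro orth_proj_fixed V) (force simp: V_def)
      then show ?thesis using hk fI by (simp add: F_def)
    qed
    show "F g = 0" if g: "\<And>h k. (h, k) \<in> R \<Longrightarrow> inner g h = 0" for g
    proof -
      have "orth_proj V g = 0"
      proof (rule orth_proj_eq_0[OF V])
        fix h assume "h \<in> V"
        then have "h \<in> closure (fst ` R)"
          unfolding V_def by (elim imageE) (auto intro!: closure_invariant[where f=fst and V=R] continuous_intros)
        then show "inner g h = 0" by (rule inner_closure_eq_0[rotated]) (use g in force)
      qed
      then show ?thesis using fI[of 0 0] subspace_0[OF R'] by (simp add: F_def zero_prod_def)
    qed
    show "F g \<in> closure (snd ` R)" for g
      using closure_invariant[of snd R "snd ` R", OF _ _ F[of g]] by (simp add: continuous_on_snd)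
  qed
qed

text \<open>Invariance of \<open>R\<close> gives the identity on the domain; invariance of the
  domain under the adjoint \<open>X'\<close> makes \<open>X\<close> preserve the orthogonal
  complement, where \<open>T\<close> vanishes.\<close>

lemma linear_relation_extension_intertwine:
  fixes T :: "'a::{real_inner,complete_space} \<Rightarrow>\<^sub>L 'b::banach" and X X' :: "'a \<Rightarrow>\<^sub>L 'a" and Y :: "'b \<Rightarrow>\<^sub>L 'b"
  assumes R: "subspace R" and T: "\<And>h k. (h, k) \<in> R \<Longrightarrow> T h = k"
    and T0: "\<And>g. (\<And>h k. (h, k) \<in> R \<Longrightarrow> inner g h = 0) \<Longrightarrow> T g = 0"
    and S: "\<And>h k. (h, k) \<in> R \<Longrightarrow> (X h, Y k) \<in> R"
    and S': "\<And>h k. (h, k) \<in> R \<Longrightarrow> \<exists>k'. (X' h, k') \<in> R"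
    and X': "\<And>x y. inner (blinfun_apply X x) y = inner x (blinfun_apply X' y)"
  shows "T o\<^sub>L X = Y o\<^sub>L T"
proof (rule blinfun_eq_on_orthogonal_decomposition)
  show "subspace (fst ` R)" by (intro linear_subspace_image R bounded_linear.linear bounded_linear_fst)
  show "(T o\<^sub>L X) h = (Y o\<^sub>L T) h" if "h \<in> fst ` R" for h
    using that T S by (fastforce simp: image_iff)
  show "(T o\<^sub>L X) g = (Y o\<^sub>L T) g" if g: "\<And>h. h \<in> fst ` R \<Longrightarrow> inner g h = 0" for g
  proof -
    have "T g = 0" by (rule T0) (use g in force)
    moreover have "T (X g) = 0"
    proof (rule T0)
      fix h k assume "(h, k) \<in> R"
      then obtain k' where "(X' h, k') \<in> R" using S' by blast
      then show "inner (X g) h = 0" unfolding X' using g by force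
    qed
    ultimately show ?thesis by (simp add: blinfun.zero_right)
  qed
qed

section \<open>The double commutant theorem\<close>

abbreviation "lookup \<equiv> Poly_Mapping.lookup"
abbreviation "keys \<equiv> Poly_Mapping.keys"

instantiation poly_mapping :: (type, real_vector) real_vector
begin

lift_definition scaleR_poly_mapping :: "real \<Rightarrow> ('a \<Rightarrow>\<^sub>0 'b) \<Rightarrow> 'a \<Rightarrow>\<^sub>0 'b"
  is "\<lambda>r f k. r *\<^sub>R f k"
  by (rule finite_subset) auto

instance
  by standard (transfer; simp add: scaleR_add_right scaleR_add_left fun_eq_iff)+

end

lemma lookup_scaleR: "lookup (r *\<^sub>R f) k = r *\<^sub>R lookup f k"
  by transfer simp

text \<open>The algebraic direct sum of copies of one space: a single type that holds all finite
  amplifications, whatever the number of vectors to be approximated.\<close>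

instantiation poly_mapping :: (type, real_inner) real_inner
begin

definition inner_poly_mapping :: "('a \<Rightarrow>\<^sub>0 'b) \<Rightarrow> ('a \<Rightarrow>\<^sub>0 'b) \<Rightarrow> real"
  where "inner_poly_mapping f g = (\<Sum>k\<in>keys f. inner (lookup f k) (lookup g k))"

definition norm_poly_mapping :: "('a \<Rightarrow>\<^sub>0 'b) \<Rightarrow> real"
  where "norm_poly_mapping f = sqrt (inner f f)"

definition sgn_poly_mapping :: "('a \<Rightarrow>\<^sub>0 'b) \<Rightarrow> ('a \<Rightarrow>\<^sub>0 'b)"
  where "sgn_poly_mapping f = f /\<^sub>R norm f"

definition dist_poly_mapping :: "('a \<Rightarrow>\<^sub>0 'b) \<Rightarrow> ('a \<Rightarrow>\<^sub>0 'b) \<Rightarrow> real"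
  where "dist_poly_mapping f g = norm (f - g)"

definition uniformity_poly_mapping :: "(('a \<Rightarrow>\<^sub>0 'b) \<times> ('a \<Rightarrow>\<^sub>0 'b)) filter"
  where "uniformity_poly_mapping = (INF e\<in>{0<..}. principal {(x, y). dist x y < e})"

definition open_poly_mapping :: "('a \<Rightarrow>\<^sub>0 'b) set \<Rightarrow> bool"
  where "open_poly_mapping U \<longleftrightarrow> (\<forall>x\<in>U. eventually (\<lambda>(x', y). x' = x \<longrightarrow> y \<in> U) uniformity)"

lemma inner_poly_mapping_superset:
  fixes f g :: "'a \<Rightarrow>\<^sub>0 'b"
  assumes "finite F" "keys f \<subseteq> F"
  shows "inner f g = (\<Sum>k\<in>F. inner (lookup f k) (lookup g k))"
  unfolding inner_poly_mapping_def
  by (rule sum.mono_neutral_left) (use assms in \<open>auto simp: in_keys_iff\<close>)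

instance
proof
  fix f g h :: "'a \<Rightarrow>\<^sub>0 'b" and r :: real
  let ?F = "keys f \<union> keys g \<union> keys h"
  have F: "finite ?F" by simp
  show "inner f g = inner g f"
    by (simp add: inner_poly_mapping_superset[OF F] le_supI1 inner_commute)
  have "keys (f + g) \<subseteq> ?F" using keys_add[of f g] by blast
  then show "inner (f + g) h = inner f h + inner g h"
    by (simp add: inner_poly_mapping_superset[OF F] le_supI1 lookup_add inner_add_left sum.distrib)
  have "keys (r *\<^sub>R f) \<subseteq> ?F" by (auto simp: in_keys_iff lookup_scaleR)
  then show "inner (r *\<^sub>R f) g = r * inner f g"
    by (simp add: inner_poly_mapping_superset[OF F] le_supI1 lookup_scaleR sum_distrib_left)
  show "0 \<le> inner f f" by (simp add: inner_poly_mapping_def sum_nonneg)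
  show "(inner f f = 0) = (f = 0)"
  proof
    assume "inner f f = 0"
    then have "\<forall>k\<in>keys f. lookup f k = 0" by (simp add: inner_poly_mapping_def sum_nonneg_eq_0_iff)
    then show "f = 0" by (intro poly_mapping_eqI) (metis in_keys_iff lookup_zero)
  qed (simp add: inner_poly_mapping_def)
qed (simp_all only: norm_poly_mapping_def sgn_poly_mapping_def dist_poly_mapping_def
       uniformity_poly_mapping_def open_poly_mapping_def)

end

lemma norm_lookup_le: "norm (lookup f k) \<le> norm (f :: 'a \<Rightarrow>\<^sub>0 'b::real_inner)"
proof -
  have F: "finite (insert k (keys f))" by simp
  have "inner (lookup f k) (lookup f k) \<le> inner f f"
    unfolding inner_poly_mapping_superset[OF F subset_insertI]
    by (rule member_le_sum[of k _ "\<lambda>k. inner (lookup f k) (lookup f k)"]) auto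
  then show ?thesis by (simp add: norm_eq_sqrt_inner)
qed

lemma bounded_linear_lookup: "bounded_linear (\<lambda>f :: 'a \<Rightarrow>\<^sub>0 'b::real_inner. lookup f k)"
  by (rule bounded_linear_intro[where K=1]) (auto simp: lookup_add lookup_scaleR norm_lookup_le)

lemma bounded_linear_single: "bounded_linear (Poly_Mapping.single k :: 'b::real_inner \<Rightarrow> 'a \<Rightarrow>\<^sub>0 'b)"
proof (rule bounded_linear_intro[where K=1])
  show "Poly_Mapping.single k (r *\<^sub>R x) = r *\<^sub>R Poly_Mapping.single k x" for r and x :: 'b
    by (intro poly_mapping_eqI) (simp add: lookup_scaleR lookup_single when_def)
  show "norm (Poly_Mapping.single k x) \<le> norm x * 1" for x :: 'b
    using inner_poly_mapping_superset[of "{k}" "Poly_Mapping.single k x"]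
    by (simp add: norm_eq_sqrt_inner)
qed (rule single_add)

text \<open>Limits are taken coordinatewise and reassembled as a finite sum. This supplies the
  completeness needed to project inside the direct sum.\<close>

lemma complete_keys_subset:
  assumes F: "finite F"
  shows "complete {f :: 'a \<Rightarrow>\<^sub>0 'b::{real_inner,complete_space}. keys f \<subseteq> F}"
  unfolding complete_def
proof (intro allI impI, elim conjE)
  fix X :: "nat \<Rightarrow> 'a \<Rightarrow>\<^sub>0 'b" assume X: "\<forall>n. X n \<in> {f. keys f \<subseteq> F}" "Cauchy X"
  have "Cauchy (\<lambda>n. lookup (X n) k)" for k
    by (rule bounded_linear.Cauchy[OF bounded_linear_lookup X(2)])
  then have "\<exists>l. (\<lambda>n. lookup (X n) k) \<longlonglongrightarrow> l" for k using Cauchy_convergent convergent_def by blast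
  then obtain l where l: "\<And>k. (\<lambda>n. lookup (X n) k) \<longlonglongrightarrow> l k" by metis
  define L where "L = (\<Sum>k\<in>F. Poly_Mapping.single k (l k))"
  have XF: "X n = (\<Sum>k\<in>F. Poly_Mapping.single k (lookup (X n) k))" for n
  proof (rule poly_mapping_eqI)
    fix i
    have "keys (X n) \<subseteq> F" using X by blast
    then show "lookup (X n) i = lookup (\<Sum>k\<in>F. Poly_Mapping.single k (lookup (X n) k)) i"
      using F by (auto simp: lookup_sum lookup_single when_def in_keys_iff)
  qed
  have "keys L \<subseteq> F"
    unfolding L_def by (rule order.trans[OF keys_sum]) auto
  moreover have "X \<longlonglongrightarrow> L"
  proof -
    have "(\<lambda>n. \<Sum>k\<in>F. Poly_Mapping.single k (lookup (X n) k)) \<longlonglongrightarrow> L"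
      unfolding L_def by (intro tendsto_sum bounded_linear.tendsto[OF bounded_linear_single] l)
    then show ?thesis using XF by simp
  qed
  ultimately show "\<exists>l\<in>{f. keys f \<subseteq> F}. X \<longlonglongrightarrow> l" by blast
qed

text \<open>A basic neighbourhood in the product topology constrains finitely many coordinates,
  which become \<open>F\<close>, and each constraint contains a ball.\<close>

lemma strong_operator_closed_memI:
  fixes A :: "('h::complex_hilbert_space \<Rightarrow>\<^sub>L 'h) set"
  assumes A: "closedin (subtopology strong_operator_topology bounded_ops) A" and T: "T \<in> bounded_ops"
    and approx: "\<And>F e. finite F \<Longrightarrow> 0 < e \<Longrightarrow> \<exists>S\<in>A. \<forall>h\<in>F. norm (T h - S h) < e"
  shows "T \<in> A"
proof (rule ccontr)
  assume "T \<notin> A"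
  have "openin (subtopology strong_operator_topology bounded_ops) (bounded_ops - A)"
    using A by (simp add: closedin_def strong_operator_topology_topspace)
  then obtain U where U: "openin strong_operator_topology U" "bounded_ops - A = U \<inter> bounded_ops"
    by (auto simp: openin_subtopology)
  then obtain V where V: "open V" "U = blinfun_apply -` V"
    by (auto simp: strong_operator_topology_def openin_pullback_topology)
  have "blinfun_apply T \<in> V" using \<open>T \<notin> A\<close> T U V by blast
  then obtain X where X: "blinfun_apply T \<in> (\<Pi>\<^sub>E i\<in>UNIV. X i)" "\<And>i. open (X i)"
    "finite {i. X i \<noteq> UNIV}" "(\<Pi>\<^sub>E i\<in>UNIV. X i) \<subseteq> V"
    using product_topology_open_contains_basis[of "\<lambda>_. euclidean" UNIV V "blinfun_apply T"] V(1)
    by (auto simp: open_fun_def)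
  define F where "F = {i. X i \<noteq> UNIV}"
  have "\<exists>e>0. ball (T i) e \<subseteq> X i" for i
    using X(1,2) open_contains_ball by (metis PiE_mem UNIV_I)
  then obtain e where e: "\<And>i. e i > 0" "\<And>i. ball (T i) (e i) \<subseteq> X i" by metis
  \<comment> \<open>The inserted 1 keeps the minimum defined when \<open>F\<close> is empty.\<close>
  define d where "d = Min (insert 1 (e ` F))"
  have F: "finite F" using X(3) by (simp add: F_def)
  have d: "d > 0" "\<And>i. i \<in> F \<Longrightarrow> d \<le> e i" using F e(1) by (auto simp: d_def)
  obtain S where S: "S \<in> A" "\<forall>h\<in>F. norm (T h - S h) < d" using approx[OF F d(1)] by blast
  have "S i \<in> X i" for i
  proof (cases "i \<in> F")
    case True
    then have "S i \<in> ball (T i) (e i)" using S(2) d(2) by (force simp: dist_norm)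
    then show ?thesis using e(2) by blast
  qed (simp add: F_def)
  then have "blinfun_apply S \<in> V" using X(4) by auto
  moreover have "S \<in> bounded_ops"
    using closedin_subset[OF A] S(1) by auto
  ultimately show False using U(2) V(2) S(1) by blast
qed

lift_definition amplify :: "('b::real_normed_vector \<Rightarrow>\<^sub>L 'b) \<Rightarrow> ('a \<Rightarrow>\<^sub>0 'b) \<Rightarrow> ('a \<Rightarrow>\<^sub>0 'b)"
  is "\<lambda>S f k. blinfun_apply S (f k)"
  by (rule finite_subset) (auto simp: blinfun.zero_right)

lemma lookup_amplify: "lookup (amplify S f) k = S (lookup f k)"
  by transfer simp

lemma amplify_diff: "amplify S (f - g) = amplify S f - amplify S g"
  by (rule poly_mapping_eqI) (simp add: lookup_amplify lookup_minus blinfun.diff_right)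

lemma amplify_single: "amplify S (Poly_Mapping.single k x) = Poly_Mapping.single k (S x)"
  by (rule poly_mapping_eqI) (simp add: lookup_amplify lookup_single when_def blinfun.zero_right)

lemma bounded_linear_amplify: "bounded_linear (amplify S :: ('a \<Rightarrow>\<^sub>0 'b::real_inner) \<Rightarrow> _)"
proof (rule bounded_linear_intro[where K="norm S"])
  show "norm (amplify S f) \<le> norm f * norm S" for f :: "'a \<Rightarrow>\<^sub>0 'b"
  proof (rule power2_le_imp_le)
    have "keys (amplify S f) \<subseteq> keys f" by (auto simp: in_keys_iff lookup_amplify blinfun.zero_right)
    then have "(norm (amplify S f))\<^sup>2 = (\<Sum>k\<in>keys f. (norm (S (lookup f k)))\<^sup>2)"
      by (simp add: power2_norm_eq_inner inner_poly_mapping_superset[of "keys f"] lookup_amplify)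
    also have "\<dots> \<le> (\<Sum>k\<in>keys f. (norm S * norm (lookup f k))\<^sup>2)"
      by (intro sum_mono power_mono norm_blinfun) auto
    also have "\<dots> = (norm f * norm S)\<^sup>2"
      by (simp add: power_mult_distrib sum_distrib_left[symmetric] power2_norm_eq_inner inner_poly_mapping_def mult.commute)
    finally show "(norm (amplify S f))\<^sup>2 \<le> (norm f * norm S)\<^sup>2" .
  qed simp
qed (auto intro!: poly_mapping_eqI simp: lookup_amplify lookup_add lookup_scaleR blinfun.add_right blinfun.scaleR_right)

lemma inner_amplify:
  assumes "\<And>x y. inner (blinfun_apply S x) y = inner x (blinfun_apply S' y)"
  shows "inner (amplify S f) g = inner f (amplify S' g)"
proof -
  have "keys (amplify S f) \<subseteq> keys f" by (auto simp: in_keys_iff lookup_amplify blinfun.zero_right)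
  then have "inner (amplify S f) g = (\<Sum>k\<in>keys f. inner (lookup (amplify S f) k) (lookup g k))"
    by (intro inner_poly_mapping_superset) auto
  then show ?thesis by (simp add: inner_poly_mapping_def lookup_amplify assms)
qed

lemma von_neumann_algebraD:
  assumes "von_neumann_algebra A"
  shows "A \<subseteq> bounded_ops" "id_blinfun \<in> A" "\<lbrakk>S \<in> A; T \<in> A\<rbrakk> \<Longrightarrow> S + T \<in> A" "T \<in> A \<Longrightarrow> op_scaleC c T \<in> A"
    "\<lbrakk>S \<in> A; T \<in> A\<rbrakk> \<Longrightarrow> S o\<^sub>L T \<in> A" "T \<in> A \<Longrightarrow> adj T \<in> A"
    "closedin (subtopology strong_operator_topology bounded_ops) A"
  using assms by (auto simp: von_neumann_algebra_def)

text \<open>Von Neumann's density argument. The projection onto the closed orbit of \<open>f\<close>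
  under the amplified algebra commutes with that algebra, so its matrix entries lie in
  \<open>commutant A\<close>. Hence \<open>T\<close> commutes with them, and the amplified
  \<open>T\<close> keeps \<open>f\<close> in the closed orbit, where elements of \<open>A\<close>
  approximate it.\<close>

theorem double_commutant:
  fixes A :: "('h::complex_hilbert_space \<Rightarrow>\<^sub>L 'h) set"
  assumes A: "von_neumann_algebra A"
  shows "commutant (commutant A) = A"
proof
  note vN = von_neumann_algebraD[OF A]
  show "A \<subseteq> commutant (commutant A)" using vN(1) by (auto simp: commutant_def)
  show "commutant (commutant A) \<subseteq> A"
  proof
    fix T assume T: "T \<in> commutant (commutant A)"
    show "T \<in> A"
    proof (rule strong_operator_closed_memI[OF vN(7)])
      show "T \<in> bounded_ops" using T by (simp add: commutant_def)
      fix F :: "'h set" and e :: real assume F: "finite F" and e: "0 < e"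
      \<comment> \<open>The vectors of \<open>F\<close> serve as their own indices: the coordinate
        of \<open>f\<close> at \<open>h\<close> is \<open>h\<close>.\<close>
      define f where "f = (\<Sum>h\<in>F. Poly_Mapping.single h h)"
      define V0 where "V0 = (\<lambda>S. amplify S f) ` A"
      define V where "V = closure V0"
      have scR: "r *\<^sub>R S \<in> A" if "S \<in> A" for r S using vN(4)[OF that] by (simp add: scaleR_eq_op_scaleC)
      have "subspace V0"
      proof (rule subspaceI)
        have "amplify 0 f = 0" by (rule poly_mapping_eqI) (simp add: lookup_amplify)
        then show "0 \<in> V0" using scR[OF vN(2), of 0] by (force simp: V0_def)
        have "amplify S f + amplify S' f = amplify (S + S') f" for S S'
          by (rule poly_mapping_eqI) (simp add: lookup_amplify lookup_add blinfun.add_left)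
        then show "x + y \<in> V0" if "x \<in> V0" "y \<in> V0" for x y
          using that vN(3) by (auto simp: V0_def)
        have "r *\<^sub>R amplify S f = amplify (r *\<^sub>R S) f" for S r
          by (rule poly_mapping_eqI) (simp add: lookup_amplify lookup_scaleR blinfun.scaleR_left)
        then show "r *\<^sub>R x \<in> V0" if "x \<in> V0" for r x
          using that scR by (auto simp: V0_def)
      qed
      then have sV: "subspace V" unfolding V_def by (rule subspace_closure)
      have kf: "keys f \<subseteq> F" unfolding f_def by (rule order.trans[OF keys_sum]) auto
      have "V0 \<subseteq> {f. keys f \<subseteq> F}"
        using kf by (fastforce simp: V0_def in_keys_iff lookup_amplify blinfun.zero_right)
      then have "V \<subseteq> {f. keys f \<subseteq> F}"
        unfolding V_def by (rule closure_minimal) (intro complete_imp_closed complete_keys_subset F)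
      then have cV: "complete V"
        using complete_keys_subset[OF F] unfolding V_def by (metis closed_closure complete_Int_closed inf.absorb2)
      have inv: "amplify S k \<in> V" if S: "S \<in> A" and k: "k \<in> V" for S k
        unfolding V_def
      proof (rule closure_invariant[OF _ _ k[unfolded V_def]])
        show "continuous_on UNIV (amplify S)" by (intro linear_continuous_on bounded_linear_amplify)
        have "amplify S (amplify S' f) = amplify (S o\<^sub>L S') f" for S'
          by (rule poly_mapping_eqI) (simp add: lookup_amplify)
        then show "amplify S x \<in> V0" if "x \<in> V0" for x using that vN(5) S by (auto simp: V0_def)
      qed
      have P_amplify: "orth_proj V (amplify S g) = amplify S (orth_proj V g)" if S: "S \<in> A" for S g
      proof (rule orth_proj_commute[OF sV cV])
        show "inner (amplify S x) y = inner x (amplify (adj S) y)" for x y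
          by (rule inner_amplify) (use S vN(1) adj_inner in blast)
      qed (use S vN(6) in \<open>auto intro: inv simp: amplify_diff\<close>)
      \<comment> \<open>Matrix entries of the projection. Since scalar operators belong to
        \<open>A\<close>, commuting with \<open>A\<close> also gives their complex
        linearity.\<close>
      define E where "E i j = Blinfun (\<lambda>x. lookup (orth_proj V (Poly_Mapping.single j x)) i)" for i j
      have E: "E i j x = lookup (orth_proj V (Poly_Mapping.single j x)) i" for i j x
        unfolding E_def
        by (subst bounded_linear_Blinfun_apply)
          (intro bounded_linear_compose[OF bounded_linear_lookup] bounded_linear_compose[OF blinfun.bounded_linear_right]
            bounded_linear_single, rule refl)
      have E_comm: "E i j o\<^sub>L S = S o\<^sub>L E i j" if "S \<in> A" for i j S
        by (rule blinfun_eqI) (simp add: E amplify_single[symmetric] P_amplify[OF that] lookup_amplify)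
      have "E i j \<in> bounded_ops" for i j
        unfolding bounded_ops_def mem_Collect_eq
      proof (intro allI)
        fix c x show "E i j (c *\<^sub>C x) = c *\<^sub>C E i j x"
          using compose_eq_apply[OF E_comm[OF vN(4)[OF vN(2), of c]], of i j x] by simp
      qed
      then have "E i j \<in> commutant A" for i j using E_comm by (simp add: commutant_def)
      then have TE: "T (E i j x) = E i j (T x)" for i j x
        using T by (auto simp: commutant_def intro!: compose_eq_apply)
      have "amplify id_blinfun f = f" by (rule poly_mapping_eqI) (simp add: lookup_amplify)
      then have "f \<in> V0" unfolding V0_def using vN(2) by (metis imageI)
      then have "f \<in> V" unfolding V_def using closure_subset by blast
      have aT: "amplify T f = (\<Sum>h\<in>F. Poly_Mapping.single h (T h))"
        by (simp add: f_def linear_sum[OF bounded_linear.linear[OF bounded_linear_amplify]] amplify_single)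
      have "orth_proj V (amplify T f) = amplify T f"
      proof (rule poly_mapping_eqI)
        fix i
        have "lookup (orth_proj V (amplify T f)) i = (\<Sum>h\<in>F. E i h (T h))"
          by (simp add: aT E blinfun.sum_right lookup_sum)
        also have "\<dots> = T (\<Sum>h\<in>F. E i h h)" by (simp add: TE blinfun.sum_right)
        also have "(\<Sum>h\<in>F. E i h h) = lookup (orth_proj V f) i"
          by (simp add: f_def E blinfun.sum_right lookup_sum)
        also have "orth_proj V f = f" by (rule orth_proj_fixed[OF sV cV \<open>f \<in> V\<close>])
        finally show "lookup (orth_proj V (amplify T f)) i = lookup (amplify T f) i"
          by (simp add: lookup_amplify)
      qed
      then have "amplify T f \<in> closure V0" using orth_proj_in[OF sV cV, of "amplify T f"] by (simp add: V_def)
      then obtain S where S: "S \<in> A" "dist (amplify S f) (amplify T f) < e"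
        unfolding closure_approachable V0_def using e by blast
      have "norm (T h - S h) < e" if "h \<in> F" for h
      proof -
        have "lookup f h = h" using that F by (simp add: f_def lookup_sum lookup_single when_def)
        then have "norm (T h - S h) \<le> norm (amplify T f - amplify S f)"
          using norm_lookup_le[of "amplify T f - amplify S f" h] by (simp add: lookup_minus lookup_amplify)
        also have "\<dots> < e" using S(2) by (simp add: dist_norm norm_minus_commute)
        finally show ?thesis .
      qed
      then show "\<exists>S\<in>A. \<forall>h\<in>F. norm (T h - S h) < e" using S(1) by blast
    qed
  qed
qed

section \<open>Square roots, unitaries and polar decomposition\<close>

text \<open>The limit \<open>Y\<close> of the iteration \<open>y \<mapsto> (a + y\<^sup>2) / 2\<close> solves \<open>(1 - Y)\<^sup>2 = 1 - a\<close>. Its increments are dominated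
  by those of the scalar iteration for \<open>a = 1\<close>, which is bounded by \<open>1\<close>.\<close>

lemma op_sqrt_exists:
  fixes a :: "'a::{real_inner,banach} \<Rightarrow>\<^sub>L 'a"
  assumes a: "norm a \<le> 1" and sym: "\<And>x y. inner (a x) y = inner x (a y)"
  obtains s where "s o\<^sub>L s = id_blinfun - a" "\<And>b. a o\<^sub>L b = b o\<^sub>L a \<Longrightarrow> s o\<^sub>L b = b o\<^sub>L s"
    "\<And>x y. inner (blinfun_apply s x) y = inner x (blinfun_apply s y)" "\<And>x. inner (blinfun_apply s x) x \<ge> 0"
proof -
  define y where "y = rec_nat (0 :: 'a \<Rightarrow>\<^sub>L 'a) (\<lambda>_ y. (1/2) *\<^sub>R (a + (y o\<^sub>L y)))"
  define r where "r = rec_nat (0 :: real) (\<lambda>_ r. (1 + r * r) / 2)"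
  have y0: "y 0 = 0" and yS: "y (Suc n) = (1/2) *\<^sub>R (a + (y n o\<^sub>L y n))" for n by (simp_all add: y_def)
  have r0: "r 0 = 0" and rS: "r (Suc n) = (1 + r n * r n) / 2" for n by (simp_all add: r_def)
  have r01: "0 \<le> r n \<and> r n \<le> 1" for n
  proof (induction n)
    case (Suc n)
    then have "r n * r n \<le> 1" by (intro mult_le_one) auto
    then show ?case by (simp add: rS)
  qed (simp add: r0)
  \<comment> \<open>The increment of the scalar iteration is
    \<open>(1 - r n)\<^sup>2 / 2\<close>.\<close>
  have r_mono: "r n \<le> r (Suc n)" for n
    using sum_squares_ge_zero[of "1 - r n" 0] by (simp add: rS field_simps)
  have y_r: "norm (y n) \<le> r n" for n
  proof (induction n)
    case (Suc n)
    have "norm (y n o\<^sub>L y n) \<le> norm (y n) * norm (y n)" by (rule norm_blinfun_compose)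
    also have "\<dots> \<le> r n * r n" using Suc r01[of n] by (intro mult_mono) auto
    finally have "norm (a + (y n o\<^sub>L y n)) \<le> 1 + r n * r n" using a by (intro norm_triangle_le) linarith
    then show ?case by (simp add: yS rS)
  qed (simp add: y0 r0)
  have y_comm: "y n o\<^sub>L b = b o\<^sub>L y n" if b: "a o\<^sub>L b = b o\<^sub>L a" for n b
  proof (induction n)
    case (Suc n)
    have "y (Suc n) x = (1/2) *\<^sub>R (a x + y n (y n x))" for x
      by (simp add: yS blinfun.add_left blinfun.scaleR_left)
    then show ?case using compose_eq_apply[OF b] compose_eq_apply[OF Suc]
      by (intro blinfun_eqI) (simp add: blinfun.add_right blinfun.scaleR_right)
  qed (simp add: y0)
  have y_sym: "inner (y n x) z = inner x (y n z)" for n x z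
  proof (induction n arbitrary: x z)
    case (Suc n)
    then show ?case by (simp add: yS blinfun.add_left blinfun.scaleR_left inner_add_left inner_add_right sym)
  qed (simp add: y0)
  have step: "norm (y (Suc n) - y n) \<le> r (Suc n) - r n" for n
  proof (induction n)
    case 0
    then show ?case using a by (simp add: y0 yS r0 rS)
  next
    case (Suc n)
    \<comment> \<open>The iterates are polynomials in \<open>a\<close>, so they commute and the
      difference of squares factors. The scalar iteration obeys the same factorisation, which closes
      the induction.\<close>
    have "a o\<^sub>L y n = y n o\<^sub>L a" by (rule y_comm[symmetric]) simp
    then have "y (Suc n) o\<^sub>L y n = y n o\<^sub>L y (Suc n)" by (rule y_comm)
    note c = compose_eq_apply[OF this]
    have "u - v = (1/2) *\<^sub>R (w - z)" if "u = (1/2) *\<^sub>R (a + w)" "v = (1/2) *\<^sub>R (a + z)" for u v w z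
      using that by (simp add: algebra_simps)
    from this[OF yS[of "Suc n"] yS[of n]]
    have "y (Suc (Suc n)) - y (Suc n) = (1/2) *\<^sub>R ((y (Suc n) o\<^sub>L y (Suc n)) - (y n o\<^sub>L y n))" .
    also have "\<dots> = (1/2) *\<^sub>R ((y (Suc n) + y n) o\<^sub>L (y (Suc n) - y n))"
      by (rule blinfun_eqI) (simp add: blinfun_apply_simps c)
    finally have "norm (y (Suc (Suc n)) - y (Suc n)) \<le> (1/2) * (norm (y (Suc n) + y n) * norm (y (Suc n) - y n))"
      using norm_blinfun_compose[of "y (Suc n) + y n" "y (Suc n) - y n"] by simp
    also have "\<dots> \<le> (1/2) * ((r (Suc n) + r n) * (r (Suc n) - r n))"
      using Suc r01[of n] r01[of "Suc n"] by (intro mult_left_mono mult_mono norm_triangle_le add_mono y_r) auto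
    also have "\<dots> = (1 + r (Suc n) * r (Suc n)) / 2 - (1 + r n * r n) / 2" by (simp add: field_simps)
    also have "\<dots> = r (Suc (Suc n)) - r (Suc n)" by (simp only: rS)
    finally show ?case .
  qed
  have step': "norm (y (m + n) - y n) \<le> r (m + n) - r n" for m n
  proof (induction m)
    case (Suc m)
    then show ?case using step[of "m + n"] norm_triangle_ineq[of "y (Suc (m + n)) - y (m + n)" "y (m + n) - y n"] by simp
  qed simp
  have "convergent r"
    using r01 r_mono by (intro Bseq_monoseq_convergent BseqI'[where K=1]) (auto simp: monoseq_Suc)
  then have "Cauchy r" by (rule convergent_Cauchy)
  have "Cauchy y"
  proof (rule CauchyI')
    fix e :: real assume "0 < e"
    then obtain N where N: "\<And>m n. m \<ge> N \<Longrightarrow> n \<ge> N \<Longrightarrow> dist (r m) (r n) < e"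
      using \<open>Cauchy r\<close> unfolding Cauchy_def by meson
    have "norm (y m - y n) < e" if mn: "m \<ge> N" "n > m" for m n
    proof -
      obtain k where k: "n = k + m" using mn(2) by (metis add.commute less_imp_add_positive)
      have "norm (y m - y n) \<le> r n - r m" using step'[of k m] by (simp add: k norm_minus_commute)
      also have "\<dots> \<le> dist (r m) (r n)" by (simp add: dist_real_def)
      also have "\<dots> < e" using N mn by simp
      finally show ?thesis .
    qed
    then show "\<exists>M. \<forall>m\<ge>M. \<forall>n>m. dist (y m) (y n) < e" by (auto simp: dist_norm)
  qed
  then obtain Y where Y: "y \<longlonglongrightarrow> Y" using Cauchy_convergent convergent_def by blast
  note lim = bounded_bilinear.tendsto[OF bounded_bilinear_blinfun_compose]
  have "(\<lambda>n. y (Suc n)) \<longlonglongrightarrow> (1/2) *\<^sub>R (a + (Y o\<^sub>L Y))"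
    unfolding yS by (intro tendsto_intros lim Y)
  then have Y_eq: "Y = (1/2) *\<^sub>R (a + (Y o\<^sub>L Y))"
    using LIMSEQ_unique LIMSEQ_Suc[OF Y] by blast
  show ?thesis
  proof (rule that[of "id_blinfun - Y"])
    have "2 *\<^sub>R Y = 2 *\<^sub>R (1/2) *\<^sub>R (a + (Y o\<^sub>L Y))" using Y_eq by simp
    then have "Y o\<^sub>L Y = 2 *\<^sub>R Y - a" by simp
    then have "Y (Y x) = 2 *\<^sub>R Y x - a x" for x
      by (metis blinfun.diff_left blinfun.scaleR_left blinfun_apply_blinfun_compose)
    then show "(id_blinfun - Y) o\<^sub>L (id_blinfun - Y) = id_blinfun - a"
      by (intro blinfun_eqI) (simp add: blinfun_apply_simps scaleR_2)
    show "(id_blinfun - Y) o\<^sub>L b = b o\<^sub>L (id_blinfun - Y)" if b: "a o\<^sub>L b = b o\<^sub>L a" for b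
    proof -
      have "(\<lambda>n. y n o\<^sub>L b) \<longlonglongrightarrow> (Y o\<^sub>L b)" by (intro lim Y tendsto_const)
      moreover have "(\<lambda>n. y n o\<^sub>L b) \<longlonglongrightarrow> (b o\<^sub>L Y)"
        unfolding y_comm[OF b] by (intro lim Y tendsto_const)
      ultimately have "Y o\<^sub>L b = b o\<^sub>L Y" by (rule LIMSEQ_unique)
      then show ?thesis using compose_eq_apply by (intro blinfun_eqI) (fastforce simp: blinfun_apply_simps)
    qed
    have Yx: "(\<lambda>n. y n x) \<longlonglongrightarrow> Y x" for x by (intro blinfun.tendsto Y tendsto_const)
    have "inner (Y x) z = inner x (Y z)" for x z
    proof (rule LIMSEQ_unique)
      show "(\<lambda>n. inner (y n x) z) \<longlonglongrightarrow> inner (Y x) z" by (intro tendsto_intros Yx)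
      show "(\<lambda>n. inner (y n x) z) \<longlonglongrightarrow> inner x (Y z)" unfolding y_sym by (intro tendsto_intros Yx)
    qed
    then show "inner ((id_blinfun - Y) x) z = inner x ((id_blinfun - Y) z)" for x z
      by (simp add: blinfun.diff_left inner_diff_left inner_diff_right)
    have "norm Y \<le> 1"
    proof (rule LIMSEQ_le_const2[OF tendsto_norm[OF Y]])
      show "\<exists>N. \<forall>n\<ge>N. norm (y n) \<le> 1" using y_r r01 order.trans by blast
    qed
    show "inner ((id_blinfun - Y) x) x \<ge> 0" for x
    proof -
      have "inner (Y x) x \<le> norm (Y x) * norm x" by (rule norm_cauchy_schwarz)
      also have "\<dots> \<le> (norm Y * norm x) * norm x" by (intro mult_right_mono norm_blinfun) auto
      also have "\<dots> \<le> (1 * norm x) * norm x" using \<open>norm Y \<le> 1\<close> by (intro mult_right_mono) auto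
      finally show ?thesis by (simp add: blinfun.diff_left inner_diff_left power2_norm_eq_inner[symmetric] power2_eq_square)
    qed
  qed
qed

text \<open>Complex linearity becomes a commutation relation, so square roots and extensions, which
  are built real-linearly, inherit it from their general commutation properties.\<close>

lemma bounded_ops_commute_iff:
  "T \<in> bounded_ops \<longleftrightarrow> (\<forall>c. T o\<^sub>L op_scaleC c id_blinfun = op_scaleC c id_blinfun o\<^sub>L T)"
proof
  assume "\<forall>c. T o\<^sub>L op_scaleC c id_blinfun = op_scaleC c id_blinfun o\<^sub>L T"
  then have "(T o\<^sub>L op_scaleC c id_blinfun) x = (op_scaleC c id_blinfun o\<^sub>L T) x" for c x by simp
  then show "T \<in> bounded_ops" by (simp add: bounded_ops_def)
qed (auto simp: bounded_ops_def intro!: blinfun_eqI)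

text \<open>Expanding the square gives \<open>(norm x)\<^sup>2 - 2 * (norm (t x))\<^sup>2 + (norm
  (adj t (t x)))\<^sup>2\<close>, whose last term is at most
  \<open>(norm (t x))\<^sup>2\<close>.\<close>

lemma norm_id_minus_adj_compose:
  assumes t: "t \<in> bounded_ops" "norm t \<le> 1"
  shows "norm (id_blinfun - (adj t o\<^sub>L t)) \<le> 1"
proof (rule norm_blinfun_bound)
  fix x
  have *: "norm (adj t y) \<le> norm y" for y
  proof -
    have "(norm (adj t y))\<^sup>2 = inner (t (adj t y)) y" by (simp add: power2_norm_eq_inner adj_inner[OF t(1)])
    also have "\<dots> \<le> norm (t (adj t y)) * norm y" by (rule norm_cauchy_schwarz)
    also have "\<dots> \<le> (norm t * norm (adj t y)) * norm y" by (intro mult_right_mono norm_blinfun) auto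
    also have "\<dots> \<le> (1 * norm (adj t y)) * norm y" using t(2) by (intro mult_right_mono) auto
    finally show ?thesis by (cases "norm (adj t y) = 0") (simp_all add: power2_eq_square)
  qed
  have "(norm (x - adj t (t x)))\<^sup>2 = (norm x)\<^sup>2 - 2 * (norm (t x))\<^sup>2 + (norm (adj t (t x)))\<^sup>2"
    unfolding power2_norm_eq_inner
    by (simp add: inner_diff_left inner_diff_right adj_inner[OF t(1)] inner_commute[of "adj t (t x)" x])
  also have "(norm (adj t (t x)))\<^sup>2 \<le> (norm (t x))\<^sup>2" by (intro power_mono *) simp
  finally have "(norm (x - adj t (t x)))\<^sup>2 \<le> (norm x)\<^sup>2" using zero_le_power2[of "norm (t x)"] by linarith
  then have "norm (x - adj t (t x)) \<le> norm x" by (rule power2_le_imp_le) simp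
  then show "norm ((id_blinfun - (adj t o\<^sub>L t)) x) \<le> 1 * norm x" by (simp add: blinfun.diff_left)
qed simp

text \<open>This \<open>s\<close> is the absolute value of \<open>t\<close>, from the square root
  lemma with \<open>id_blinfun - (adj t o\<^sub>L t)\<close> as its \<open>a\<close>.\<close>

lemma sqrt_adj_compose:
  assumes t: "t \<in> bounded_ops" "norm t \<le> 1"
  obtains s where "s \<in> bounded_ops" "adj s = s" "s o\<^sub>L s = adj t o\<^sub>L t" "\<And>x. inner (blinfun_apply s x) x \<ge> 0"
    "\<And>b. (adj t o\<^sub>L t) o\<^sub>L b = b o\<^sub>L (adj t o\<^sub>L t) \<Longrightarrow> s o\<^sub>L b = b o\<^sub>L s"
proof -
  let ?a = "id_blinfun - (adj t o\<^sub>L t)"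
  have "inner (?a x) y = inner x (?a y)" for x y
    by (simp add: blinfun.diff_left inner_diff_left inner_diff_right adj_inner'[OF t(1), symmetric] adj_inner[OF t(1), symmetric])
  then obtain s where s: "s o\<^sub>L s = id_blinfun - ?a" "\<And>b. ?a o\<^sub>L b = b o\<^sub>L ?a \<Longrightarrow> s o\<^sub>L b = b o\<^sub>L s"
    "\<And>x y. inner (s x) y = inner x (s y)" "\<And>x. inner (s x) x \<ge> 0"
    using op_sqrt_exists[OF norm_id_minus_adj_compose[OF t]] by blast
  have comm: "s o\<^sub>L b = b o\<^sub>L s" if b: "(adj t o\<^sub>L t) o\<^sub>L b = b o\<^sub>L (adj t o\<^sub>L t)" for b
    by (rule s(2), rule blinfun_eqI) (use compose_eq_apply[OF b] in \<open>simp add: blinfun_apply_simps\<close>)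
  have "s \<in> bounded_ops"
    unfolding bounded_ops_commute_iff
  proof
    fix c
    have "adj t o\<^sub>L t \<in> bounded_ops" using t(1) by (intro bounded_ops_compose bounded_ops_adj)
    then show "s o\<^sub>L op_scaleC c id_blinfun = op_scaleC c id_blinfun o\<^sub>L s"
      by (intro comm) (simp add: bounded_ops_commute_iff)
  qed
  then show ?thesis using that s comm adj_eqI by (metis (no_types, lifting) diff_diff_eq2 add_diff_cancel_left')
qed

section \<open>Algebra of commutants and their spanning by unitaries\<close>

lemma commutant_add: "\<lbrakk>S \<in> commutant A; T \<in> commutant A\<rbrakk> \<Longrightarrow> S + T \<in> commutant A"
  and commutant_diff: "\<lbrakk>S \<in> commutant A; T \<in> commutant A\<rbrakk> \<Longrightarrow> S - T \<in> commutant A"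
  and commutant_compose: "\<lbrakk>S \<in> commutant A; T \<in> commutant A\<rbrakk> \<Longrightarrow> S o\<^sub>L T \<in> commutant A"
  and commutant_id: "id_blinfun \<in> commutant A"
  and commutant_0: "0 \<in> commutant A"
proof -
  have *: "S (b x) = b (S x)" if "S \<in> commutant A" "b \<in> A" for S b x
    using that by (auto simp: commutant_def intro: compose_eq_apply)
  show "\<lbrakk>S \<in> commutant A; T \<in> commutant A\<rbrakk> \<Longrightarrow> S + T \<in> commutant A"
    by (subst commutant_def) (auto intro!: blinfun_eqI simp: * blinfun_apply_simps bounded_ops_add commutant_def[THEN eqset_imp_iff])
  show "\<lbrakk>S \<in> commutant A; T \<in> commutant A\<rbrakk> \<Longrightarrow> S - T \<in> commutant A"
    by (subst commutant_def) (auto intro!: blinfun_eqI simp: * blinfun_apply_simps bounded_ops_diff commutant_def[THEN eqset_imp_iff])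
  show "\<lbrakk>S \<in> commutant A; T \<in> commutant A\<rbrakk> \<Longrightarrow> S o\<^sub>L T \<in> commutant A"
    by (subst commutant_def) (auto intro!: blinfun_eqI simp: * bounded_ops_compose commutant_def[THEN eqset_imp_iff])
qed (auto simp: commutant_def bounded_ops_id bounded_ops_0 intro!: blinfun_eqI)

lemma commutant_subset: "commutant A \<subseteq> bounded_ops"
  by (auto simp: commutant_def)

lemma commutant_op_scaleC: "A \<subseteq> bounded_ops \<Longrightarrow> T \<in> commutant A \<Longrightarrow> op_scaleC c T \<in> commutant A"
  by (auto simp: commutant_def bounded_ops_op_scaleC dest: compose_eq_apply intro!: blinfun_eqI)
     (metis (no_types, lifting) blinfun_apply_blinfun_compose bounded_ops_apply subsetD)

lemma commutant_scaleR: "A \<subseteq> bounded_ops \<Longrightarrow> T \<in> commutant A \<Longrightarrow> r *\<^sub>R T \<in> commutant A"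
  by (simp add: scaleR_eq_op_scaleC commutant_op_scaleC)

lemma commutant_apply: "\<lbrakk>T \<in> commutant A; S \<in> A\<rbrakk> \<Longrightarrow> T (S x) = S (T x)"
  by (auto simp: commutant_def intro: compose_eq_apply)

lemma commutant_adj:
  assumes "A \<subseteq> bounded_ops" "\<And>S. S \<in> A \<Longrightarrow> adj S \<in> A" "T \<in> commutant A"
  shows "adj T \<in> commutant A"
proof -
  have T: "T \<in> bounded_ops" using assms(3) commutant_subset by blast
  have "adj T o\<^sub>L S = S o\<^sub>L adj T" if "S \<in> A" for S
  proof -
    have S: "S \<in> bounded_ops" using that assms(1) by blast
    have "adj (adj S o\<^sub>L T) = adj (T o\<^sub>L adj S)" using assms that by (simp add: commutant_def)
    then show ?thesis by (simp add: adj_compose S T bounded_ops_adj adj_adj)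
  qed
  then show ?thesis by (simp add: commutant_def bounded_ops_adj T)
qed

lemma commutant_antimono: "A \<subseteq> B \<Longrightarrow> commutant B \<subseteq> commutant A"
  by (auto simp: commutant_def)

text \<open>The unitary is x + i sqrt(1 - x^2), the operator form of writing a number in [-1, 1] as
  a cosine.\<close>

lemma self_adjoint_contraction_unitary:
  fixes x :: "'h::complex_hilbert_space \<Rightarrow>\<^sub>L 'h"
  assumes x: "x \<in> bounded_ops" "adj x = x" "norm x \<le> 1"
  obtains u where "u \<in> bounded_ops" "adj u o\<^sub>L u = id_blinfun" "u o\<^sub>L adj u = id_blinfun"
    "2 *\<^sub>R x = u + adj u" "\<And>b. \<lbrakk>b \<in> bounded_ops; x o\<^sub>L b = b o\<^sub>L x\<rbrakk> \<Longrightarrow> u o\<^sub>L b = b o\<^sub>L u"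
proof -
  have xx: "inner (x y) z = inner y (x z)" for y z using adj_inner[OF x(1), of y z] x(2) by simp
  have n: "norm (x o\<^sub>L x) \<le> 1"
    using norm_blinfun_compose[of x x] mult_le_one[OF x(3) norm_ge_zero x(3)] by linarith
  have "inner ((x o\<^sub>L x) y) z = inner y ((x o\<^sub>L x) z)" for y z by (simp add: xx)
  then obtain s where s: "s o\<^sub>L s = id_blinfun - (x o\<^sub>L x)"
      "\<And>b. (x o\<^sub>L x) o\<^sub>L b = b o\<^sub>L (x o\<^sub>L x) \<Longrightarrow> s o\<^sub>L b = b o\<^sub>L s"
      "\<And>x y. inner (s x) y = inner x (s y)" "\<And>x. inner (s x) x \<ge> 0"
    using op_sqrt_exists[OF n] by blast
  have s_comm: "s o\<^sub>L b = b o\<^sub>L s" if "x o\<^sub>L b = b o\<^sub>L x" for b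
    by (rule s(2)) (metis that blinfun_compose_assoc)
  have sb: "s \<in> bounded_ops"
    using x(1) s_comm unfolding bounded_ops_commute_iff by blast
  have adj_s: "adj s = s" by (rule adj_eqI[OF sb s(3)])
  have sx: "s (x y) = x (s y)" for y by (rule compose_eq_apply, rule s_comm) simp
  have ss: "s (s y) = y - x (x y)" for y
    using arg_cong[OF s(1), of "\<lambda>f. blinfun_apply f y"] by (simp add: blinfun.diff_left)
  define u where "u = x + op_scaleC \<i> s"
  have ub: "u \<in> bounded_ops" unfolding u_def by (intro bounded_ops_add bounded_ops_op_scaleC x sb)
  have au: "adj u = x + op_scaleC (- \<i>) s"
    unfolding u_def by (simp add: adj_add adj_op_scaleC bounded_ops_op_scaleC x sb adj_s)
  have neg: "(- \<i>) *\<^sub>C y = - (\<i> *\<^sub>C y)" for y :: 'h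
    using scaleC_add_left[of "-\<i>" \<i> y] norm_scaleC[of 0 y] by (simp add: eq_neg_iff_add_eq_0)
  have ii: "\<i> *\<^sub>C \<i> *\<^sub>C y = - y" for y :: 'h
    using scaleC_of_real[of "-1" y] by (simp add: scaleC_scaleC)
  have u_apply: "u y = x y + \<i> *\<^sub>C s y" "adj u y = x y - \<i> *\<^sub>C s y" for y
    by (simp_all add: au blinfun.add_left neg) (simp add: u_def blinfun.add_left)
  show ?thesis
  proof (rule that[OF ub])
    show "adj u o\<^sub>L u = id_blinfun" "u o\<^sub>L adj u = id_blinfun"
      by (rule blinfun_eqI; simp add: u_apply blinfun_apply_simps ii sx ss bounded_ops_apply[OF x(1)] bounded_ops_apply[OF sb]
            scaleC_add_right scaleC_diff_right)+
    show "2 *\<^sub>R x = u + adj u"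
      by (rule blinfun_eqI) (simp add: u_apply blinfun_apply_simps scaleR_2)
    show "u o\<^sub>L b = b o\<^sub>L u" if b: "b \<in> bounded_ops" "x o\<^sub>L b = b o\<^sub>L x" for b
      unfolding u_def using compose_eq_apply[OF b(2)] compose_eq_apply[OF s_comm[OF b(2)]]
      by (intro blinfun_eqI) (simp add: blinfun_apply_simps bounded_ops_apply[OF b(1)])
  qed
qed

text \<open>Each element is a combination of four unitaries of the commutant, two for each of its
  self-adjoint parts, because the commutant of a self-adjoint set contains adjoints and the
  unitaries just constructed.\<close>

lemma commutant_unitary_induct:
  assumes A: "A \<subseteq> bounded_ops" "\<And>S. S \<in> A \<Longrightarrow> adj S \<in> A"
    and x: "x \<in> commutant A"
    and add: "\<And>S T. \<lbrakk>S \<in> commutant A; T \<in> commutant A; P S; P T\<rbrakk> \<Longrightarrow> P (S + T)"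
    and scale: "\<And>c T. \<lbrakk>T \<in> commutant A; P T\<rbrakk> \<Longrightarrow> P (op_scaleC c T)"
    and unitary: "\<And>u. \<lbrakk>u \<in> commutant A; adj u o\<^sub>L u = id_blinfun; u o\<^sub>L adj u = id_blinfun\<rbrakk> \<Longrightarrow> P u"
  shows "P x"
proof -
  have real_scale: "P (r *\<^sub>R T)" if "T \<in> commutant A" "P T" for r T
    using scale[OF that] by (simp add: scaleR_eq_op_scaleC)
  have sa1: "P h" if h: "h \<in> commutant A" "adj h = h" "norm h \<le> 1" for h
  proof -
    have hb: "h \<in> bounded_ops" using h commutant_subset by blast
    obtain u where u: "u \<in> bounded_ops" "adj u o\<^sub>L u = id_blinfun" "u o\<^sub>L adj u = id_blinfun"
      "2 *\<^sub>R h = u + adj u" "\<And>b. \<lbrakk>b \<in> bounded_ops; h o\<^sub>L b = b o\<^sub>L h\<rbrakk> \<Longrightarrow> u o\<^sub>L b = b o\<^sub>L u"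
      using self_adjoint_contraction_unitary[OF hb h(2,3)] by blast
    have uc: "u \<in> commutant A" using u(1,5) A(1) h(1) by (auto simp: commutant_def)
    have au: "adj u \<in> commutant A" by (rule commutant_adj[OF A uc])
    have "P (u + adj u)"
      using u by (intro add uc au unitary) (simp_all add: adj_adj)
    then have "P ((1/2) *\<^sub>R (u + adj u))" by (intro real_scale commutant_add uc au)
    moreover have "h = (1/2) *\<^sub>R (u + adj u)" by (simp add: u(4)[symmetric])
    ultimately show ?thesis by simp
  qed
  have sa: "P h" if h: "h \<in> commutant A" "adj h = h" for h
  proof -
    have hb: "h \<in> bounded_ops" using h commutant_subset by blast
    define c where "c = norm h + 1"
    have c: "c > 0" by (simp add: c_def add_nonneg_pos)
    have "P ((1/c) *\<^sub>R h)"
    proof (rule sa1)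
      show "(1/c) *\<^sub>R h \<in> commutant A" by (rule commutant_scaleR[OF A(1) h(1)])
      show "adj ((1/c) *\<^sub>R h) = (1/c) *\<^sub>R h" by (simp add: scaleR_eq_op_scaleC adj_op_scaleC hb h(2))
      show "norm ((1/c) *\<^sub>R h) \<le> 1" using c by (simp add: c_def)
    qed
    then have "P (c *\<^sub>R (1/c) *\<^sub>R h)" by (rule real_scale[OF commutant_scaleR[OF A(1) h(1)]])
    then show ?thesis using c by simp
  qed
  have xb: "x \<in> bounded_ops" using x commutant_subset by blast
  have ax: "adj x \<in> commutant A" by (rule commutant_adj[OF A x])
  have axb: "adj x \<in> bounded_ops" using ax commutant_subset by blast
  \<comment> \<open>Twice the real and imaginary parts, so that \<open>x\<close> is half of
    \<open>h + op_scaleC \<i> k\<close>.\<close>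
  define h k where "h = x + adj x" and "k = op_scaleC (-\<i>) x + op_scaleC \<i> (adj x)"
  have hc: "h \<in> commutant A" and kc: "k \<in> commutant A"
    unfolding h_def k_def by (intro commutant_add commutant_op_scaleC A x ax)+
  have "P h" by (rule sa[OF hc]) (simp add: h_def adj_add xb axb adj_adj add.commute)
  moreover have "P k"
    by (rule sa[OF kc]) (simp add: k_def adj_add xb axb adj_adj adj_op_scaleC bounded_ops_op_scaleC add.commute)
  ultimately have "P ((1/2) *\<^sub>R (h + op_scaleC \<i> k))"
    by (intro real_scale add scale commutant_add commutant_op_scaleC A hc kc)
  moreover have "(1/2) *\<^sub>R (h + op_scaleC \<i> k) = x"
  proof (rule blinfun_eqI)
    fix y
    have "\<i> *\<^sub>C (-\<i>) *\<^sub>C z = z" "\<i> *\<^sub>C \<i> *\<^sub>C z = - z" for z :: 'a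
      using scaleC_of_real[of "-1" z] scaleC_of_real[of 1 z] by (simp_all add: scaleC_scaleC)
    then show "((1/2) *\<^sub>R (h + op_scaleC \<i> k)) y = x y"
      by (simp add: h_def k_def blinfun_apply_simps scaleC_add_right scaleR_2[symmetric])
  qed
  ultimately show ?thesis by simp
qed

section \<open>Range projections and polar decomposition\<close>

lemma closed_range_csubspace:
  assumes "c \<in> bounded_ops"
  shows "subspace (closure (range (blinfun_apply c)))" "closed (closure (range (blinfun_apply c)))"
    "h \<in> closure (range (blinfun_apply c)) \<Longrightarrow> r *\<^sub>C h \<in> closure (range (blinfun_apply c))"
proof -
  show "subspace (closure (range (blinfun_apply c)))"
    by (intro subspace_closure linear_subspace_image bounded_linear.linear blinfun.bounded_linear_right subspace_UNIV)
  show "r *\<^sub>C h \<in> closure (range (blinfun_apply c))" if "h \<in> closure (range (blinfun_apply c))"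
    by (rule closure_invariant[OF _ _ that])
       (auto intro: linear_continuous_on bounded_linear_scaleC simp: bounded_ops_apply[OF assms, symmetric])
qed simp

lemma is_projectionD:
  assumes "is_projection p"
  shows "p \<in> bounded_ops" "blinfun_apply p (blinfun_apply p x) = blinfun_apply p x" "adj p = p" "inner (blinfun_apply p x) y = inner x (blinfun_apply p y)"
proof -
  show p: "p \<in> bounded_ops" "adj p = p" using assms by (auto simp: is_projection_def)
  show "p (p x) = p x" using assms unfolding is_projection_def by (metis blinfun_apply_blinfun_compose)
  show "inner (p x) y = inner x (p y)" using adj_inner[OF p(1)] p(2) by metis
qed

lemma range_projection:
  assumes c: "c \<in> bounded_ops"
  obtains p where "is_projection p" "p o\<^sub>L c = c" "\<And>x. blinfun_apply p x \<in> closure (range (blinfun_apply c))"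
    "\<And>S. \<lbrakk>S \<in> bounded_ops; c o\<^sub>L S = S o\<^sub>L c; c o\<^sub>L adj S = adj S o\<^sub>L c\<rbrakk> \<Longrightarrow> p o\<^sub>L S = S o\<^sub>L p"
proof -
  note K = closed_range_csubspace[OF c]
  let ?p = "orth_proj (closure (range (blinfun_apply c)))"
  have cK: "complete (closure (range (blinfun_apply c)))" by (simp add: complete_eq_closed)
  show ?thesis
  proof (rule that)
    show "is_projection ?p" by (rule is_projection_orth_proj[OF K])
    show "?p o\<^sub>L c = c" by (rule blinfun_eqI) (simp add: orth_proj_fixed[OF K(1) cK] closure_subset[THEN subsetD])
    show "?p x \<in> closure (range (blinfun_apply c))" for x by (rule orth_proj_in[OF K(1) cK])
    fix S assume S: "S \<in> bounded_ops" "c o\<^sub>L S = S o\<^sub>L c" "c o\<^sub>L adj S = adj S o\<^sub>L c"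
    have inv: "X k \<in> closure (range (blinfun_apply c))" if "c o\<^sub>L X = X o\<^sub>L c" "k \<in> closure (range (blinfun_apply c))" for X k
      by (rule closure_invariant[OF _ _ that(2)])
         (auto simp: compose_eq_apply[OF that(1), symmetric] intro!: continuous_intros)
    show "?p o\<^sub>L S = S o\<^sub>L ?p"
      by (rule blinfun_eqI, simp, rule orth_proj_commute[OF K(1) cK, where g="adj S"])
         (auto simp: blinfun.diff_right adj_inner[OF S(1)] intro: inv S)
  qed
qed

text \<open>Up to scaling, \<open>v\<close> sends \<open>s h\<close> to \<open>t h\<close>, where
  \<open>s\<close> is the absolute value, and is zero on the complement of the range of
  \<open>s\<close>. The last clause holds because its hypotheses make \<open>X\<close> commute with
  \<open>adj t o\<^sub>L t\<close>, hence with \<open>s\<close>; intertwining by \<open>t\<close>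
  thus passes to \<open>v\<close>.\<close>

lemma polar_decomposition:
  fixes t :: "'h::complex_hilbert_space \<Rightarrow>\<^sub>L 'h"
  assumes t: "t \<in> bounded_ops"
  obtains v s where "partial_isometry v" "t = v o\<^sub>L s"
    "\<And>X Y. \<lbrakk>X \<in> bounded_ops; Y \<in> bounded_ops; t o\<^sub>L X = Y o\<^sub>L t; t o\<^sub>L adj X = adj Y o\<^sub>L t\<rbrakk> \<Longrightarrow> v o\<^sub>L X = Y o\<^sub>L v"
proof -
  define c where "c = norm t + 1"
  have c: "c > 0" by (simp add: c_def add_nonneg_pos)
  \<comment> \<open>The square root is available for contractions; the factor \<open>c\<close>
    returns in the second factor of the decomposition.\<close>
  define t1 where "t1 = (1/c) *\<^sub>R t"
  have t1: "t1 \<in> bounded_ops" unfolding t1_def scaleR_eq_op_scaleC by (rule bounded_ops_op_scaleC[OF t])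
  have n1: "norm t1 \<le> 1" using c by (simp add: c_def t1_def)
  obtain s where s: "s \<in> bounded_ops" "adj s = s" "s o\<^sub>L s = adj t1 o\<^sub>L t1" "\<And>x. inner (s x) x \<ge> 0"
     "\<And>b. (adj t1 o\<^sub>L t1) o\<^sub>L b = b o\<^sub>L (adj t1 o\<^sub>L t1) \<Longrightarrow> s o\<^sub>L b = b o\<^sub>L s"
    using sqrt_adj_compose[OF t1 n1] by blast
  have ss: "inner (s x) (s y) = inner (t1 x) (t1 y)" for x y
    using compose_eq_apply[OF s(3), of y] adj_inner[OF s(1), of x "s y"] adj_inner[OF t1, of x "t1 y"] s(2) by simp
  define R where "R = range (\<lambda>h. (s h, t1 h))"
  have R: "subspace R" unfolding R_def
    by (intro linear_subspace_image subspace_UNIV bounded_linear.linear bounded_linear_Pair blinfun.bounded_linear_right)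
  have bd: "norm k \<le> 1 * norm h" if "(h, k) \<in> R" for h k
    using that ss by (auto simp: R_def norm_eq_sqrt_inner)
  obtain v where v: "\<And>h k. (h, k) \<in> R \<Longrightarrow> blinfun_apply v h = k"
      "\<And>g. (\<And>h k. (h, k) \<in> R \<Longrightarrow> inner g h = 0) \<Longrightarrow> blinfun_apply v g = 0"
      "\<And>g. blinfun_apply v g \<in> closure (snd ` R)"
    using linear_relation_extension[OF R bd] by blast
  have vs: "v (s x) = t1 x" for x by (rule v) (simp add: R_def)
  have v0: "v g = 0" if "\<And>h. inner g (s h) = 0" for g
    by (rule v(2)) (use that in \<open>auto simp: R_def\<close>)
  have intertwine: "v o\<^sub>L X = Y o\<^sub>L v"
    if X: "s o\<^sub>L X = X o\<^sub>L s" "t1 o\<^sub>L X = Y o\<^sub>L t1" "s o\<^sub>L adj X = adj X o\<^sub>L s" "X \<in> bounded_ops" for X Y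
  proof (rule linear_relation_extension_intertwine[OF R v(1,2), where X'="adj X"])
    show "(X h, Y k) \<in> R" if "(h, k) \<in> R" for h k
      using that compose_eq_apply[OF X(1)] compose_eq_apply[OF X(2)] by (auto simp: R_def image_iff) metis
    show "\<exists>k'. (adj X h, k') \<in> R" if "(h, k) \<in> R" for h k
      using that compose_eq_apply[OF X(3)] by (auto simp: R_def image_iff) metis
  qed (simp_all add: adj_inner X)
  have adj_scalar: "adj (op_scaleC r id_blinfun) = op_scaleC (cnj r) id_blinfun" for r
    by (simp add: adj_op_scaleC bounded_ops_id adj_id)
  have vb: "v \<in> bounded_ops"
    unfolding bounded_ops_commute_iff
    using bounded_ops_commute_iff[THEN iffD1, OF s(1)] bounded_ops_commute_iff[THEN iffD1, OF t1]
    by (intro allI intertwine) (simp_all add: adj_scalar bounded_ops_op_scaleC bounded_ops_id)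
  have ranges: "subspace (range (blinfun_apply s))"
    by (intro linear_subspace_image bounded_linear.linear blinfun.bounded_linear_right subspace_UNIV)
  \<comment> \<open>Taking adjoints, \<open>adj v\<close> maps \<open>t1 x\<close> back to
    \<open>s x\<close>, so \<open>adj v o\<^sub>L v\<close> is the identity on the range of
    \<open>s\<close>.\<close>
  have "adj t1 o\<^sub>L v = s"
  proof (rule blinfun_eq_on_orthogonal_decomposition[OF ranges])
    show "(adj t1 o\<^sub>L v) h = s h" if "h \<in> range (blinfun_apply s)" for h
      using that vs compose_eq_apply[OF s(3)] by auto
    show "(adj t1 o\<^sub>L v) g = s g" if g: "\<And>h. h \<in> range (blinfun_apply s) \<Longrightarrow> inner g h = 0" for g
    proof -
      have "v g = 0" by (rule v0) (use g in auto)
      moreover have "s g = 0"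
        by (rule inner_left_eqI) (use g adj_inner[OF s(1)] s(2) in \<open>metis inner_commute inner_zero_right rangeI\<close>)
      ultimately show ?thesis by (simp add: blinfun.zero_right)
    qed
  qed
  then have "adj (adj t1 o\<^sub>L v) = adj s" by simp
  then have "adj v o\<^sub>L t1 = s" by (simp add: adj_compose bounded_ops_adj t1 vb adj_adj s(2))
  then have vt: "adj v (t1 x) = s x" for x by (metis blinfun_apply_blinfun_compose)
  have "(adj v o\<^sub>L v) o\<^sub>L (adj v o\<^sub>L v) = adj v o\<^sub>L v"
  proof (rule blinfun_eq_on_orthogonal_decomposition[OF ranges])
    show "((adj v o\<^sub>L v) o\<^sub>L (adj v o\<^sub>L v)) h = (adj v o\<^sub>L v) h" if "h \<in> range (blinfun_apply s)" for h
      using that by (auto simp: vs vt)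
    show "((adj v o\<^sub>L v) o\<^sub>L (adj v o\<^sub>L v)) g = (adj v o\<^sub>L v) g" if g: "\<And>h. h \<in> range (blinfun_apply s) \<Longrightarrow> inner g h = 0" for g
    proof -
      have "v g = 0" by (rule v0) (use g in auto)
      then show ?thesis by (simp add: blinfun.zero_right)
    qed
  qed
  then have "partial_isometry v"
    by (auto simp: partial_isometry_def is_projection_def vb bounded_ops_compose bounded_ops_adj adj_compose adj_adj)
  moreover have "t = v o\<^sub>L (c *\<^sub>R s)"
    using c by (intro blinfun_eqI) (simp add: blinfun_apply_simps vs t1_def)
  moreover have "v o\<^sub>L X = Y o\<^sub>L v"
    if XY: "X \<in> bounded_ops" "Y \<in> bounded_ops" "t o\<^sub>L X = Y o\<^sub>L t" "t o\<^sub>L adj X = adj Y o\<^sub>L t" for X Y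
  proof -
    have 1: "t1 o\<^sub>L X = Y o\<^sub>L t1" "t1 o\<^sub>L adj X = adj Y o\<^sub>L t1"
      using compose_eq_apply[OF XY(3)] compose_eq_apply[OF XY(4)]
      by (auto intro!: blinfun_eqI simp: t1_def blinfun_apply_simps)
    have comm: "s o\<^sub>L X = X o\<^sub>L s" if "X \<in> bounded_ops" "Y \<in> bounded_ops" "t1 o\<^sub>L X = Y o\<^sub>L t1" "t1 o\<^sub>L adj X = adj Y o\<^sub>L t1" for X Y
    proof (rule s(5))
      \<comment> \<open>The adjoint relation becomes
        \<open>X o\<^sub>L adj t1 = adj t1 o\<^sub>L Y\<close>; together with the direct one it lets
        \<open>X\<close> pass through \<open>adj t1 o\<^sub>L t1\<close>.\<close>
      have "adj (t1 o\<^sub>L adj X) = adj (adj Y o\<^sub>L t1)" using that(4) by simp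
      then have "X o\<^sub>L adj t1 = adj t1 o\<^sub>L Y" by (simp add: adj_compose t1 that(1,2) bounded_ops_adj adj_adj)
      then show "adj t1 o\<^sub>L t1 o\<^sub>L X = X o\<^sub>L (adj t1 o\<^sub>L t1)" using that(3) by (metis blinfun_compose_assoc)
    qed
    show ?thesis
      by (rule intertwine[OF comm[OF XY(1,2) 1] 1(1) comm[of "adj X" "adj Y"] XY(1)])
         (simp_all add: bounded_ops_adj XY 1 adj_adj)
  qed
  ultimately show ?thesis using that by blast
qed

section \<open>Spectral projections and vector functionals\<close>

text \<open>One bisection step: \<open>p\<close> is the spectral projection of \<open>a\<close> for the interval \<open>(l/2, l]\<close>, obtained as the range
  projection of \<open>\<bar>b\<bar> + b\<close> with \<open>b = a - l/2\<close>.\<close>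

lemma spectral_bisection:
  fixes a :: "'h::complex_hilbert_space \<Rightarrow>\<^sub>L 'h"
  assumes A: "A \<subseteq> bounded_ops" "\<And>S. S \<in> A \<Longrightarrow> adj S \<in> A"
    and a: "a \<in> commutant A" "adj a = a" "\<And>h. 0 \<le> inner (a h) h" "\<And>h. inner (a h) h \<le> l * (norm h)\<^sup>2"
  obtains p where "p \<in> commutant A" "is_projection p"
    "\<And>h. 0 \<le> inner ((a - (l/2) *\<^sub>R p) h) h" "\<And>h. inner ((a - (l/2) *\<^sub>R p) h) h \<le> l/2 * (norm h)\<^sup>2"
    "\<And>q. \<lbrakk>is_projection q; a o\<^sub>L q = a; 0 < l\<rbrakk> \<Longrightarrow> p o\<^sub>L q = p"
proof -
  have ab: "a \<in> bounded_ops" using a commutant_subset by blast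
  define b where "b = a - (l/2) *\<^sub>R id_blinfun"
  have bc: "b \<in> commutant A" unfolding b_def by (intro commutant_diff commutant_scaleR A a commutant_id)
  have bb: "b \<in> bounded_ops" using bc commutant_subset by blast
  have b_apply: "b h = a h - (l/2) *\<^sub>R h" for h by (simp add: b_def blinfun_apply_simps)
  have adj_b: "adj b = b"
    by (simp add: b_def adj_diff ab scaleR_eq_op_scaleC bounded_ops_op_scaleC bounded_ops_id adj_op_scaleC adj_id a)
  define L where "L = norm b + 1"
  have L: "L > 0" by (simp add: L_def add_nonneg_pos)
  define t where "t = (1/L) *\<^sub>R b"
  have tb: "t \<in> bounded_ops" unfolding t_def scaleR_eq_op_scaleC by (rule bounded_ops_op_scaleC[OF bb])
  have t_apply: "t h = (1/L) *\<^sub>R b h" for h by (simp add: t_def blinfun_apply_simps)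
  have tn: "norm t \<le> 1" using L by (simp add: t_def L_def)
  have adj_t: "adj t = t" by (simp add: t_def scaleR_eq_op_scaleC adj_op_scaleC bb adj_b)
  obtain s where s: "s \<in> bounded_ops" "adj s = s" "s o\<^sub>L s = adj t o\<^sub>L t" "\<And>x. inner (blinfun_apply s x) x \<ge> 0"
    "\<And>b. (adj t o\<^sub>L t) o\<^sub>L b = b o\<^sub>L (adj t o\<^sub>L t) \<Longrightarrow> s o\<^sub>L b = b o\<^sub>L s"
    using sqrt_adj_compose[OF tb tn] by blast
  define m where "m = L *\<^sub>R s"
  have m_apply: "m h = L *\<^sub>R s h" for h by (simp add: m_def blinfun_apply_simps)
  have m_pos: "inner (m h) h \<ge> 0" for h using s(4) L by (simp add: m_apply)
  have m_comm: "m (S h) = S (m h)" if S: "b o\<^sub>L S = S o\<^sub>L b" for S h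
  proof -
    have "(adj t o\<^sub>L t) o\<^sub>L S = S o\<^sub>L (adj t o\<^sub>L t)"
      using compose_eq_apply[OF S] by (intro blinfun_eqI) (simp add: adj_t t_apply blinfun_apply_simps)
    then have "s (S h) = S (s h)" by (intro compose_eq_apply s(5))
    then show ?thesis by (simp add: m_apply blinfun.scaleR_right)
  qed
  have mb_comm: "m (b h) = b (m h)" for h by (rule m_comm) simp
  have mm: "m (m h) = b (b h)" for h
    using compose_eq_apply[OF s(3), of h] L by (simp add: m_apply adj_t t_apply blinfun_apply_simps)
  have mb: "m \<in> bounded_ops" unfolding m_def scaleR_eq_op_scaleC by (rule bounded_ops_op_scaleC[OF s(1)])
  define c where "c = m + b"
  have c_apply: "c h = m h + b h" for h by (simp add: c_def blinfun.add_left)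
  have cb: "c \<in> bounded_ops" unfolding c_def by (intro bounded_ops_add mb bb)
  have c_sym: "inner (c x) y = inner x (c y)" for x y
    using adj_inner[OF s(1), of x y] adj_inner[OF bb, of x y]
    by (simp add: c_apply m_apply inner_add_left inner_add_right s(2) adj_b)
  have c_comm: "c o\<^sub>L S = S o\<^sub>L c" if S: "b o\<^sub>L S = S o\<^sub>L b" for S
    using m_comm[OF S] compose_eq_apply[OF S] by (intro blinfun_eqI) (simp add: c_apply blinfun_apply_simps)
  obtain p where p: "is_projection p" "p o\<^sub>L c = c" "\<And>x. blinfun_apply p x \<in> closure (range (blinfun_apply c))"
    "\<And>S. \<lbrakk>S \<in> bounded_ops; c o\<^sub>L S = S o\<^sub>L c; c o\<^sub>L adj S = adj S o\<^sub>L c\<rbrakk> \<Longrightarrow> p o\<^sub>L S = S o\<^sub>L p"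
    using range_projection[OF cb] by blast
  note pD = is_projectionD[OF p(1)]
  have bS: "b o\<^sub>L S = S o\<^sub>L b" if "S \<in> A" for S using bc that by (auto simp: commutant_def)
  have pc: "p \<in> commutant A"
    unfolding commutant_def using pD(1) A bS by (auto intro!: p(4) c_comm)
  have ba: "b o\<^sub>L a = a o\<^sub>L b" by (rule blinfun_eqI) (simp add: b_apply blinfun_apply_simps)
  have pa: "p (a h) = a (p h)" for h
    by (rule compose_eq_apply, rule p(4)) (simp_all add: ab a(2) c_comm ba)
  \<comment> \<open>The product of \<open>m - b\<close> and \<open>c\<close> is m^2 - b^2 = 0
    because \<open>m\<close> and \<open>b\<close> commute.\<close>
  have b_on: "b (p h) = m (p h)" for h
  proof -
    have "(m - b) (p h) \<in> closure {0}"
      by (rule closure_invariant[OF _ _ p(3)])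
         (auto simp: c_apply blinfun_apply_simps mm mb_comm intro!: continuous_intros)
    then show ?thesis by (simp add: blinfun.diff_left)
  qed
  \<comment> \<open>The symmetric \<open>c\<close> vanishes on the complement of its range, so
    \<open>b\<close> is \<open>-m\<close> there.\<close>
  have b_off: "b (h - p h) = - m (h - p h)" for h
  proof -
    have "c (h - p h) = 0"
    proof (rule inner_left_eqI)
      fix x
      have "inner x (c (h - p h)) = inner (p (c x)) (h - p h)"
        using c_sym[of x "h - p h"] p(2) by (metis blinfun_apply_blinfun_compose)
      then show "inner x (c (h - p h)) = inner x 0" by (simp add: pD blinfun_apply_simps)
    qed
    then show ?thesis by (simp add: c_apply eq_neg_iff_add_eq_0 add.commute)
  qed
  \<comment> \<open>The two parts do not interact. On the range of \<open>p\<close> the operator a -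
    l/2 equals both \<open>m\<close> and \<open>b\<close>; off it \<open>a\<close> equals l/2 - m.
    Both bounds follow from this.\<close>
  have form: "inner ((a - (l/2) *\<^sub>R p) h) h = inner (m (p h)) (p h) + inner (a (h - p h)) (h - p h)" for h
  proof -
    define k j where "k = p h" and "j = h - p h"
    have h: "h = k + j" by (simp add: k_def j_def)
    have kj: "inner (p y) j = 0" for y by (simp add: j_def pD blinfun_apply_simps)
    have kj': "inner j (p y) = 0" for y using kj by (simp add: inner_commute)
    have "a k = m k + (l/2) *\<^sub>R k" using b_on[of h] b_apply[of k] by (simp add: k_def algebra_simps)
    then have e: "(a - (l/2) *\<^sub>R p) h = m k + a j"
      by (simp add: h blinfun_apply_simps) (simp add: k_def j_def pD blinfun_apply_simps)
    have "inner (m k) j = 0"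
    proof -
      have "m k = p (m k)"
        using \<open>a k = m k + (l/2) *\<^sub>R k\<close> pa[of h] by (metis add_diff_cancel_right' blinfun.diff_right blinfun.scaleR_right k_def pD(2) pa)
      then show ?thesis using kj by metis
    qed
    moreover have "inner (a j) k = 0"
      using adj_inner[OF ab, of j k] kj'[of "a h"] by (simp add: a(2) k_def pa)
    ultimately have "inner (m k + a j) (k + j) = inner (m k) k + inner (a j) j"
      by (simp add: inner_add_left inner_add_right)
    then show ?thesis unfolding e h[symmetric] by (simp only: k_def j_def)
  qed
  show ?thesis
  proof (rule that[OF pc p(1)])
    show "0 \<le> inner ((a - (l/2) *\<^sub>R p) h) h" for h
      unfolding form using m_pos a(3) by (intro add_nonneg_nonneg)
    show "inner ((a - (l/2) *\<^sub>R p) h) h \<le> l/2 * (norm h)\<^sup>2" for h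
    proof -
      have "inner (m (p h)) (p h) \<le> l/2 * (norm (p h))\<^sup>2"
        using a(4)[of "p h"] b_apply[of "p h"] by (simp add: b_on[symmetric] inner_diff_left power2_norm_eq_inner)
      moreover have "inner (a j) j \<le> l/2 * (norm j)\<^sup>2" if "b j = - m j" for j
      proof -
        have "a j = (l/2) *\<^sub>R j - m j" using that b_apply[of j] by (simp add: algebra_simps)
        then show ?thesis using m_pos[of j] by (simp add: inner_diff_left power2_norm_eq_inner)
      qed
      note this[OF b_off, of h]
      moreover have "(norm h)\<^sup>2 = (norm (p h))\<^sup>2 + (norm (h - p h))\<^sup>2"
        unfolding power2_norm_eq_inner by (simp add: inner_diff_left inner_diff_right pD inner_commute)
      ultimately show ?thesis unfolding form by (simp add: distrib_left)
    qed
    show "p o\<^sub>L q = p" if q: "is_projection q" "a o\<^sub>L q = a" "0 < l" for q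
    proof (rule blinfun_eqI)
      fix x
      \<comment> \<open>Since \<open>a\<close> vanishes at \<open>k\<close>, it vanishes at
        \<open>p k\<close>, where \<open>b\<close> is therefore -l/2. But \<open>b\<close> agrees
        with the positive \<open>m\<close> there, which forces \<open>p k = 0\<close>.\<close>
      define k where "k = x - q x"
      have "a k = 0" using arg_cong[OF q(2), of "\<lambda>f. f x"] by (simp add: k_def blinfun.diff_right)
      then have "a (p k) = 0" using pa[of k] by (simp add: blinfun.zero_right)
      then have "inner (m (p k)) (p k) = - (l/2) * (norm (p k))\<^sup>2"
        by (simp add: b_on[symmetric] b_apply power2_norm_eq_inner)
      with m_pos[of "p k"] q(3) have "(norm (p k))\<^sup>2 \<le> 0" by (simp add: mult_le_0_iff)
      then show "(p o\<^sub>L q) x = p x" by (simp add: k_def blinfun.diff_right)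
    qed
  qed
qed

text \<open>Iterating the bisection expands \<open>a\<close> into a norm-convergent series \<open>\<Sum>n. l / 2 ^ Suc n *\<^sub>R p n\<close> of projections.\<close>

lemma positive_le_vector_functional:
  fixes \<omega> :: "('h::complex_hilbert_space \<Rightarrow>\<^sub>L 'h) \<Rightarrow> real"
  assumes A: "A \<subseteq> bounded_ops" "\<And>S. S \<in> A \<Longrightarrow> adj S \<in> A"
    and \<omega>: "\<And>x y. \<lbrakk>x \<in> commutant A; y \<in> commutant A\<rbrakk> \<Longrightarrow> \<omega> (x + y) = \<omega> x + \<omega> y"
      "\<And>r x. x \<in> commutant A \<Longrightarrow> \<omega> (r *\<^sub>R x) = r * \<omega> x"
    and bd: "\<And>x l. \<lbrakk>x \<in> commutant A; adj x = x; \<And>h. 0 \<le> inner (x h) h; \<And>h. inner (x h) h \<le> l * (norm h)\<^sup>2; 0 < l\<rbrakk>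
        \<Longrightarrow> \<omega> x \<le> K * l"
    and q: "is_projection q"
    and C: "0 \<le> C"
    and proj: "\<And>p. \<lbrakk>p \<in> commutant A; is_projection p; p o\<^sub>L q = p\<rbrakk> \<Longrightarrow> \<omega> p \<le> C * inner (p \<eta>) \<eta>"
    and a: "a \<in> commutant A" "adj a = a" "\<And>h. 0 \<le> inner (a h) h" "\<And>h. inner (a h) h \<le> l * (norm h)\<^sup>2" "0 < l" "a o\<^sub>L q = a"
  shows "\<omega> a \<le> C * inner (a \<eta>) \<eta>"
proof -
  \<comment> \<open>After \<open>n\<close> bisections the remainder lies between 0 and
    \<open>l / 2 ^ n\<close>; the a priori bound \<open>bd\<close>, which stands in for continuity
    of \<open>\<omega>\<close>, turns it into the error term.\<close>
  have approx: "\<omega> a \<le> C * inner (a \<eta>) \<eta> + K * (l / 2 ^ n)"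
    if "a \<in> commutant A" "adj a = a" "\<And>h. 0 \<le> inner (a h) h" "\<And>h. inner (a h) h \<le> l * (norm h)\<^sup>2" "0 < l" "a o\<^sub>L q = a"
 for a l n
    using that
  proof (induction n arbitrary: a l)
    case 0
    then have "\<omega> a \<le> K * l" by (intro bd)
    then show ?case using 0 C by (simp add: add_increasing)
  next
    case (Suc n)
    have ab: "a \<in> bounded_ops" using Suc.prems(1) commutant_subset by blast
    obtain p where p: "p \<in> commutant A" "is_projection p"
      "\<And>h. 0 \<le> inner ((a - (l/2) *\<^sub>R p) h) h" "\<And>h. inner ((a - (l/2) *\<^sub>R p) h) h \<le> l/2 * (norm h)\<^sup>2"
      "\<And>q. \<lbrakk>is_projection q; a o\<^sub>L q = a; 0 < l\<rbrakk> \<Longrightarrow> p o\<^sub>L q = p"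
      using spectral_bisection[OF A Suc.prems(1-4)] by blast
    note pD = is_projectionD[OF p(2)]
    have pq: "p o\<^sub>L q = p" using p(5) q Suc.prems by blast
    let ?b = "a - (l/2) *\<^sub>R p"
    have pl: "(l/2) *\<^sub>R p \<in> commutant A" by (rule commutant_scaleR[OF A(1) p(1)])
    have bc: "?b \<in> commutant A" by (rule commutant_diff[OF Suc.prems(1) pl])
    have "\<omega> ?b \<le> C * inner (?b \<eta>) \<eta> + K * ((l/2) / 2 ^ n)"
    proof (rule Suc.IH[OF bc])
      show "adj ?b = ?b"
        by (simp add: adj_diff ab Suc.prems(2) scaleR_eq_op_scaleC adj_op_scaleC pD bounded_ops_op_scaleC)
      show "?b o\<^sub>L q = ?b"
        using arg_cong[OF Suc.prems(6), of blinfun_apply] arg_cong[OF pq, of blinfun_apply]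
        by (intro blinfun_eqI) (simp add: fun_eq_iff blinfun_apply_simps)
    qed (use p Suc.prems in auto)
    moreover have "\<omega> a = \<omega> ?b + l/2 * \<omega> p" using \<omega>(1)[OF bc pl] \<omega>(2)[OF p(1)] by simp
    moreover have "l/2 * \<omega> p \<le> l/2 * (C * inner (p \<eta>) \<eta>)"
      using proj[OF p(1,2) pq] Suc.prems(5) by (intro mult_left_mono) auto
    moreover have "inner (?b \<eta>) \<eta> = inner (a \<eta>) \<eta> - l/2 * inner (p \<eta>) \<eta>"
      by (simp add: blinfun_apply_simps inner_diff_left)
    ultimately show ?case by (simp add: algebra_simps)
  qed
  show ?thesis
  proof (rule LIMSEQ_le_const)
    have "(\<lambda>n. C * inner (a \<eta>) \<eta> + K * (l * (1/2) ^ n)) \<longlonglongrightarrow> C * inner (a \<eta>) \<eta> + K * (l * 0)"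
      by (intro tendsto_intros LIMSEQ_power_zero) simp
    then show "(\<lambda>n. C * inner (a \<eta>) \<eta> + K * (l / 2 ^ n)) \<longlonglongrightarrow> C * inner (a \<eta>) \<eta>"
      by (simp add: power_one_over)
    show "\<exists>N. \<forall>n\<ge>N. \<omega> a \<le> C * inner (a \<eta>) \<eta> + K * (l / 2 ^ n)" using approx[OF a] by blast
  qed
qed

section \<open>Intertwiners for an automorphism of a commutant\<close>

lemma orth_proj_commutant:
  assumes A: "A \<subseteq> bounded_ops" "\<And>S. S \<in> A \<Longrightarrow> adj S \<in> A"
    and V: "subspace V" "closed V" "\<And>c h. h \<in> V \<Longrightarrow> c *\<^sub>C h \<in> V"
    and inv: "\<And>S k. S \<in> A \<Longrightarrow> k \<in> V \<Longrightarrow> blinfun_apply S k \<in> V"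
  shows "orth_proj V \<in> commutant A"
proof -
  have cV: "complete V" using V by (simp add: complete_eq_closed)
  have "orth_proj V o\<^sub>L S = S o\<^sub>L orth_proj V" if "S \<in> A" for S
    by (rule blinfun_eqI, simp, rule orth_proj_commute[OF V(1) cV, where g="adj S"])
      (use that A inv in \<open>auto simp: blinfun.diff_right adj_inner\<close>)
  then show ?thesis using orth_proj_bounded_ops[OF V] by (simp add: commutant_def)
qed

lemma norm_projection_le: "is_projection p \<Longrightarrow> norm (blinfun_apply p h) \<le> norm h"
proof -
  assume p: "is_projection p"
  have "(norm (p h))\<^sup>2 = inner h (p h)" by (simp add: power2_norm_eq_inner is_projectionD[OF p])
  also have "\<dots> \<le> norm h * norm (p h)" by (rule norm_cauchy_schwarz)
  finally show ?thesis by (cases "norm (p h) = 0") (simp_all add: power2_eq_square)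
qed

lemma projection_diff:
  assumes s: "is_projection s" and r: "is_projection r" and sr: "s o\<^sub>L r = r"
  shows "is_projection (s - r)" "r o\<^sub>L s = r"
proof -
  note sD = is_projectionD[OF s] and rD = is_projectionD[OF r]
  have "adj (s o\<^sub>L r) = adj r" using sr by simp
  then show rs: "r o\<^sub>L s = r" by (simp add: adj_compose sD rD)
  have "s (r x) = r x" "r (s x) = r x" for x using sr rs by (metis blinfun_apply_blinfun_compose)+
  then show "is_projection (s - r)"
    by (auto simp: is_projection_def bounded_ops_diff adj_diff sD rD blinfun_apply_simps intro!: blinfun_eqI)
qed

text \<open>Polarisation with \<open>k\<close> equal to \<open>x h\<close> divided by
  \<open>l\<close>: four times the product of \<open>x h\<close> and \<open>k\<close> is 4 l |k|^2,
  and the bounds on the form control the polarised expression.\<close>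

lemma norm_le_quadratic_form:
  fixes x :: "'a::real_inner \<Rightarrow>\<^sub>L 'a"
  assumes sym: "\<And>h k. inner (x h) k = inner h (x k)"
    and x: "\<And>h. 0 \<le> inner (x h) h" "\<And>h. inner (x h) h \<le> l * (norm h)\<^sup>2" and l: "0 < l"
  shows "norm x \<le> l"
proof (rule norm_blinfun_bound)
  fix h
  define k where "k = (1/l) *\<^sub>R x h"
  have xh: "x h = l *\<^sub>R k" using l by (simp add: k_def)
  have "4 * inner (x h) k = inner (x (h + k)) (h + k) - inner (x (h - k)) (h - k)"
    using sym[of k h] by (simp add: blinfun_apply_simps inner_diff_left inner_diff_right inner_add_left inner_add_right inner_commute)
  also have "\<dots> \<le> l * (norm (h + k))\<^sup>2" using x(1)[of "h - k"] x(2)[of "h + k"] by linarith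
  also have "\<dots> \<le> l * (2 * (norm h)\<^sup>2 + 2 * (norm k)\<^sup>2)"
  proof (rule mult_left_mono)
    have "0 \<le> inner (h - k) (h - k)" by simp
    then show "(norm (h + k))\<^sup>2 \<le> 2 * (norm h)\<^sup>2 + 2 * (norm k)\<^sup>2" unfolding power2_norm_eq_inner
      by (simp add: inner_diff_left inner_diff_right inner_add_left inner_add_right inner_commute)
  qed (use l in simp)
  finally have "l * (4 * (norm k)\<^sup>2) \<le> l * (2 * (norm h)\<^sup>2 + 2 * (norm k)\<^sup>2)"
    by (simp add: xh power2_norm_eq_inner)
  then have "(norm k)\<^sup>2 \<le> (norm h)\<^sup>2" using l by simp
  then have "norm k \<le> norm h" by (rule power2_le_imp_le) simp
  then show "norm (x h) \<le> l * norm h" using l by (simp add: xh)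
qed (use l in simp)

locale commutant_automorphism =
  fixes B :: "('h::complex_hilbert_space \<Rightarrow>\<^sub>L 'h) set" and \<theta>
  assumes vN: "von_neumann_algebra B" and \<theta>: "\<theta> \<in> automorphisms (commutant B)"
begin

lemma B: "B \<subseteq> bounded_ops" "S \<in> B \<Longrightarrow> adj S \<in> B"
  using von_neumann_algebraD[OF vN] by auto

lemma
  shows theta_in: "x \<in> commutant B \<Longrightarrow> \<theta> x \<in> commutant B"
    and theta_surj: "y \<in> commutant B \<Longrightarrow> \<exists>x\<in>commutant B. \<theta> x = y"
    and theta_inj: "\<lbrakk>x \<in> commutant B; y \<in> commutant B; \<theta> x = \<theta> y\<rbrakk> \<Longrightarrow> x = y"
    and theta_add: "\<lbrakk>x \<in> commutant B; y \<in> commutant B\<rbrakk> \<Longrightarrow> \<theta> (x + y) = \<theta> x + \<theta> y"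
    and theta_op_scaleC: "x \<in> commutant B \<Longrightarrow> \<theta> (op_scaleC c x) = op_scaleC c (\<theta> x)"
    and theta_compose: "\<lbrakk>x \<in> commutant B; y \<in> commutant B\<rbrakk> \<Longrightarrow> \<theta> (x o\<^sub>L y) = \<theta> x o\<^sub>L \<theta> y"
    and theta_adj: "x \<in> commutant B \<Longrightarrow> \<theta> (adj x) = adj (\<theta> x)"
proof -
  have bij: "bij_betw \<theta> (commutant B) (commutant B)"
    and hom: "\<forall>x\<in>commutant B. \<forall>y\<in>commutant B. \<theta> (x + y) = \<theta> x + \<theta> y"
      "\<forall>c. \<forall>x\<in>commutant B. \<theta> (op_scaleC c x) = op_scaleC c (\<theta> x)"
      "\<forall>x\<in>commutant B. \<forall>y\<in>commutant B. \<theta> (x o\<^sub>L y) = \<theta> x o\<^sub>L \<theta> y"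
      "\<forall>x\<in>commutant B. \<theta> (adj x) = adj (\<theta> x)"
    using \<theta> unfolding automorphisms_def by simp_all
  show "x \<in> commutant B \<Longrightarrow> \<theta> x \<in> commutant B" by (rule bij_betwE[OF bij, rule_format])
  show "y \<in> commutant B \<Longrightarrow> \<exists>x\<in>commutant B. \<theta> x = y"
    using bij_betw_imp_surj_on[OF bij] by (metis imageE)
  show "\<lbrakk>x \<in> commutant B; y \<in> commutant B; \<theta> x = \<theta> y\<rbrakk> \<Longrightarrow> x = y"
    by (rule inj_onD[OF bij_betw_imp_inj_on[OF bij]])
  show "\<lbrakk>x \<in> commutant B; y \<in> commutant B\<rbrakk> \<Longrightarrow> \<theta> (x + y) = \<theta> x + \<theta> y"
    "x \<in> commutant B \<Longrightarrow> \<theta> (op_scaleC c x) = op_scaleC c (\<theta> x)"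
    "\<lbrakk>x \<in> commutant B; y \<in> commutant B\<rbrakk> \<Longrightarrow> \<theta> (x o\<^sub>L y) = \<theta> x o\<^sub>L \<theta> y"
    "x \<in> commutant B \<Longrightarrow> \<theta> (adj x) = adj (\<theta> x)"
    using hom by simp_all
qed

lemma theta_scaleR: "x \<in> commutant B \<Longrightarrow> \<theta> (r *\<^sub>R x) = r *\<^sub>R \<theta> x"
  by (simp add: scaleR_eq_op_scaleC theta_op_scaleC)

lemma theta_0: "\<theta> 0 = 0"
  using theta_scaleR[OF commutant_0, of 0] by simp

lemma theta_diff: "\<lbrakk>x \<in> commutant B; y \<in> commutant B\<rbrakk> \<Longrightarrow> \<theta> (x - y) = \<theta> x - \<theta> y"
  using theta_add[of "x - y" y] commutant_diff[of x B y] by simp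

lemma theta_id: "\<theta> id_blinfun = id_blinfun"
proof -
  obtain y where y: "y \<in> commutant B" "\<theta> y = id_blinfun" using theta_surj[OF commutant_id] by blast
  have "\<theta> (id_blinfun o\<^sub>L y) = \<theta> id_blinfun o\<^sub>L \<theta> y" by (rule theta_compose[OF commutant_id y(1)])
  moreover have "id_blinfun o\<^sub>L z = z" "z o\<^sub>L id_blinfun = z" for z :: "'h \<Rightarrow>\<^sub>L 'h" by (auto intro: blinfun_eqI)
  ultimately show ?thesis using y by simp
qed

lemma commutant_bounded: "x \<in> commutant B \<Longrightarrow> x \<in> bounded_ops"
  using commutant_subset by blast

lemma theta_projection: "x \<in> commutant B \<Longrightarrow> is_projection x \<longleftrightarrow> is_projection (\<theta> x)"
  unfolding is_projection_def
  using commutant_bounded theta_in theta_compose theta_adj theta_inj commutant_compose commutant_adj[OF B]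
  by metis

lemma norm_theta_projection:
  assumes "x \<in> commutant B" "is_projection x"
  shows "(norm (\<theta> x \<xi>))\<^sup>2 = inner (\<theta> x \<xi>) \<xi>"
  using is_projectionD[OF theta_projection[THEN iffD1, OF assms]] by (simp add: power2_norm_eq_inner)

text \<open>As 1 - x/l is the square of a self-adjoint \<open>s\<close> in the commutant, its image
  is the square of the self-adjoint \<open>\<theta> s\<close>. Order bounds thus cross
  \<open>\<theta>\<close> by algebra alone.\<close>

lemma theta_positive_bound:
  assumes x: "x \<in> commutant B" "adj x = x" "\<And>h. 0 \<le> inner (x h) h" "\<And>h. inner (x h) h \<le> l * (norm h)\<^sup>2" "0 < l"
  shows "inner (\<theta> x \<xi>) \<xi> \<le> (norm \<xi>)\<^sup>2 * l"
proof -
  have xb: "x \<in> bounded_ops" by (rule commutant_bounded[OF x(1)])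
  have sym: "inner (x h) k = inner h (x k)" for h k using adj_inner[OF xb] x(2) by simp
  define a where "a = (1/l) *\<^sub>R x"
  have ac: "a \<in> commutant B" unfolding a_def by (rule commutant_scaleR[OF B(1) x(1)])
  have "norm x \<le> l" by (rule norm_le_quadratic_form[OF sym x(3-5)])
  then have n: "norm a \<le> 1" using x(5) by (simp add: a_def)
  have a_sym: "inner (a h) k = inner h (a k)" for h k by (simp add: a_def blinfun_apply_simps sym)
  obtain s where s: "s o\<^sub>L s = id_blinfun - a" "\<And>b. a o\<^sub>L b = b o\<^sub>L a \<Longrightarrow> s o\<^sub>L b = b o\<^sub>L s"
    "\<And>x y. inner (blinfun_apply s x) y = inner x (blinfun_apply s y)" "\<And>x. inner (blinfun_apply s x) x \<ge> 0"
    using op_sqrt_exists[OF n a_sym] by blast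
  have sb: "s \<in> bounded_ops"
    using commutant_bounded[OF ac] s(2) unfolding bounded_ops_commute_iff by blast
  have sc: "s \<in> commutant B"
    using ac s(2) sb by (auto simp: commutant_def)
  have "adj (\<theta> s) = \<theta> s" using adj_eqI[OF sb s(3)] theta_adj[OF sc] by simp
  then have "inner (\<theta> s (\<theta> s \<xi>)) \<xi> = inner (\<theta> s \<xi>) (\<theta> s \<xi>)"
    using adj_inner[OF commutant_bounded[OF theta_in[OF sc]]] by metis
  moreover have "\<theta> s o\<^sub>L \<theta> s = id_blinfun - (1/l) *\<^sub>R \<theta> x"
    using s(1) theta_compose[OF sc sc] theta_diff[OF commutant_id ac] theta_id theta_scaleR[OF x(1)] by (simp add: a_def)
  then have "\<theta> s (\<theta> s \<xi>) = \<xi> - (1/l) *\<^sub>R \<theta> x \<xi>"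
    by (auto dest: arg_cong[where f="\<lambda>f. blinfun_apply f \<xi>"] simp: blinfun.diff_left blinfun.scaleR_left)
  ultimately have "0 \<le> inner (\<xi> - (1/l) *\<^sub>R \<theta> x \<xi>) \<xi>" by simp
  then show ?thesis using x(5) by (simp add: inner_diff_left power2_norm_eq_inner field_simps)
qed

text \<open>A projection \<open>q\<close> on which the state \<open>\<langle>\<theta>(\<cdot>)\<xi>, \<xi>\<rangle>\<close> is nonzero and dominated by a multiple of \<open>\<langle>\<cdot>\<eta>, \<eta>\<rangle>\<close>. Here
  \<open>s\<close> is the support of the state; \<open>q\<close> is the complement in \<open>s\<close> of a maximal \<open>r\<close> for which the opposite domination
  holds, and \<open>r \<noteq> s\<close> because \<open>D\<close> exceeds the norm of \<open>\<xi>\<close>.\<close>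

lemma dominated_projection_exists:
  assumes \<xi>: "\<xi> \<noteq> 0"
  obtains q \<eta> D where "q \<in> commutant B" "is_projection q" "\<theta> q \<xi> \<noteq> 0" "D \<ge> 0"
    "\<And>p. \<lbrakk>p \<in> commutant B; is_projection p; p o\<^sub>L q = p\<rbrakk> \<Longrightarrow> norm (\<theta> p \<xi>) \<le> D * norm (p \<eta>)"
proof -
  define W where "W = (\<lambda>b. blinfun_apply b \<xi>) ` B"
  note vD = von_neumann_algebraD[OF vN]
  have sW: "subspace W"
  proof (rule subspaceI)
    have scR: "r *\<^sub>R S \<in> B" if "S \<in> B" for r S using vD(4)[OF that] by (simp add: scaleR_eq_op_scaleC)
    have "0 \<in> B" using scR[OF vD(2), of 0] by simp
    then show "0 \<in> W" by (force simp: W_def)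
    show "x + y \<in> W" if "x \<in> W" "y \<in> W" for x y
      using that vD(3) by (force simp: W_def blinfun.add_left[symmetric])
    show "c *\<^sub>R x \<in> W" if "x \<in> W" for c x
      using that scR by (force simp: W_def blinfun.scaleR_left[symmetric])
  qed
  have invW: "S k \<in> closure W" if "S \<in> B" "k \<in> closure W" for S k
    by (rule closure_invariant[OF _ _ that(2)])
      (use that(1) vD(5) in \<open>force simp: W_def blinfun_apply_blinfun_compose[symmetric] simp del: blinfun_apply_blinfun_compose intro!: continuous_intros\<close>)+
  have scW: "c *\<^sub>C k \<in> closure W" if "k \<in> closure W" for c k
    using invW[OF vD(4)[OF vD(2)] that] by simp
  define P where "P = orth_proj (closure W)"
  have P: "P \<in> commutant B"
    unfolding P_def using invW scW by (intro orth_proj_commutant B subspace_closure sW closed_closure) auto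
  have pP: "is_projection P"
    unfolding P_def using scW by (intro is_projection_orth_proj subspace_closure sW closed_closure) auto
  have "id_blinfun \<xi> \<in> W" unfolding W_def using vD(2) by (rule imageI)
  then have P\<xi>: "P \<xi> = \<xi>"
    unfolding P_def by (intro orth_proj_fixed subspace_closure sW) (auto simp: complete_eq_closed closure_subset[THEN subsetD])
  \<comment> \<open>\<open>P\<close> is the smallest projection of the commutant that fixes
    \<open>\<xi>\<close>, so its preimage is the support of the state.\<close>
  obtain s where s: "s \<in> commutant B" "\<theta> s = P" using theta_surj[OF P] by blast
  have ps: "is_projection s" using theta_projection[OF s(1)] pP s(2) by simp
  note sD = is_projectionD[OF ps]
  have "s \<noteq> 0" using P\<xi> \<xi> s(2) theta_0 by auto
  then obtain h where h: "s h \<noteq> 0" by (metis blinfun_eqI blinfun.zero_left)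
  \<comment> \<open>Any unit vector in the range of \<open>s\<close> serves: at \<open>r = s\<close>
    the inequality in \<open>Q\<close> would read
    \<open>D \<le> norm (\<theta> s \<xi>)\<close>.\<close>
  define \<eta> where "\<eta> = (1 / norm (s h)) *\<^sub>R s h"
  have s\<eta>: "s \<eta> = \<eta>" and n\<eta>: "norm \<eta> = 1" using h by (auto simp: \<eta>_def blinfun_apply_simps sD)
  define D where "D = 1 + norm \<xi>"
  have D: "D > 0" by (simp add: D_def add_pos_nonneg)
  define Q where "Q = {r \<in> commutant B. is_projection r \<and> s o\<^sub>L r = r \<and> D * norm (r \<eta>) \<le> norm (\<theta> r \<xi>)}"
  have adjoint: "r o\<^sub>L r' = r" if "is_projection r" "is_projection r'" "r' o\<^sub>L r = r" for r r' :: "'h \<Rightarrow>\<^sub>L 'h"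
    using projection_diff(2) that by blast
  have mono: "norm (\<theta> r \<xi>) \<le> norm (\<theta> r' \<xi>)"
    if "r \<in> commutant B" "r' \<in> commutant B" "is_projection r" "is_projection r'" "r' o\<^sub>L r = r" for r r'
  proof -
    have "\<theta> r o\<^sub>L \<theta> r' = \<theta> r" using theta_compose[OF that(1,2)] adjoint[OF that(3-5)] by simp
    then have "\<theta> r \<xi> = \<theta> r (\<theta> r' \<xi>)" by (metis blinfun_apply_blinfun_compose)
    then show ?thesis using norm_projection_le theta_projection that by metis
  qed
  have "\<exists>m\<in>Q. \<forall>a\<in>Q. a o\<^sub>L m = m \<longrightarrow> a = m"
  proof (rule predicate_Zorn[where P="\<lambda>r r'. r' o\<^sub>L r = r"])
    show "partial_order_on Q (relation_of (\<lambda>r r'. r' o\<^sub>L r = r) Q)"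
    proof (rule partial_order_on_relation_ofI)
      show "a o\<^sub>L a = a" if "a \<in> Q" for a using that by (simp add: Q_def is_projection_def)
      show "c o\<^sub>L a = a" if "b o\<^sub>L a = a" "c o\<^sub>L b = b" for a b c
        using that by (metis blinfun_compose_assoc)
      show "a = b" if "a \<in> Q" "b \<in> Q" "b o\<^sub>L a = a" "a o\<^sub>L b = b" for a b
        using that adjoint[of a b] by (simp add: Q_def)
    qed
    fix C assume "C \<in> Chains (relation_of (\<lambda>r r'. r' o\<^sub>L r = r) Q)"
    then have C: "C \<subseteq> Q" "\<And>r r'. r \<in> C \<Longrightarrow> r' \<in> C \<Longrightarrow> r' o\<^sub>L r = r \<or> r o\<^sub>L r' = r'"
      by (auto simp: Chains_def relation_of_def)
    \<comment> \<open>The union of the ranges in the chain, with 0 added for the empty chain; the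
      projection onto its closure is the supremum.\<close>
    define V where "V = {x. x = 0 \<or> (\<exists>r\<in>C. r x = x)}"
    have chain: "r' x = x" if "r x = x" "r' o\<^sub>L r = r" for r r' :: "'h \<Rightarrow>\<^sub>L 'h" and x
      using that by (metis blinfun_apply_blinfun_compose)
    have sV: "subspace V"
    proof (rule subspaceI)
      show "x + y \<in> V" if "x \<in> V" "y \<in> V" for x y
      proof (cases "x = 0 \<or> y = 0")
        case False
        then obtain r r' where r: "r \<in> C" "r x = x" "r' \<in> C" "r' y = y" using \<open>x \<in> V\<close> \<open>y \<in> V\<close> by (auto simp: V_def)
        have "r' (x + y) = x + y \<or> r (x + y) = x + y"
          using C(2)[OF r(1,3)] chain[OF r(2)] chain[OF r(4)] r by (auto simp: blinfun.add_right)
        then show ?thesis using r(1,3) by (auto simp: V_def)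
      qed (use that in auto)
      show "c *\<^sub>R x \<in> V" if "x \<in> V" for c x
        using that by (auto simp: V_def blinfun.scaleR_right)
    qed (simp add: V_def)
    have scV: "c *\<^sub>C x \<in> closure V" if "x \<in> closure V" for c x
    proof (rule closure_invariant[OF _ _ that])
      show "c *\<^sub>C x \<in> V" if "x \<in> V" for x
      proof (cases "x = 0")
        case True
        then show ?thesis using norm_scaleC[of c x] by (simp add: V_def)
      next
        case False
        then obtain r where "r \<in> C" "r x = x" using \<open>x \<in> V\<close> by (auto simp: V_def)
        moreover have "r \<in> bounded_ops" using \<open>r \<in> C\<close> C(1) commutant_bounded by (auto simp: Q_def)
        ultimately have "r \<in> C \<and> r (c *\<^sub>C x) = c *\<^sub>C x" by (simp add: bounded_ops_apply)
        then show ?thesis unfolding V_def by blast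
      qed
    qed (rule linear_continuous_on[OF bounded_linear_scaleC])
    have invV: "S k \<in> closure V" if S: "S \<in> B" and k: "k \<in> closure V" for S k
    proof (rule closure_invariant[OF _ _ k])
      show "S x \<in> V" if "x \<in> V" for x
        using that S C(1) commutant_apply by (force simp: V_def blinfun.zero_right Q_def)
    qed (rule linear_continuous_on[OF blinfun.bounded_linear_right])
    define u where "u = orth_proj (closure V)"
    have cV: "subspace (closure V)" "complete (closure V)" using sV by (auto simp: subspace_closure complete_eq_closed)
    have uc: "u \<in> commutant B"
      unfolding u_def using invV scV by (intro orth_proj_commutant B cV closed_closure) auto
    have pu: "is_projection u" unfolding u_def using scV by (intro is_projection_orth_proj cV closed_closure) auto
    have su: "s o\<^sub>L u = u"
    proof (rule blinfun_eqI)
      fix x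
      have "(s - id_blinfun) (u x) \<in> closure {0}"
      proof (rule closure_invariant[of "blinfun_apply (s - id_blinfun)" V "{0}"])
        show "u x \<in> closure V" unfolding u_def by (rule orth_proj_in[OF cV])
        show "(s - id_blinfun) y \<in> {0}" if "y \<in> V" for y
          using that C(1) chain by (force simp: V_def Q_def blinfun_apply_simps)
      qed (intro continuous_intros)
      then show "(s o\<^sub>L u) x = u x" by (simp add: blinfun.diff_left)
    qed
    have ur: "u o\<^sub>L r = r" if r: "r \<in> C" for r
    proof (rule blinfun_eqI)
      fix x
      have "r (r x) = r x" using r C(1) is_projectionD(2) by (auto simp: Q_def)
      then have "r x \<in> V" using r by (auto simp: V_def)
      then show "(u o\<^sub>L r) x = r x"
        unfolding u_def by (simp add: orth_proj_fixed[OF cV] closure_subset[THEN subsetD])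
    qed
    have "D * norm (u \<eta>) \<le> norm (\<theta> u \<xi>)"
    proof -
      \<comment> \<open>At \<open>v = u \<eta>\<close> this is the wanted inequality. For
        \<open>v\<close> in the range of a chain member \<open>r\<close>, the vector
        \<open>r \<eta>\<close> is at least as close to \<open>u \<eta>\<close> as \<open>v\<close>
        is, and \<open>\<theta>\<close> enters through monotonicity.\<close>
      have "norm (\<theta> u \<xi>) - D * (norm (u \<eta>) - norm (u \<eta> - u \<eta>)) \<in> closure {0..}"
      proof (rule closure_invariant[of "\<lambda>v. norm (\<theta> u \<xi>) - D * (norm (u \<eta>) - norm (u \<eta> - v))" V])
        show "u \<eta> \<in> closure V" unfolding u_def by (rule orth_proj_in[OF cV])
        fix v assume "v \<in> V"
        show "norm (\<theta> u \<xi>) - D * (norm (u \<eta>) - norm (u \<eta> - v)) \<in> {0..}"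
        proof (cases "v = 0")
          case False
          then obtain r where r: "r \<in> C" "r v = v" using \<open>v \<in> V\<close> by (auto simp: V_def)
          have rQ: "r \<in> commutant B" "is_projection r" "D * norm (r \<eta>) \<le> norm (\<theta> r \<xi>)"
            using r C(1) by (auto simp: Q_def)
          have "r o\<^sub>L u = r" by (rule adjoint[OF rQ(2) pu ur[OF r(1)]])
          then have "r (u \<eta>) = r \<eta>" by (metis blinfun_apply_blinfun_compose)
          then have e: "u \<eta> - r \<eta> = (id_blinfun - r) (u \<eta> - v)"
            using r(2) by (simp add: blinfun_apply_simps)
          have "is_projection (id_blinfun - r)"
            by (rule projection_diff(1)[OF _ rQ(2)])
               (auto simp: is_projection_def bounded_ops_id adj_id intro!: blinfun_eqI)
          then have "norm (u \<eta> - r \<eta>) \<le> norm (u \<eta> - v)" unfolding e by (rule norm_projection_le)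
          then have "norm (u \<eta>) - norm (u \<eta> - v) \<le> norm (r \<eta>)"
            using norm_triangle_ineq2[of "u \<eta>" "r \<eta>"] by linarith
          then have "D * (norm (u \<eta>) - norm (u \<eta> - v)) \<le> D * norm (r \<eta>)" using D by (intro mult_left_mono) auto
          also have "\<dots> \<le> norm (\<theta> u \<xi>)"
            using rQ(3) mono[OF rQ(1) uc rQ(2) pu ur[OF r(1)]] by linarith
          finally show ?thesis by simp
        qed simp
      qed (intro continuous_intros)
      then show ?thesis by simp
    qed
    then have "u \<in> Q" using uc pu su by (simp add: Q_def)
    then show "\<exists>u\<in>Q. \<forall>a\<in>C. u o\<^sub>L a = a" using ur by blast
  qed
  then obtain r where r: "r \<in> commutant B" "is_projection r" "s o\<^sub>L r = r" "D * norm (r \<eta>) \<le> norm (\<theta> r \<xi>)"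
    and r_max: "\<And>a. a \<in> Q \<Longrightarrow> a o\<^sub>L r = r \<Longrightarrow> a = r"
    by (auto simp: Q_def)
  have "r \<noteq> s"
  proof
    assume "r = s"
    then have "D \<le> norm (\<theta> s \<xi>)" using r(4) s\<eta> n\<eta> by simp
    also have "\<dots> \<le> norm \<xi>" using norm_projection_le pP s(2) by metis
    finally show False by (simp add: D_def)
  qed
  define q where "q = s - r"
  have qc: "q \<in> commutant B" unfolding q_def by (rule commutant_diff[OF s(1) r(1)])
  have pq: "is_projection q" unfolding q_def by (rule projection_diff(1)[OF ps r(2,3)])
  have rs: "r o\<^sub>L s = r" by (rule projection_diff(2)[OF ps r(2,3)])
  note rD = is_projectionD[OF r(2)]
  have sr': "s (r x) = r x" and rs': "r (s x) = r x" for x using r(3) rs by (metis blinfun_apply_blinfun_compose)+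
  have q_apply: "q x = s x - r x" for x by (simp add: q_def blinfun.diff_left)
  have "q \<noteq> 0" using \<open>r \<noteq> s\<close> by (simp add: q_def)
  \<comment> \<open>Otherwise \<open>\<theta> q\<close> kills the orbit of \<open>\<xi>\<close>
    under \<open>B\<close>, hence the range of \<open>P\<close>; but \<open>q\<close> lies below
    \<open>s\<close>, so \<open>\<theta> q\<close> lies below \<open>P\<close> and would be
    0.\<close>
  have "\<theta> q \<xi> \<noteq> 0"
  proof
    assume 0: "\<theta> q \<xi> = 0"
    have "q o\<^sub>L s = q" by (rule blinfun_eqI) (simp add: q_apply sD rs')
    then have \<theta>q: "\<theta> q = \<theta> q o\<^sub>L P" using theta_compose[OF qc s(1)] s(2) by simp
    have "\<theta> q (P x) \<in> closure {0}" for x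
    proof (rule closure_invariant[of "blinfun_apply (\<theta> q)" W "{0}"])
      show "P x \<in> closure W" unfolding P_def by (intro orth_proj_in subspace_closure sW) (simp add: complete_eq_closed)
      show "\<theta> q y \<in> {0}" if "y \<in> W" for y
        using that commutant_apply[OF theta_in[OF qc]] 0 by (auto simp: W_def blinfun.zero_right)
    qed (intro continuous_intros)
    then have "\<theta> q = 0" by (subst \<theta>q) (auto intro!: blinfun_eqI)
    then have "q = 0" using theta_inj[OF qc commutant_0] theta_0 by simp
    with \<open>q \<noteq> 0\<close> show False ..
  qed
  moreover have "norm (\<theta> p \<xi>) \<le> D * norm (p \<eta>)" if p: "p \<in> commutant B" "is_projection p" "p o\<^sub>L q = p" for p
  proof (rule ccontr)
    assume "\<not> ?thesis"
    then have less: "D * norm (p \<eta>) < norm (\<theta> p \<xi>)" by simp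
    note pD = is_projectionD[OF p(2)]
    have "q o\<^sub>L p = p"
      using arg_cong[OF p(3), of adj] by (simp add: adj_compose pD is_projectionD[OF pq])
    then have qp: "q (p x) = p x" for x by (metis blinfun_apply_blinfun_compose)
    have rp: "r (p x) = 0" for x
      using arg_cong[OF qp[of x], of "blinfun_apply r"] by (simp add: q_apply blinfun.diff_right rs' rD)
    have sp: "s (p x) = p x" for x using qp[of x] by (simp add: q_apply rp)
    have pr: "p (r x) = 0" for x
      by (rule inner_left_eqI) (metis inner_zero_left inner_zero_right pD(4) rD(4) rp)
    \<comment> \<open>A violating \<open>p\<close> is orthogonal to \<open>r\<close>, and adding it
      gives an element of \<open>Q\<close> above the maximal \<open>r\<close>.\<close>
    define a where "a = r + p"
    have ac: "a \<in> commutant B" unfolding a_def by (rule commutant_add[OF r(1) p(1)])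
    have a_apply: "a x = r x + p x" for x by (simp add: a_def blinfun.add_left)
    have adj_a: "adj a = a" by (simp add: a_def adj_add rD pD)
    have "a o\<^sub>L a = a" by (rule blinfun_eqI) (simp add: a_apply blinfun.add_right rD pD rp pr)
    then have pa: "is_projection a"
      using commutant_bounded[OF ac] adj_a by (simp add: is_projection_def)
    have "(D * norm (a \<eta>))\<^sup>2 = (D * norm (r \<eta>))\<^sup>2 + (D * norm (p \<eta>))\<^sup>2"
    proof -
      have "inner (r \<eta>) (p \<eta>) = 0" by (simp add: rD rp)
      then have "(norm (a \<eta>))\<^sup>2 = (norm (r \<eta>))\<^sup>2 + (norm (p \<eta>))\<^sup>2"
        unfolding power2_norm_eq_inner by (simp add: a_apply inner_add_left inner_add_right inner_commute)
      then show ?thesis by (simp add: power_mult_distrib distrib_left)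
    qed
    also have "\<dots> \<le> (norm (\<theta> r \<xi>))\<^sup>2 + (norm (\<theta> p \<xi>))\<^sup>2"
      using r(4) less D by (intro add_mono power_mono) auto
    also have "\<dots> = (norm (\<theta> a \<xi>))\<^sup>2"
      using norm_theta_projection[OF r(1,2)] norm_theta_projection[OF p(1,2)] norm_theta_projection[OF ac pa]
      by (simp add: a_def theta_add r(1) p(1) blinfun.add_left inner_add_left)
    finally have "D * norm (a \<eta>) \<le> norm (\<theta> a \<xi>)" by (rule power2_le_imp_le) simp
    moreover have "s o\<^sub>L a = a" by (rule blinfun_eqI) (simp add: a_apply blinfun.add_right sr' sp)
    ultimately have "a \<in> Q" using ac pa by (simp add: Q_def)
    moreover have "a o\<^sub>L r = r" by (rule blinfun_eqI) (simp add: a_apply rD pr)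
    ultimately have "a = r" by (rule r_max)
    then have "p = 0" by (simp add: a_def)
    with less theta_0 show False by simp
  qed
  ultimately show ?thesis using that[OF qc pq _ less_imp_le[OF D]] by blast
qed

text \<open>A construction of GNS type. The closure clause places the range of \<open>t\<close> in
  the cyclic subspace of \<open>\<xi>\<close>, so no nonzero \<open>\<xi>\<close> can have its
  cyclic subspace orthogonal to all ranges of intertwiners.\<close>

lemma intertwiner_exists:
  assumes \<xi>: "\<xi> \<noteq> 0"
  obtains t where "t \<in> bounded_ops" "t \<noteq> 0" "\<And>y. y \<in> commutant B \<Longrightarrow> t o\<^sub>L y = \<theta> y o\<^sub>L t"
    "\<And>h. blinfun_apply t h \<in> closure ((\<lambda>y. blinfun_apply y \<xi>) ` commutant B)"
proof -
  obtain q \<eta> D where q: "q \<in> commutant B" "is_projection q" "\<theta> q \<xi> \<noteq> 0" and D: "D \<ge> 0"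
    and dom: "\<And>p. \<lbrakk>p \<in> commutant B; is_projection p; p o\<^sub>L q = p\<rbrakk> \<Longrightarrow> norm (\<theta> p \<xi>) \<le> D * norm (p \<eta>)"
    using dominated_projection_exists[OF \<xi>] by metis
  note qD = is_projectionD[OF q(2)]
  have bd: "norm (\<theta> (y o\<^sub>L q) \<xi>) \<le> D * norm (y (q \<eta>))" if y: "y \<in> commutant B" for y
  proof -
    have yb: "y \<in> bounded_ops" by (rule commutant_bounded[OF y])
    define z where "z = y o\<^sub>L q"
    have zc: "z \<in> commutant B" unfolding z_def by (rule commutant_compose[OF y q(1)])
    have zb: "z \<in> bounded_ops" by (rule commutant_bounded[OF zc])
    have azc: "adj z \<in> commutant B" by (rule commutant_adj[OF B zc])
    \<comment> \<open>On \<open>a\<close> both functionals are, up to the constant, squared norms,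
      so comparing them is the wanted bound; \<open>a o\<^sub>L q = a\<close> confines the bisection
      projections to those below \<open>q\<close>.\<close>
    define a where "a = adj z o\<^sub>L z"
    have ac: "a \<in> commutant B" unfolding a_def by (rule commutant_compose[OF azc zc])
    have form: "inner (a h) h = (norm (z h))\<^sup>2" for h
      using adj_inner[OF zb, of h "z h"] by (simp add: a_def power2_norm_eq_inner inner_commute)
    have "inner (\<theta> a \<xi>) \<xi> \<le> D\<^sup>2 * inner (a \<eta>) \<eta>"
    proof (rule positive_le_vector_functional[OF B(1) B(2), where \<omega>="\<lambda>x. inner (\<theta> x \<xi>) \<xi>" and q=q and a=a and l="(norm z)\<^sup>2 + 1" and K="(norm \<xi>)\<^sup>2"])
      show "inner (\<theta> p \<xi>) \<xi> \<le> D\<^sup>2 * inner (p \<eta>) \<eta>" if p: "p \<in> commutant B" "is_projection p" "p o\<^sub>L q = p" for p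
      proof -
        have "(norm (\<theta> p \<xi>))\<^sup>2 \<le> (D * norm (p \<eta>))\<^sup>2" by (intro power_mono dom p) simp
        moreover have "(norm (p \<eta>))\<^sup>2 = inner (p \<eta>) \<eta>" by (simp add: power2_norm_eq_inner is_projectionD[OF p(2)])
        ultimately show ?thesis by (simp add: norm_theta_projection[OF p(1,2)] power_mult_distrib)
      qed
      show "inner (a h) h \<le> ((norm z)\<^sup>2 + 1) * (norm h)\<^sup>2" for h
      proof -
        have "(norm (z h))\<^sup>2 \<le> (norm z * norm h)\<^sup>2" by (intro power_mono norm_blinfun) simp
        then show ?thesis by (simp add: form power_mult_distrib distrib_right add_increasing2)
      qed
      show "a o\<^sub>L q = a" by (rule blinfun_eqI) (simp add: a_def z_def qD)
      show "adj a = a" by (simp add: a_def adj_compose bounded_ops_adj zb adj_adj)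
      show "0 < (norm z)\<^sup>2 + 1" by (simp add: add_nonneg_pos)
      show "inner (\<theta> x \<xi>) \<xi> \<le> (norm \<xi>)\<^sup>2 * l"
        if "x \<in> commutant B" "adj x = x" "\<And>h. 0 \<le> inner (x h) h" "\<And>h. inner (x h) h \<le> l * (norm h)\<^sup>2" "0 < l" for x l
        by (rule theta_positive_bound[OF that])
    qed (simp_all add: theta_add theta_scaleR blinfun_apply_simps inner_add_left q ac form D)
    moreover have "inner (\<theta> a \<xi>) \<xi> = (norm (\<theta> z \<xi>))\<^sup>2"
      using adj_inner'[OF commutant_bounded[OF theta_in[OF zc]], of "\<theta> z \<xi>" \<xi>]
      by (simp add: a_def theta_compose zc azc theta_adj power2_norm_eq_inner)
    moreover have "D\<^sup>2 * inner (a \<eta>) \<eta> = (D * norm (y (q \<eta>)))\<^sup>2" by (simp add: form z_def power_mult_distrib)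
    ultimately have "(norm (\<theta> z \<xi>))\<^sup>2 \<le> (D * norm (y (q \<eta>)))\<^sup>2" by simp
    then show ?thesis unfolding z_def by (rule power2_le_imp_le) (simp add: D)
  qed
  define R where "R = (\<lambda>y. (blinfun_apply y (q \<eta>), blinfun_apply (\<theta> (y o\<^sub>L q)) \<xi>)) ` commutant B"
  have R: "subspace R"
  proof (rule subspaceI)
    have "(0 :: 'h \<Rightarrow>\<^sub>L 'h) o\<^sub>L q = 0" by (rule blinfun_eqI) simp
    then show "0 \<in> R" unfolding R_def by (intro image_eqI[of _ _ 0]) (simp_all add: commutant_0 theta_0 zero_prod_def)
    have add: "(y + y') o\<^sub>L q = (y o\<^sub>L q) + (y' o\<^sub>L q)" for y y' by (rule blinfun_eqI) (simp add: blinfun.add_left)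
    have sc: "(r *\<^sub>R y) o\<^sub>L q = r *\<^sub>R (y o\<^sub>L q)" for y r by (rule blinfun_eqI) (simp add: blinfun.scaleR_left)
    show "x + x' \<in> R" if xx: "x \<in> R" "x' \<in> R" for x x'
    proof -
      obtain y y' where y: "y \<in> commutant B" "y' \<in> commutant B" "x = (y (q \<eta>), \<theta> (y o\<^sub>L q) \<xi>)" "x' = (y' (q \<eta>), \<theta> (y' o\<^sub>L q) \<xi>)"
        using xx unfolding R_def by blast
      then show ?thesis unfolding R_def
        by (intro image_eqI[of _ _ "y + y'"]) (simp_all add: commutant_add add theta_add commutant_compose q(1) blinfun.add_left)
    qed
    show "r *\<^sub>R x \<in> R" if x: "x \<in> R" for r x
    proof -
      obtain y where y: "y \<in> commutant B" "x = (y (q \<eta>), \<theta> (y o\<^sub>L q) \<xi>)"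
        using x unfolding R_def by blast
      then show ?thesis unfolding R_def
        by (intro image_eqI[of _ _ "r *\<^sub>R y"]) (simp_all add: commutant_scaleR[OF B(1)] sc theta_scaleR commutant_compose q(1) blinfun.scaleR_left)
    qed
  qed
  have bdR: "norm k \<le> D * norm h" if "(h, k) \<in> R" for h k using that bd by (auto simp: R_def)
  obtain t where t: "\<And>h k. (h, k) \<in> R \<Longrightarrow> blinfun_apply t h = k"
      "\<And>g. (\<And>h k. (h, k) \<in> R \<Longrightarrow> inner g h = 0) \<Longrightarrow> blinfun_apply t g = 0"
      "\<And>g. blinfun_apply t g \<in> closure (snd ` R)"
    using linear_relation_extension[OF R bdR] by blast
  have inv: "(x h, \<theta> x k) \<in> R" if x: "x \<in> commutant B" and hk: "(h, k) \<in> R" for x h k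
  proof -
    obtain y where y: "y \<in> commutant B" "h = y (q \<eta>)" "k = \<theta> (y o\<^sub>L q) \<xi>" using hk unfolding R_def by blast
    have "\<theta> ((x o\<^sub>L y) o\<^sub>L q) = \<theta> x o\<^sub>L \<theta> (y o\<^sub>L q)"
      unfolding blinfun_compose_assoc by (intro theta_compose commutant_compose x y q)
    then show ?thesis unfolding R_def y
      by (intro image_eqI[of _ _ "x o\<^sub>L y"]) (simp_all add: commutant_compose x y(1))
  qed
  have tx: "t o\<^sub>L x = \<theta> x o\<^sub>L t" if x: "x \<in> commutant B" for x
    by (rule linear_relation_extension_intertwine[OF R t(1,2), where X'="adj x"])
       (use inv[OF x] inv[OF commutant_adj[OF B x]] adj_inner[OF commutant_bounded[OF x]] in blast)+
  \<comment> \<open>Complex linearity is the intertwining relation for scalar operators, which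
    \<open>\<theta>\<close> fixes.\<close>
  have tb: "t \<in> bounded_ops"
    unfolding bounded_ops_commute_iff
    using tx[OF commutant_op_scaleC[OF B(1) commutant_id]] theta_op_scaleC[OF commutant_id] theta_id by simp
  have "(id_blinfun (q \<eta>), \<theta> (id_blinfun o\<^sub>L q) \<xi>) \<in> R" unfolding R_def by (intro image_eqI[OF refl] commutant_id)
  moreover have "id_blinfun o\<^sub>L q = q" by (rule blinfun_eqI) simp
  ultimately have "t (q \<eta>) = \<theta> q \<xi>" using t(1) by simp
  then have "t \<noteq> 0" using q(3) by auto
  moreover have "t h \<in> closure ((\<lambda>y. blinfun_apply y \<xi>) ` commutant B)" for h
  proof -
    have "snd ` R \<subseteq> (\<lambda>y. blinfun_apply y \<xi>) ` commutant B"
      by (auto simp: R_def intro!: imageI theta_in commutant_compose q(1))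
    then show ?thesis using t(3) closure_mono by blast
  qed
  ultimately show ?thesis using that tb tx by blast
qed

end

section \<open>Groupoid normalisers\<close>

lemma is_projectionI:
  "\<lbrakk>p \<in> bounded_ops; adj p = p; \<And>h. blinfun_apply p (blinfun_apply p h) = blinfun_apply p h\<rbrakk> \<Longrightarrow> is_projection p"
  by (auto simp: is_projection_def intro!: blinfun_eqI)

lemma inner_eq_on_span:
  fixes G :: "('a::real_inner \<times> 'b::real_inner) set"
  assumes G: "\<And>p q. \<lbrakk>p \<in> G; q \<in> G\<rbrakk> \<Longrightarrow> inner (fst p) (fst q) = inner (snd p) (snd q)"
    and p: "p \<in> span G" and q: "q \<in> span G"
  shows "inner (fst p) (fst q) = inner (snd p) (snd q)"
proof -
  have sub: "subspace {q. inner (fst p) (fst q) = inner (snd p) (snd q)}" for p :: "'a \<times> 'b"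
    by (auto simp: subspace_def inner_add_right)
  have "inner (fst p) (fst q) = inner (snd p) (snd q)" if "p \<in> G" for p
    using span_induct[OF q sub[of p]] G[OF that] by simp
  then have "inner (fst q) (fst p) = inner (snd q) (snd p)"
    using span_induct[OF p sub[of q]] by (simp add: inner_commute)
  then show ?thesis by (simp add: inner_commute)
qed

lemma span_invariant:
  fixes f :: "'a::real_vector \<Rightarrow> 'b::real_vector"
  assumes "linear f" "\<And>x. x \<in> G \<Longrightarrow> f x \<in> H" "x \<in> span G"
  shows "f x \<in> span H"
proof -
  have "f ` span G \<subseteq> span H"
    using assms(1,2) by (simp add: linear_span_image[symmetric] image_subset_iff span_mono)
  then show ?thesis using assms(3) by blast
qed

locale von_neumann_inclusion =
  fixes B M :: "('h::complex_hilbert_space \<Rightarrow>\<^sub>L 'h) set"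
  assumes vB: "von_neumann_algebra B" and vM: "von_neumann_algebra M" and BM: "B \<subseteq> M"
begin

lemmas B_adj = von_neumann_algebraD(6)[OF vB]
lemmas B_compose = von_neumann_algebraD(5)[OF vB]
lemmas B_bounded = von_neumann_algebraD(1)[OF vB, THEN subsetD]
lemmas M_bounded = von_neumann_algebraD(1)[OF vM, THEN subsetD]

lemma N_bounded: "y \<in> commutant B \<Longrightarrow> y \<in> bounded_ops"
  using commutant_subset by blast

lemma N_adj: "y \<in> commutant B \<Longrightarrow> adj y \<in> commutant B"
  using commutant_adj B_adj von_neumann_algebraD(1)[OF vB] by blast

lemma B_memI: "\<lbrakk>T \<in> bounded_ops; \<And>y h. y \<in> commutant B \<Longrightarrow> blinfun_apply T (blinfun_apply y h) = blinfun_apply y (blinfun_apply T h)\<rbrakk> \<Longrightarrow> T \<in> B"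
  using double_commutant[OF vB] by (auto simp: commutant_def intro!: blinfun_eqI)

lemma M_memI: "\<lbrakk>T \<in> bounded_ops; \<And>y. y \<in> commutant M \<Longrightarrow> T o\<^sub>L y = y o\<^sub>L T\<rbrakk> \<Longrightarrow> T \<in> M"
  using double_commutant[OF vM] by (auto simp: commutant_def)

lemma commutant_M_subset: "commutant M \<subseteq> commutant B"
  by (rule commutant_antimono[OF BM])

text \<open>Unitaries of \<open>B\<close> are groupoid normalisers, and they span \<open>B\<close>,
  which is the commutant of its commutant.\<close>

lemma groupoid_normalisers_commutant_subset:
  "commutant (groupoid_normalisers M B) \<subseteq> commutant B"
proof
  fix x assume x: "x \<in> commutant (groupoid_normalisers M B)"
  have "x o\<^sub>L b = b o\<^sub>L x" if b: "b \<in> B" for b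
  proof (rule commutant_unitary_induct[of "commutant B" b "\<lambda>b. x o\<^sub>L b = b o\<^sub>L x"])
    show "b \<in> commutant (commutant B)" using b double_commutant[OF vB] by simp
    have xb: "x \<in> bounded_ops" using x commutant_subset by blast
    show "x o\<^sub>L (S + T) = (S + T) o\<^sub>L x" if "x o\<^sub>L S = S o\<^sub>L x" "x o\<^sub>L T = T o\<^sub>L x" for S T
      using compose_eq_apply[OF that(1)] compose_eq_apply[OF that(2)] by (intro blinfun_eqI) (simp add: blinfun_apply_simps)
    show "x o\<^sub>L op_scaleC c T = op_scaleC c T o\<^sub>L x" if "x o\<^sub>L T = T o\<^sub>L x" for c T
      using compose_eq_apply[OF that] bounded_ops_apply[OF xb] by (intro blinfun_eqI) simp
    fix u assume u: "u \<in> commutant (commutant B)" "adj u o\<^sub>L u = id_blinfun" "u o\<^sub>L adj u = id_blinfun"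
    have uB: "u \<in> B" using u(1) double_commutant[OF vB] by simp
    have "u \<in> groupoid_normalisers M B"
      using uB BM u(2) B_bounded[OF uB]
      by (auto simp: groupoid_normalisers_def partial_isometry_def is_projection_def adj_id bounded_ops_id
          intro!: B_compose B_adj blinfun_eqI)
    then show "x o\<^sub>L u = u o\<^sub>L x" using x by (auto simp: commutant_def)
  qed (use commutant_subset N_adj in auto)
  then show "x \<in> commutant B" using x by (auto simp: commutant_def)
qed

text \<open>\<open>v o\<^sub>L b o\<^sub>L adj v\<close> commutes with every
  \<open>\<theta> y\<close>, hence by surjectivity with the whole commutant, and so lies in
  \<open>B\<close>; the other conjugation is similar. As \<open>\<theta>\<close> fixes the commutant
  of \<open>M\<close>, \<open>v\<close> commutes with it and lies in \<open>M\<close>.\<close>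

lemma intertwiner_groupoid_normaliser:
  assumes fixing: "\<theta> \<in> automorphisms_fixing (commutant M) (commutant B)"
    and v: "partial_isometry v" "\<And>y. y \<in> commutant B \<Longrightarrow> v o\<^sub>L y = \<theta> y o\<^sub>L v"
  shows "v \<in> groupoid_normalisers M B"
proof -
  interpret commutant_automorphism B \<theta>
    using fixing vB by (simp add: commutant_automorphism_def automorphisms_fixing_def)
  have vb: "v \<in> bounded_ops" using v(1) by (simp add: partial_isometry_def)
  have "v \<in> M"
  proof (rule M_memI[OF vb])
    show "v o\<^sub>L m = m o\<^sub>L v" if m: "m \<in> commutant M" for m
      using v(2)[of m] commutant_M_subset m fixing by (auto simp: automorphisms_fixing_def)
  qed
  have vy: "v (y h) = \<theta> y (v h)" if "y \<in> commutant B" for y h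
    by (rule compose_eq_apply[OF v(2)[OF that]])
  have avy: "adj v (\<theta> y h) = y (adj v h)" if y: "y \<in> commutant B" for y h
  proof -
    have "adj (v o\<^sub>L adj y) = adj (\<theta> (adj y) o\<^sub>L v)" using v(2)[OF N_adj[OF y]] by simp
    then have "y o\<^sub>L adj v = adj v o\<^sub>L \<theta> y"
      by (simp add: adj_compose vb N_bounded y bounded_ops_adj adj_adj theta_adj theta_in)
    then show ?thesis by (rule compose_eq_apply[OF sym])
  qed
  have "v o\<^sub>L b o\<^sub>L adj v \<in> B" if b: "b \<in> B" for b
  proof (rule B_memI)
    show "v o\<^sub>L b o\<^sub>L adj v \<in> bounded_ops" by (intro bounded_ops_compose vb bounded_ops_adj B_bounded b)
    fix y h assume "y \<in> commutant B"
    then obtain z where z: "z \<in> commutant B" "\<theta> z = y" using theta_surj by blast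
    show "(v o\<^sub>L b o\<^sub>L adj v) (y h) = y ((v o\<^sub>L b o\<^sub>L adj v) h)"
      using avy[OF z(1)] commutant_apply[OF z(1) b] by (simp add: z(2)[symmetric] vy[OF z(1), symmetric])
  qed
  moreover have "adj v o\<^sub>L b o\<^sub>L v \<in> B" if b: "b \<in> B" for b
  proof (rule B_memI)
    show "adj v o\<^sub>L b o\<^sub>L v \<in> bounded_ops" by (intro bounded_ops_compose vb bounded_ops_adj B_bounded b)
    fix y h assume y: "y \<in> commutant B"
    show "(adj v o\<^sub>L b o\<^sub>L v) (y h) = y ((adj v o\<^sub>L b o\<^sub>L v) h)"
      using vy[OF y] commutant_apply[OF theta_in[OF y] b] by (simp add: avy[OF y, symmetric])
  qed
  ultimately show ?thesis using \<open>v \<in> M\<close> v(1) by (simp add: groupoid_normalisers_def)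
qed

lemma commutant_groupoid_normalisers_fixed:
  assumes x: "x \<in> commutant (groupoid_normalisers M B)"
    and fixing: "\<theta> \<in> automorphisms_fixing (commutant M) (commutant B)"
  shows "\<theta> x = x"
proof -
  interpret commutant_automorphism B \<theta>
    using fixing vB by (simp add: commutant_automorphism_def automorphisms_fixing_def)
  have xN: "x \<in> commutant B" using x groupoid_normalisers_commutant_subset by blast
  define d where "d = \<theta> x - x"
  have d: "d \<in> commutant B" unfolding d_def by (intro commutant_diff theta_in xN)
  have db: "d \<in> bounded_ops" by (rule N_bounded[OF d])
  have dt: "d (t h) = 0" if t: "t \<in> bounded_ops" "\<And>y. y \<in> commutant B \<Longrightarrow> t o\<^sub>L y = \<theta> y o\<^sub>L t" for t h
  proof -
    obtain v s where v: "partial_isometry v" "t = v o\<^sub>L s"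
      "\<And>X Y. \<lbrakk>X \<in> bounded_ops; Y \<in> bounded_ops; t o\<^sub>L X = Y o\<^sub>L t; t o\<^sub>L adj X = adj Y o\<^sub>L t\<rbrakk> \<Longrightarrow> v o\<^sub>L X = Y o\<^sub>L v"
      using polar_decomposition[OF t(1)] by blast
    have vy: "v o\<^sub>L y = \<theta> y o\<^sub>L v" if y: "y \<in> commutant B" for y
    proof (rule v(3))
      show "t o\<^sub>L adj y = adj (\<theta> y) o\<^sub>L t" using t(2)[OF N_adj[OF y]] theta_adj[OF y] by simp
    qed (use y in \<open>auto intro: N_bounded theta_in t\<close>)
    have "v \<in> groupoid_normalisers M B" by (rule intertwiner_groupoid_normaliser[OF fixing v(1) vy])
    then have "x o\<^sub>L v = v o\<^sub>L x" using x by (auto simp: commutant_def)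
    then have "x (v k) = \<theta> x (v k)" for k using vy[OF xN] by (metis blinfun_apply_blinfun_compose)
    then show ?thesis by (simp add: d_def v(2) blinfun.diff_left)
  qed
  \<comment> \<open>Since \<open>d\<close> kills the ranges of intertwiners, \<open>adj d h\<close>
    is orthogonal to them. An intertwiner into the cyclic subspace of this vector then has range
    orthogonal to itself.\<close>
  have "adj d = 0"
  proof (rule ccontr)
    assume "adj d \<noteq> 0"
    then obtain h where h: "adj d h \<noteq> 0" by (metis blinfun_eqI blinfun.zero_left)
    obtain t where t: "t \<in> bounded_ops" "t \<noteq> 0" "\<And>y. y \<in> commutant B \<Longrightarrow> t o\<^sub>L y = \<theta> y o\<^sub>L t"
      "\<And>k. blinfun_apply t k \<in> closure ((\<lambda>y. blinfun_apply y (adj d h)) ` commutant B)"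
      using intertwiner_exists[OF h] by metis
    have "inner (t k) (t k) = 0" for k
    proof (rule inner_closure_eq_0[OF _ t(4)])
      fix w assume "w \<in> (\<lambda>y. blinfun_apply y (adj d h)) ` commutant B"
      then obtain y where y: "y \<in> commutant B" "w = blinfun_apply y (adj d h)" by blast
      \<comment> \<open>Surjectivity turns \<open>adj y\<close> after \<open>t\<close> into
        \<open>t\<close> after \<open>z\<close>: the range of \<open>t\<close> is invariant under
        the commutant.\<close>
      obtain z where z: "z \<in> commutant B" "\<theta> z = adj y" using theta_surj[OF N_adj[OF y(1)]] by blast
      have "inner (t k) w = inner (adj y (t k)) (adj d h)"
        unfolding y(2) by (rule adj_inner'[OF N_bounded[OF y(1)]])
      also have "adj y (t k) = t (z k)" using compose_eq_apply[OF t(3)[OF z(1)]] z(2) by simp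
      also have "inner (t (z k)) (adj d h) = inner (d (t (z k))) h" by (rule adj_inner[OF db, symmetric])
      also have "\<dots> = 0" using dt[OF t(1,3)] by simp
      finally show "inner (t k) w = 0" .
    qed
    then have "t = 0" by (intro blinfun_eqI) simp
    with t(2) show False ..
  qed
  then have "d = 0" using adj_adj[OF db] adj_0 by metis
  then show ?thesis by (simp add: d_def)
qed

lemma groupoid_normalisersD:
  assumes v: "v \<in> groupoid_normalisers M B"
  shows "v \<in> M" "v \<in> bounded_ops" "b \<in> B \<Longrightarrow> v o\<^sub>L b o\<^sub>L adj v \<in> B" "b \<in> B \<Longrightarrow> adj v o\<^sub>L b o\<^sub>L v \<in> B"
    "adj v o\<^sub>L v \<in> B" "blinfun_apply v (blinfun_apply (adj v) (blinfun_apply v h)) = blinfun_apply v h"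
    "blinfun_apply (adj v) (blinfun_apply v (blinfun_apply (adj v) h)) = blinfun_apply (adj v) h"
proof -
  show vb: "v \<in> M" "v \<in> bounded_ops" and B: "b \<in> B \<Longrightarrow> v o\<^sub>L b o\<^sub>L adj v \<in> B" "b \<in> B \<Longrightarrow> adj v o\<^sub>L b o\<^sub>L v \<in> B" for b
    using v M_bounded by (auto simp: groupoid_normalisers_def)
  have "adj v o\<^sub>L id_blinfun o\<^sub>L v = adj v o\<^sub>L v" by (rule blinfun_eqI) simp
  then show "adj v o\<^sub>L v \<in> B" using B(2)[OF von_neumann_algebraD(2)[OF vB]] by simp
  have p: "is_projection (adj v o\<^sub>L v)" using v by (simp add: groupoid_normalisers_def partial_isometry_def)
  have vv: "v o\<^sub>L adj v o\<^sub>L v = v"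
  proof (rule blinfun_eqI)
    fix h
    let ?k = "h - adj v (v h)"
    have "adj v (v ?k) = 0" using is_projectionD(2)[OF p, of h] by (simp add: blinfun.diff_right)
    then have "inner (v ?k) (v ?k) = 0" by (simp add: adj_inner[OF vb(2)])
    then show "(v o\<^sub>L adj v o\<^sub>L v) h = v h" by (simp add: blinfun.diff_right)
  qed
  then show "v (adj v (v h)) = v h" by (metis blinfun_apply_blinfun_compose)
  have "adj (v o\<^sub>L adj v o\<^sub>L v) = adj v" using vv by simp
  then have "adj v o\<^sub>L (v o\<^sub>L adj v) = adj v"
    by (simp add: adj_compose bounded_ops_compose vb bounded_ops_adj adj_adj)
  then show "adj v (v (adj v h)) = adj v h" by (metis blinfun_apply_blinfun_compose)
qed

lemma groupoid_normalisersI: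
  assumes "v \<in> M" "\<And>h. blinfun_apply v (blinfun_apply (adj v) (blinfun_apply v h)) = blinfun_apply v h"
    "\<And>b. b \<in> B \<Longrightarrow> v o\<^sub>L b o\<^sub>L adj v \<in> B" "\<And>b. b \<in> B \<Longrightarrow> adj v o\<^sub>L b o\<^sub>L v \<in> B"
  shows "v \<in> groupoid_normalisers M B"
proof -
  have vb: "v \<in> bounded_ops" using assms(1) M_bounded by blast
  have "is_projection (adj v o\<^sub>L v)"
    by (rule is_projectionI) (simp_all add: assms vb bounded_ops_compose bounded_ops_adj adj_compose adj_adj)
  then show ?thesis using assms vb by (simp add: groupoid_normalisers_def partial_isometry_def)
qed

lemma groupoid_normalisers_adj:
  assumes v: "v \<in> groupoid_normalisers M B"
  shows "adj v \<in> groupoid_normalisers M B"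
  using groupoid_normalisersD[OF v] von_neumann_algebraD(6)[OF vM]
  by (intro groupoid_normalisersI) (simp_all add: adj_adj)

text \<open>For unitary \<open>y\<close> the assignment \<open>b v v\<^sup>* h \<mapsto> b v y v\<^sup>* h\<close> is isometric, so it extends to an operator commuting
  with \<open>B\<close>; the unitaries span the commutant.\<close>

lemma conjugation_extends:
  assumes v: "v \<in> groupoid_normalisers M B" and y: "y \<in> commutant B"
  shows "\<exists>y'\<in>commutant B. \<forall>h. y' (v (adj v h)) = v (y (adj v h))"
proof (rule commutant_unitary_induct[of B y])
  note vD = groupoid_normalisersD[OF v]
  show "B \<subseteq> bounded_ops" "\<And>S. S \<in> B \<Longrightarrow> adj S \<in> B" using B_bounded B_adj by auto
  show "y \<in> commutant B" by fact
  show "\<exists>y'\<in>commutant B. \<forall>h. y' (v (adj v h)) = v ((S + T) (adj v h))"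
    if ST: "\<exists>y'\<in>commutant B. \<forall>h. y' (v (adj v h)) = v (S (adj v h))"
           "\<exists>y'\<in>commutant B. \<forall>h. y' (v (adj v h)) = v (T (adj v h))" for S T :: "'h \<Rightarrow>\<^sub>L 'h"
  proof -
    obtain S' T' where "S' \<in> commutant B" "T' \<in> commutant B"
      "\<And>h. blinfun_apply S' (v (adj v h)) = v (S (adj v h))" "\<And>h. blinfun_apply T' (v (adj v h)) = v (T (adj v h))" using ST by blast
    then show ?thesis by (intro bexI[of _ "S' + T'"] commutant_add) (simp_all add: blinfun_apply_simps)
  qed
  show "\<exists>y'\<in>commutant B. \<forall>h. y' (v (adj v h)) = v (op_scaleC c T (adj v h))"
    if T: "\<exists>y'\<in>commutant B. \<forall>h. y' (v (adj v h)) = v (T (adj v h))" for c and T :: "'h \<Rightarrow>\<^sub>L 'h"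
  proof -
    obtain T' where "T' \<in> commutant B" "\<And>h. blinfun_apply T' (v (adj v h)) = v (T (adj v h))" using T by blast
    then show ?thesis using commutant_op_scaleC[of B T' c] B_bounded
      by (intro bexI[of _ "op_scaleC c T'"]) (auto simp: bounded_ops_apply[OF vD(2)])
  qed
  fix u assume u: "u \<in> commutant B" "adj u o\<^sub>L u = id_blinfun"
  have uu: "inner (u h) (u k) = inner h k" for h k
    using adj_inner'[OF N_bounded[OF u(1)], of "u h" k] u(2) by (metis blinfun_apply_blinfun_compose blinfun_apply_id_blinfun)
  define G where "G = {(blinfun_apply b (v (adj v h)), blinfun_apply b (v (u (adj v h)))) | b h. b \<in> B}"
  have G: "inner (fst p) (fst q) = inner (snd p) (snd q)" if pq: "p \<in> G" "q \<in> G" for p q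
  proof -
    obtain b h b' h' where b: "b \<in> B" "b' \<in> B" "p = (blinfun_apply b (v (adj v h)), b (v (u (adj v h))))" "q = (blinfun_apply b' (v (adj v h')), b' (v (u (adj v h'))))"
      using pq unfolding G_def by blast
    \<comment> \<open>Inner products of the spanning pairs are governed by \<open>c\<close>, which
      lies in \<open>B\<close> by normalisation and so commutes with the unitary
      \<open>u\<close>.\<close>
    define c where "c = adj v o\<^sub>L (adj b o\<^sub>L b') o\<^sub>L v"
    have cB: "c \<in> B" unfolding c_def by (intro vD(4) B_compose B_adj b)
    have c: "inner (b (v k)) (b' (v k')) = inner k (c k')" for k k'
      by (simp add: c_def adj_inner[OF vD(2), symmetric] adj_inner[OF B_bounded[OF b(1)], symmetric])
    show ?thesis unfolding b fst_conv snd_conv c using uu commutant_apply[OF u(1) cB] by metis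
  qed
  have bd: "norm k \<le> 1 * norm h" if "(h, k) \<in> span G" for h k
    using inner_eq_on_span[OF G that that] by (simp add: norm_eq_sqrt_inner)
  obtain u' where u': "\<And>h k. (h, k) \<in> span G \<Longrightarrow> blinfun_apply u' h = k"
      "\<And>g. (\<And>h k. (h, k) \<in> span G \<Longrightarrow> inner g h = 0) \<Longrightarrow> blinfun_apply u' g = 0"
      "\<And>g. blinfun_apply u' g \<in> closure (snd ` span G)"
    using linear_relation_extension[OF subspace_span bd] by blast
  have inv: "(S h, S k) \<in> span G" if S: "S \<in> B" and hk: "(h, k) \<in> span G" for S h k
  proof -
    have lin: "linear (\<lambda>p. (S (fst p), S (snd p)))"
      by (rule linearI) (auto simp: blinfun_apply_simps)
    have "(S (fst p), S (snd p)) \<in> G" if p: "p \<in> G" for p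
    proof -
      obtain b h where "b \<in> B" "p = (blinfun_apply b (v (adj v h)), b (v (u (adj v h))))" using p unfolding G_def by blast
      then show ?thesis unfolding G_def using B_compose[OF S] by (intro CollectI exI[of _ "S o\<^sub>L b"] exI[of _ h]) simp
    qed
    from span_invariant[OF lin this hk] show ?thesis by simp
  qed
  have u'S: "u' o\<^sub>L S = S o\<^sub>L u'" if S: "S \<in> B" for S
    by (rule linear_relation_extension_intertwine[OF subspace_span u'(1,2), where X'="adj S"])
       (use inv[OF S] inv[OF B_adj[OF S]] adj_inner[OF B_bounded[OF S]] in blast)+
  have "u' \<in> bounded_ops"
    unfolding bounded_ops_commute_iff using u'S von_neumann_algebraD(2,4)[OF vB] by blast
  then have "u' \<in> commutant B" using u'S by (simp add: commutant_def)
  moreover have "u' (v (adj v h)) = v (u (adj v h))" for h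
    by (rule u'(1), rule span_base) (use von_neumann_algebraD(2)[OF vB] in \<open>force simp: G_def\<close>)
  ultimately show "\<exists>y'\<in>commutant B. \<forall>h. y' (v (adj v h)) = v (u (adj v h))" by blast
qed

section \<open>Central projections and central supports\<close>

definition central_projection :: "('h \<Rightarrow>\<^sub>L 'h) \<Rightarrow> bool"
  where "central_projection z \<longleftrightarrow> is_projection z \<and> z \<in> B \<and> z \<in> commutant B"

lemma central_projectionD:
  assumes "central_projection z"
  shows "is_projection z" "z \<in> B" "z \<in> commutant B" "z \<in> bounded_ops" "adj z = z"
    "blinfun_apply z (blinfun_apply z h) = blinfun_apply z h"
    "b \<in> B \<Longrightarrow> blinfun_apply z (blinfun_apply b h) = blinfun_apply b (blinfun_apply z h)"
    "y \<in> commutant B \<Longrightarrow> blinfun_apply z (blinfun_apply y h) = blinfun_apply y (blinfun_apply z h)"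
proof -
  show z: "is_projection z" "z \<in> B" "z \<in> commutant B" using assms by (auto simp: central_projection_def)
  show "z \<in> bounded_ops" "adj z = z" "z (z h) = z h" using is_projectionD[OF z(1)] by auto
  show "b \<in> B \<Longrightarrow> z (b h) = b (z h)" by (rule commutant_apply[OF z(3)])
  show "y \<in> commutant B \<Longrightarrow> z (y h) = y (z h)" using commutant_apply[OF _ z(2)] by simp
qed

text \<open>The closed span of the vectors \<open>b (p h)\<close> is invariant under
  \<open>B\<close> and, as \<open>p\<close> lies in \<open>B\<close>, under its commutant, so the
  projection onto it is central. The last clause is minimality, phrased for arbitrary
  \<open>w\<close> to reach operators outside the centre.\<close>

lemma central_support_exists:
  assumes p: "p \<in> B"
  obtains z where "central_projection z" "\<And>h. blinfun_apply z (blinfun_apply p h) = blinfun_apply p h"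
    "\<And>(w :: 'h \<Rightarrow>\<^sub>L 'h) h. (\<And>b k. b \<in> B \<Longrightarrow> blinfun_apply w (blinfun_apply b (blinfun_apply p k)) = 0) \<Longrightarrow> blinfun_apply w (blinfun_apply z h) = 0"
proof -
  define G where "G = {blinfun_apply b (blinfun_apply p h) | b h. b \<in> B}"
  define V where "V = closure (span G)"
  have V: "subspace V" "closed V" "complete V"
    unfolding V_def by (auto intro!: subspace_closure subspace_span simp: complete_eq_closed)
  have inv: "f k \<in> V" if f: "bounded_linear f" "\<And>x. x \<in> G \<Longrightarrow> f x \<in> G" and k: "k \<in> V" for f k
    using k unfolding V_def
    by (intro closure_invariant[OF linear_continuous_on[OF f(1)] span_invariant[OF bounded_linear.linear[OF f(1)] f(2)]])
  have invB: "S k \<in> V" if S: "S \<in> B" and k: "k \<in> V" for S k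
  proof (rule inv[OF blinfun.bounded_linear_right _ k])
    show "S x \<in> G" if x: "x \<in> G" for x
    proof -
      obtain b h where "b \<in> B" "x = blinfun_apply b (p h)" using x unfolding G_def by blast
      then show ?thesis unfolding G_def using B_compose[OF S] by (intro CollectI exI[of _ "S o\<^sub>L b"] exI[of _ h]) simp
    qed
  qed
  have invN: "y k \<in> V" if y: "y \<in> commutant B" and k: "k \<in> V" for y k
  proof (rule inv[OF blinfun.bounded_linear_right _ k])
    show "y x \<in> G" if "x \<in> G" for x
      using that commutant_apply[OF y] p by (fastforce simp: G_def)
  qed
  have sc: "c *\<^sub>C k \<in> V" if "k \<in> V" for c k
    using invB[OF von_neumann_algebraD(4)[OF vB von_neumann_algebraD(2)[OF vB]] that] by simp
  show ?thesis
  proof (rule that[of "orth_proj V"])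
    have "orth_proj V \<in> commutant (commutant B)"
      using invN sc by (intro orth_proj_commutant V commutant_subset N_adj)
    moreover have "orth_proj V \<in> commutant B"
      using invB sc B_bounded by (intro orth_proj_commutant V B_adj) auto
    ultimately show "central_projection (orth_proj V)"
      using is_projection_orth_proj[OF V(1,2) sc] double_commutant[OF vB] by (simp add: central_projection_def)
    have "p h \<in> G" for h using von_neumann_algebraD(2)[OF vB] by (force simp: G_def)
    then show "orth_proj V (p h) = p h" for h
      unfolding V_def using closure_subset span_superset by (intro orth_proj_fixed V[unfolded V_def]) blast
    fix w :: "'h \<Rightarrow>\<^sub>L 'h" and h assume w: "\<And>b k. b \<in> B \<Longrightarrow> blinfun_apply w (blinfun_apply b (p k)) = 0"
    have "subspace {k. w k = 0}" by (auto simp: subspace_def blinfun_apply_simps)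
    then have "w k \<in> {0}" if "k \<in> span G" for k
      using span_induct[OF that, of "\<lambda>k. w k = 0"] w by (auto simp: G_def)
    then have "w (orth_proj V h) \<in> closure {0}"
      by (rule closure_invariant[OF linear_continuous_on[OF blinfun.bounded_linear_right] _
            orth_proj_in[OF V(1,3), of h, unfolded V_def], folded V_def])
    then show "w (orth_proj V h) = 0" by simp
  qed
qed

end

section \<open>Automorphisms induced by groupoid normalisers\<close>

text \<open>The assumptions say that \<open>z\<close> is the common central support of
  \<open>adj v o\<^sub>L v\<close> and \<open>v o\<^sub>L adj v\<close>. Minimality is stated as
  faithfulness: below \<open>z\<close>, an element of the commutant is determined by either
  corner.\<close>

locale full_groupoid_normaliser = von_neumann_inclusion B M
  for B M :: "('h::complex_hilbert_space \<Rightarrow>\<^sub>L 'h) set" +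
  fixes v z :: "'h \<Rightarrow>\<^sub>L 'h"
  assumes v: "v \<in> groupoid_normalisers M B" and z: "central_projection z"
    and z_source: "blinfun_apply z (adj v (v h)) = adj v (v h)"
    and z_range: "blinfun_apply z (v (adj v h)) = v (adj v h)"
    and source_faithful: "\<lbrakk>y \<in> commutant B; \<And>h. blinfun_apply y (adj v (v h)) = 0\<rbrakk> \<Longrightarrow> blinfun_apply y (blinfun_apply z k) = 0"
    and range_faithful: "\<lbrakk>y \<in> commutant B; \<And>h. blinfun_apply y (v (adj v h)) = 0\<rbrakk> \<Longrightarrow> blinfun_apply y (blinfun_apply z k) = 0"
begin

text \<open>The graph of the induced automorphism: conjugation on the range of \<open>v\<close>, the
  identity off \<open>z\<close>. In relational form, its algebraic properties follow from
  uniqueness.\<close>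

definition conjugate :: "('h \<Rightarrow>\<^sub>L 'h) \<Rightarrow> ('h \<Rightarrow>\<^sub>L 'h) \<Rightarrow> bool"
  where "conjugate y y' \<longleftrightarrow> y \<in> commutant B \<and> y' \<in> commutant B \<and>
    (\<forall>h. blinfun_apply y' (v (adj v h)) = v (y (adj v h))) \<and> (\<forall>h. blinfun_apply y' (h - z h) = y (h - z h))"

lemma conjugateD:
  assumes "conjugate y y'"
  shows "y \<in> commutant B" "y' \<in> commutant B" "blinfun_apply y' (v (adj v h)) = v (y (adj v h))"
    "blinfun_apply y' (h - z h) = y (h - z h)"
  using assms by (auto simp: conjugate_def)

lemma conjugate_unique:
  assumes "conjugate y y'" "conjugate y y''"
  shows "y' = y''"
proof (rule blinfun_eqI)
  note D = conjugateD[OF assms(1)] conjugateD[OF assms(2)]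
  fix h
  have "(y' - y'') (z h) = 0"
    by (rule range_faithful) (use D in \<open>auto intro: commutant_diff simp: blinfun.diff_left\<close>)
  then have "y' (z h) = y'' (z h)" by (simp add: blinfun.diff_left)
  moreover have "y' (h - z h) = y'' (h - z h)" using D by simp
  ultimately show "y' h = y'' h" by (simp add: blinfun.diff_right)
qed

lemma conjugate_exists:
  assumes y: "y \<in> commutant B"
  shows "\<exists>y'. conjugate y y'"
proof -
  note zD = central_projectionD[OF z]
  obtain w where w: "w \<in> commutant B" "\<And>h. blinfun_apply w (v (adj v h)) = v (y (adj v h))"
    using conjugation_extends[OF v y] by blast
  \<comment> \<open>Nothing is known about \<open>w\<close> off \<open>z\<close>, so it is replaced
    there by \<open>y\<close>.\<close>
  define y' where "y' = (w o\<^sub>L z) + (y o\<^sub>L (id_blinfun - z))"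
  have "y' \<in> commutant B"
    unfolding y'_def by (intro commutant_add commutant_compose commutant_diff commutant_id w y zD)
  then have "conjugate y y'"
    using y by (auto simp: conjugate_def y'_def blinfun_apply_simps z_range w zD)
  then show ?thesis ..
qed

lemma conjugate_M: "m \<in> commutant M \<Longrightarrow> conjugate m m"
  using commutant_M_subset commutant_apply[of m M v] groupoid_normalisersD(1)[OF v] by (auto simp: conjugate_def)

lemma conjugate_add: "\<lbrakk>conjugate x x'; conjugate y y'\<rbrakk> \<Longrightarrow> conjugate (x + y) (x' + y')"
  by (auto simp: conjugate_def commutant_add blinfun.add_left blinfun.add_right)

lemma conjugate_op_scaleC: "conjugate x x' \<Longrightarrow> conjugate (op_scaleC c x) (op_scaleC c x')"
  using commutant_op_scaleC[of B] B_bounded bounded_ops_apply[OF groupoid_normalisersD(2)[OF v]]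
  by (auto simp: conjugate_def subset_iff)

lemma conjugate_compose:
  assumes x: "conjugate x x'" and y: "conjugate y y'"
  shows "conjugate (x o\<^sub>L y) (x' o\<^sub>L y')"
proof -
  note vD = groupoid_normalisersD[OF v] and xD = conjugateD[OF x] and yD = conjugateD[OF y]
  have "x' (y' (v (adj v h))) = v (x (y (adj v h)))" for h
  proof -
    have "x' (y' (v (adj v h))) = x' (v (adj v (v (y (adj v h)))))" by (simp add: yD vD)
    also have "\<dots> = v (x (adj v (v (y (adj v h)))))" by (rule xD(3))
    also have "adj v (v (y (adj v h))) = y (adj v h)"
      using commutant_apply[OF yD(1) vD(5), of "adj v h"] by (simp add: vD)
    finally show ?thesis .
  qed
  moreover have "x' (y' (h - z h)) = x (y (h - z h))" for h
  proof -
    have "y (h - z h) = y h - z (y h)" by (simp add: blinfun.diff_right central_projectionD(8)[OF z yD(1)])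
    then show ?thesis using xD(4)[of "y h"] by (simp add: yD(4))
  qed
  ultimately show ?thesis using xD yD by (simp add: conjugate_def commutant_compose)
qed

lemma conjugate_adj:
  assumes x: "conjugate x x'"
  shows "conjugate (adj x) (adj x')"
proof -
  note vD = groupoid_normalisersD[OF v] and xD = conjugateD[OF x] and zD = central_projectionD[OF z]
  have xb: "x \<in> bounded_ops" "x' \<in> bounded_ops" using xD N_bounded by auto
  have fB: "v o\<^sub>L adj v \<in> B" using groupoid_normalisersD(5)[OF groupoid_normalisers_adj[OF v]] vD(2) by (simp add: adj_adj)
  have "adj x' (v (adj v h)) = v (adj x (adj v h))" for h
  proof (rule inner_left_eqI)
    fix k
    have "inner k (adj x' (v (adj v h))) = inner (v (adj v (x' k))) h"
      unfolding adj_inner[OF xb(2), symmetric] adj_inner'[OF vD(2), of "x' k"] adj_inner[OF vD(2)] ..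
    also have "v (adj v (x' k)) = v (x (adj v k))" using commutant_apply[OF xD(2) fB, of k] xD(3) by simp
    also have "inner (v (x (adj v k))) h = inner k (v (adj x (adj v h)))"
      unfolding adj_inner[OF vD(2), of "x (adj v k)"] adj_inner[OF xb(1)] adj_inner'[OF vD(2), of k] ..
    finally show "inner k (adj x' (v (adj v h))) = inner k (v (adj x (adj v h)))" .
  qed
  moreover have "adj x' (h - z h) = adj x (h - z h)" for h
  proof (rule inner_left_eqI)
    fix k
    have zz: "inner a (h - z h) = inner (a - z a) h" for a
      by (simp add: inner_diff_left inner_diff_right is_projectionD(4)[OF zD(1)])
    have "x' k - z (x' k) = x k - z (x k)" using xD(4)[of k] by (simp add: blinfun.diff_right zD(8) xD)
    then show "inner k (adj x' (h - z h)) = inner k (adj x (h - z h))"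
      by (simp add: adj_inner[OF xb(1), symmetric] adj_inner[OF xb(2), symmetric] zz)
  qed
  ultimately show ?thesis using xD by (simp add: conjugate_def N_adj)
qed

lemma full_groupoid_normaliser_adj: "full_groupoid_normaliser B M (adj v) z"
proof unfold_locales
  show "adj v \<in> groupoid_normalisers M B" "central_projection z"
    by (rule groupoid_normalisers_adj[OF v], rule z)
qed (use groupoid_normalisersD[OF v] z_source z_range source_faithful range_faithful in \<open>auto simp: adj_adj\<close>)

text \<open>Passing to the adjoint of \<open>v\<close> reverses the relation, so bijectivity of the
  induced map reduces to uniqueness and existence.\<close>

lemma conjugate_inverse:
  assumes "conjugate y y'"
  shows "full_groupoid_normaliser.conjugate B (adj v) z y' y"
proof -
  note vD = groupoid_normalisersD[OF v] and yD = conjugateD[OF assms]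
  have "y (adj v (v h)) = adj v (y' (v h))" for h
    using commutant_apply[OF yD(1) vD(5), of h] yD(3)[of "v h"] commutant_apply[OF yD(1) vD(5), of "adj v (v h)"] by (simp add: vD)
  then show ?thesis unfolding full_groupoid_normaliser.conjugate_def[OF full_groupoid_normaliser_adj]
    using yD vD by (simp add: adj_adj)
qed

lemma fixed_point_commutes:
  assumes x: "x \<in> fixed_points (commutant B) (automorphisms_fixing (commutant M) (commutant B))"
  shows "x o\<^sub>L v = v o\<^sub>L x"
proof -
  note vD = groupoid_normalisersD[OF v]
  interpret op: full_groupoid_normaliser B M "adj v" z by (rule full_groupoid_normaliser_adj)
  have xN: "x \<in> commutant B" using x by (simp add: fixed_points_def)
  define \<theta> where "\<theta> = restrict (\<lambda>y. THE y'. conjugate y y') (commutant B)"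
  have the: "(THE y'. conjugate y y') = w" if "conjugate y w" for y w
    using that conjugate_unique by blast
  have \<theta>_eq: "\<theta> y = w" if "conjugate y w" for y w
    using the[OF that] conjugateD(1)[OF that] by (simp add: \<theta>_def)
  have \<theta>: "conjugate y (\<theta> y)" if "y \<in> commutant B" for y
    using conjugate_exists[OF that] \<theta>_eq by metis
  have inj: "y = w" if "conjugate y u" "conjugate w u" for y w u
    using op.conjugate_unique conjugate_inverse that by blast
  have surj: "\<exists>y. conjugate y u" if u: "u \<in> commutant B" for u
    using op.conjugate_exists[OF u] op.conjugate_inverse vD(2) by (metis adj_adj)
  have "bij_betw \<theta> (commutant B) (commutant B)"
    unfolding bij_betw_def
  proof
    show "inj_on \<theta> (commutant B)" by (rule inj_onI) (metis \<theta> inj)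
    show "\<theta> ` commutant B = commutant B"
      using conjugateD(2)[OF \<theta>] surj \<theta>_eq conjugateD(1) by (auto simp: image_iff) metis
  qed
  moreover have "\<theta> \<in> extensional (commutant B)" by (simp add: \<theta>_def)
  moreover have "\<theta> (a + b) = \<theta> a + \<theta> b" "\<theta> (a o\<^sub>L b) = \<theta> a o\<^sub>L \<theta> b" if "a \<in> commutant B" "b \<in> commutant B" for a b
    using that by (auto intro!: \<theta>_eq conjugate_add conjugate_compose \<theta>)
  moreover have "\<theta> (op_scaleC c a) = op_scaleC c (\<theta> a)" "\<theta> (adj a) = adj (\<theta> a)" if "a \<in> commutant B" for a c
    using that by (auto intro!: \<theta>_eq conjugate_op_scaleC conjugate_adj \<theta>)
  moreover have "\<theta> m = m" if "m \<in> commutant M" for m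
    by (rule \<theta>_eq[OF conjugate_M[OF that]])
  ultimately have "\<theta> \<in> automorphisms_fixing (commutant M) (commutant B)"
    by (simp add: automorphisms_fixing_def automorphisms_def)
  then have "\<theta> x = x" using x by (simp add: fixed_points_def)
  then have c: "conjugate x x" using \<theta>[OF xN] by simp
  show ?thesis
  proof (rule blinfun_eqI)
    fix k
    have "x (v k) = v (x (adj v (v k)))" using conjugateD(3)[OF c, of "v k"] by (simp add: vD)
    also have "x (adj v (v k)) = adj v (v (x k))" using commutant_apply[OF xN vD(5), of k] by simp
    finally show "(x o\<^sub>L v) k = (v o\<^sub>L x) k" by (simp add: vD)
  qed
qed

end

section \<open>Partial action of normalisers on the centre, and the general case\<close>

context von_neumann_inclusion
begin

lemma central_projectionI:
  assumes "z \<in> B" "z \<in> commutant B" "adj z = z" "\<And>h. blinfun_apply z (blinfun_apply z h) = blinfun_apply z h"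
  shows "central_projection z"
  using assms B_bounded by (auto simp: central_projection_def intro!: is_projectionI)

lemma central_projection_compl: "central_projection z \<Longrightarrow> central_projection (id_blinfun - z)"
  and central_projection_compose: "\<lbrakk>central_projection z; central_projection w\<rbrakk> \<Longrightarrow> central_projection (z o\<^sub>L w)"
proof -
  note vD = von_neumann_algebraD[OF vB]
  have Bdiff: "S - T \<in> B" if "S \<in> B" "T \<in> B" for S T
    using that commutant_diff[of S "commutant B" T] double_commutant[OF vB] by simp
  show "central_projection (id_blinfun - z)" if z: "central_projection z"
  proof (rule central_projectionI)
    note zD = central_projectionD[OF z]
    show "id_blinfun - z \<in> B" by (rule Bdiff[OF vD(2) zD(2)])
    show "id_blinfun - z \<in> commutant B" by (rule commutant_diff[OF commutant_id zD(3)])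
    show "adj (id_blinfun - z) = id_blinfun - z" by (simp add: adj_diff bounded_ops_id adj_id zD(4,5))
    show "(id_blinfun - z) ((id_blinfun - z) h) = (id_blinfun - z) h" for h
      by (simp add: blinfun_apply_simps zD(6))
  qed
  show "central_projection (z o\<^sub>L w)" if z: "central_projection z" and w: "central_projection w"
  proof (rule central_projectionI)
    note zD = central_projectionD[OF z] and wD = central_projectionD[OF w]
    show "z o\<^sub>L w \<in> B" by (rule B_compose[OF zD(2) wD(2)])
    show "z o\<^sub>L w \<in> commutant B" by (rule commutant_compose[OF zD(3) wD(3)])
    have "w o\<^sub>L z = z o\<^sub>L w" by (rule blinfun_eqI) (simp add: zD(7)[OF wD(2)])
    then show "adj (z o\<^sub>L w) = z o\<^sub>L w" by (simp add: adj_compose zD(4,5) wD(4,5))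
    show "(z o\<^sub>L w) ((z o\<^sub>L w) h) = (z o\<^sub>L w) h" for h
      by (simp add: zD(7)[OF wD(2)] zD(6) wD(6))
  qed
qed

text \<open>The central projection \<open>c'\<close> with \<open>c' v v\<^sup>* = v c v\<^sup>*\<close>: the partial action of \<open>v\<close> on the centre.\<close>

lemma central_transport:
  assumes v: "v \<in> groupoid_normalisers M B" and c: "central_projection c"
  obtains c' where "central_projection c'" "\<And>h. blinfun_apply c' (v h) = v (c h)"
    "\<And>(w :: 'h \<Rightarrow>\<^sub>L 'h) h. (\<And>b k. b \<in> B \<Longrightarrow> blinfun_apply w (blinfun_apply b (v (c (adj v k)))) = 0) \<Longrightarrow> blinfun_apply w (c' h) = 0"
proof -
  note vD = groupoid_normalisersD[OF v] and cD = central_projectionD[OF c]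
  have pB: "v o\<^sub>L c o\<^sub>L adj v \<in> B" by (rule vD(3)[OF cD(2)])
  obtain c' where c': "central_projection c'" "\<And>h. blinfun_apply c' ((v o\<^sub>L c o\<^sub>L adj v) h) = (v o\<^sub>L c o\<^sub>L adj v) h"
    "\<And>(w :: 'h \<Rightarrow>\<^sub>L 'h) h. (\<And>b k. b \<in> B \<Longrightarrow> blinfun_apply w (blinfun_apply b ((v o\<^sub>L c o\<^sub>L adj v) k)) = 0) \<Longrightarrow> blinfun_apply w (blinfun_apply c' h) = 0"
    using central_support_exists[OF pB] by metis
  note c'D = central_projectionD[OF c'(1)]
  have ce: "c (adj v (v h)) = adj v (v (c h))" for h using cD(7)[OF vD(5), of h] by simp
  have 1: "c' (v (c h)) = v (c h)" for h
    using c'(2)[of "v h"] by (simp add: ce vD)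
  \<comment> \<open>Minimality of \<open>c'\<close> applies because
    \<open>adj v o\<^sub>L b o\<^sub>L v\<close> lies in \<open>B\<close> and commutes with
    \<open>c\<close>. So \<open>adj v\<close> maps the range of \<open>c'\<close> into that of
    \<open>c\<close>.\<close>
  have "((id_blinfun - c) o\<^sub>L adj v) (c' h) = 0" for h
  proof (rule c'(3))
    fix b k assume b: "b \<in> B"
    have "c (adj v (b (v x))) = adj v (b (v (c x)))" for x using cD(7)[OF vD(4)[OF b], of x] by simp
    then show "((id_blinfun - c) o\<^sub>L adj v) (b ((v o\<^sub>L c o\<^sub>L adj v) k)) = 0"
      by (simp add: blinfun_apply_simps cD)
  qed
  then have ac: "adj v (c' h) = c (adj v (c' h))" for h by (simp add: blinfun_apply_simps)
  have 2: "c' (v (h - c h)) = 0" for h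
  proof (rule inner_left_eqI)
    fix k
    have "inner k (c' (v (h - c h))) = inner (adj v (c' k)) (h - c h)"
      by (simp add: is_projectionD(4)[OF c'D(1), symmetric] adj_inner'[OF vD(2)])
    also have "\<dots> = inner (c (adj v (c' k))) (h - c h)" using ac by metis
    also have "\<dots> = inner (adj v (c' k)) (c (h - c h))" by (rule is_projectionD(4)[OF cD(1)])
    finally show "inner k (c' (v (h - c h))) = inner k 0" by (simp add: blinfun.diff_right cD)
  qed
  show ?thesis
  proof (rule that[OF c'(1)])
    show "c' (v h) = v (c h)" for h using 1[of h] 2[of h] by (simp add: blinfun.diff_right)
    show "w (c' h) = 0" if "\<And>b k. b \<in> B \<Longrightarrow> w (blinfun_apply b (v (c (adj v k)))) = 0" for w :: "'h \<Rightarrow>\<^sub>L 'h" and h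
      by (rule c'(3)) (simp add: that)
  qed
qed

text \<open>If \<open>c v c = 0\<close> then the self-adjoint normaliser \<open>v c + c v\<^sup>*\<close> swaps \<open>c\<close> with its disjoint transport.\<close>

lemma fixed_point_commutes_swap:
  assumes v: "v \<in> groupoid_normalisers M B" and c: "central_projection c"
    and cvc: "\<And>h. blinfun_apply c (v (c h)) = 0"
    and faithful: "\<And>y k. \<lbrakk>y \<in> commutant B; \<And>h. blinfun_apply y (adj v (v h)) = 0\<rbrakk> \<Longrightarrow> blinfun_apply y (c k) = 0"
    and x: "x \<in> fixed_points (commutant B) (automorphisms_fixing (commutant M) (commutant B))"
  shows "x (v (c h)) = v (x (c h))"
proof -
  note vD = groupoid_normalisersD[OF v] and cD = central_projectionD[OF c]
  have xN: "x \<in> commutant B" using x by (simp add: fixed_points_def)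
  obtain c' where c': "central_projection c'" "\<And>h. blinfun_apply c' (v h) = v (c h)"
    "\<And>(w :: 'h \<Rightarrow>\<^sub>L 'h) h. (\<And>b k. b \<in> B \<Longrightarrow> blinfun_apply w (blinfun_apply b (v (c (adj v k)))) = 0) \<Longrightarrow> blinfun_apply w (c' h) = 0"
    using central_transport[OF v c] by metis
  note c'D = central_projectionD[OF c'(1)]
  \<comment> \<open>Minimality of \<open>c'\<close> again: \<open>c\<close> moves past
    \<open>b\<close> and meets \<open>v\<close> after \<open>c\<close>, which gives 0.\<close>
  have cc': "c (c' h) = 0" for h
    by (rule c'(3)) (simp add: cD(7) cvc blinfun.zero_right)
  have c'c: "c' (c h) = 0" for h using cD(7)[OF c'D(2), of h] cc' by simp
  have cvc': "c (adj v (c h)) = 0" for h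
  proof (rule inner_left_eqI)
    fix k
    show "inner k (c (adj v (c h))) = inner k 0"
      using cvc[of k] by (simp add: is_projectionD(4)[OF cD(1), symmetric] adj_inner[OF vD(2), symmetric])
  qed
  have ce: "c (adj v (v h)) = adj v (v (c h))" for h using cD(7)[OF vD(5), of h] by simp
  have c'e: "c' (adj v (v h)) = adj v (v (c' h))" for h using c'D(7)[OF vD(5), of h] by simp
  have cf: "c (v (adj v h)) = v (adj v (c h))" for h
  proof -
    have "v o\<^sub>L adj v \<in> B" using groupoid_normalisersD(5)[OF groupoid_normalisers_adj[OF v]] vD(2) by (simp add: adj_adj)
    from cD(7)[OF this, of h] show ?thesis by simp
  qed
  have vcvc: "v (c (adj v (c h))) = 0" for h by (simp add: cvc' blinfun.zero_right)
  define u where "u = (v o\<^sub>L c) + (c o\<^sub>L adj v)"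
  have u_apply: "u h = v (c h) + c (adj v h)" for h by (simp add: u_def blinfun.add_left)
  have uM: "u \<in> M"
    unfolding u_def using BM[THEN subsetD, OF cD(2)] vD(1) by (intro von_neumann_algebraD(3,5,6)[OF vM])
  have adj_u: "adj u = u"
    by (simp add: u_def adj_add adj_compose bounded_ops_compose bounded_ops_adj vD(2) cD(4,5) adj_adj add.commute)
  \<comment> \<open>The square of \<open>u\<close> splits into a part under \<open>c'\<close> and a
    part under \<open>c\<close>; this dictates the support \<open>z\<close> chosen below.\<close>
  have uu: "u (u h) = v (c (adj v h)) + adj v (v (c h))" for h
    by (simp add: u_apply blinfun.add_right cvc cvc' cD(6) ce blinfun.zero_right)
  have uB: "u o\<^sub>L b o\<^sub>L u \<in> B" if b: "b \<in> B" for b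
  proof -
    have "c (b (v (c h))) = 0" for h by (simp add: cD(7)[OF b] cvc blinfun.zero_right)
    moreover have "c (adj v (b (c h))) = 0" for h by (simp add: cD(7)[OF b, symmetric] cvc')
    ultimately have "u o\<^sub>L b o\<^sub>L u = (v o\<^sub>L (c o\<^sub>L b o\<^sub>L c) o\<^sub>L adj v) + (c o\<^sub>L (adj v o\<^sub>L b o\<^sub>L v) o\<^sub>L c)"
      by (intro blinfun_eqI) (simp add: u_apply blinfun_apply_simps)
    then show ?thesis
      by (simp only:) (intro von_neumann_algebraD(3)[OF vB] vD(3) B_compose[OF B_compose[OF cD(2) vD(4)[OF b]] cD(2)]
        B_compose[OF B_compose[OF cD(2) b] cD(2)])
  qed
  have uuu: "u (u (u h)) = u h" for h
    unfolding uu by (simp add: u_apply blinfun.add_right vcvc cvc' cD(6) ce[symmetric] vD)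
       (simp add: ce cf[symmetric] cvc vD cD(6) blinfun.zero_right)
  have uGN: "u \<in> groupoid_normalisers M B"
    by (rule groupoid_normalisersI) (simp_all add: uM adj_u uuu uB)
  define z where "z = c + c'"
  have z_apply: "z h = c h + c' h" for h by (simp add: z_def blinfun.add_left)
  have z_central: "central_projection z"
  proof (rule central_projectionI)
    show "z \<in> B" unfolding z_def by (intro von_neumann_algebraD(3)[OF vB] cD c'D)
    show "z \<in> commutant B" unfolding z_def by (intro commutant_add cD c'D)
    show "adj z = z" unfolding z_def by (simp add: adj_add cD c'D)
    show "z (z h) = z h" for h by (simp add: z_apply blinfun.add_right cD(6) c'D(6) cc' c'c)
  qed
  have z_uu: "z (u (u h)) = u (u h)" for h
    unfolding uu by (simp add: z_apply blinfun.add_right cvc c'(2) cD(6) ce c'e c'c blinfun.zero_right)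
  have uu_faithful: "y (z k) = 0" if y: "y \<in> commutant B" "\<And>h. y (u (u h)) = 0" for y k
  proof -
    have yc: "y o\<^sub>L c \<in> commutant B" by (intro commutant_compose y cD)
    have ye: "y (adj v (v (c h))) = 0" for h
      using y(2)[of "c h"] unfolding uu by (simp add: vcvc cD(6))
    have "(y o\<^sub>L c) (c k) = 0" by (rule faithful[OF yc]) (simp add: ce ye)
    then have "y (c k) = 0" by (simp add: cD(6))
    moreover have "y (v (c (adj v h))) = 0" for h
      using y(2)[of h] unfolding uu by (simp add: blinfun.add_right ye)
    then have "y (c' k) = 0" by (intro c'(3)) (simp add: commutant_apply[OF y(1)] blinfun.zero_right)
    ultimately show ?thesis by (simp add: z_apply blinfun.add_right)
  qed
  interpret full_groupoid_normaliser B M u z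
    by unfold_locales (simp_all add: uGN z_central adj_u z_uu uu_faithful)
  have xu: "x (u h) = u (x h)" for h by (rule compose_eq_apply[OF fixed_point_commutes[OF x]])
  have xc: "c (x h) = x (c h)" for h by (rule cD(8)[OF xN])
  \<comment> \<open>On the range of \<open>c\<close> the summand \<open>c o\<^sub>L adj v\<close>
    vanishes, so \<open>u\<close> acts as \<open>v\<close>.\<close>
  show ?thesis using xu[of "c h"] by (simp add: u_apply cD(6) cvc' xc[symmetric])
qed

lemma fixed_point_commutes_groupoid_normaliser:
  assumes x: "x \<in> fixed_points (commutant B) (automorphisms_fixing (commutant M) (commutant B))"
    and v: "v \<in> groupoid_normalisers M B"
  shows "x o\<^sub>L v = v o\<^sub>L x"
proof -
  note vD = groupoid_normalisersD[OF v]
  have xN: "x \<in> commutant B" using x by (simp add: fixed_points_def)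
  define d where "d = (x o\<^sub>L v) - (v o\<^sub>L x)"
  have d_apply: "d h = x (v h) - v (x h)" for h by (simp add: d_def blinfun.diff_left)
  \<comment> \<open>The largest subspace invariant under \<open>B\<close> and its commutant on which
    the commutator \<open>d\<close> vanishes. Its projection \<open>r\<close> is the largest central
    projection killed by \<open>d\<close>, and the goal becomes \<open>q = 0\<close> for the
    complement \<open>q\<close>.\<close>
  define E where "E = {h. \<forall>b\<in>B. \<forall>y\<in>commutant B. d (b (y h)) = 0}"
  have sE: "subspace E" by (auto simp: E_def subspace_def blinfun_apply_simps)
  have "closed E"
  proof -
    have "E = (\<Inter>b\<in>B. \<Inter>y\<in>commutant B. {h. blinfun_apply d (blinfun_apply b (blinfun_apply y h)) = 0})" by (auto simp: E_def)
    then show ?thesis by (auto intro!: closed_INT closed_Collect_eq continuous_intros)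
  qed
  note E = sE this
  have cE: "complete E" using E by (simp add: complete_eq_closed)
  have EB: "S h \<in> E" if "S \<in> B" "h \<in> E" for S h
    unfolding E_def
  proof (intro CollectI ballI)
    fix b y assume b: "b \<in> B" and y: "y \<in> commutant B"
    have "d ((b o\<^sub>L S) (y h)) = 0" using that(2) y B_compose[OF b that(1)] unfolding E_def by blast
    then show "d (b (y (S h))) = 0" by (simp add: commutant_apply[OF y that(1)])
  qed
  have EN: "S h \<in> E" if "S \<in> commutant B" "h \<in> E" for S h
    unfolding E_def
  proof (intro CollectI ballI)
    fix b y assume b: "b \<in> B" and y: "y \<in> commutant B"
    have "d (b ((y o\<^sub>L S) h)) = 0" using that(2) b commutant_compose[OF y that(1)] unfolding E_def by blast
    then show "d (b (y (S h))) = 0" by simp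
  qed
  have sc: "c *\<^sub>C h \<in> E" if "h \<in> E" for c h
    using EB[OF von_neumann_algebraD(4)[OF vB von_neumann_algebraD(2)[OF vB]] that] by simp
  define r where "r = orth_proj E"
  have r: "central_projection r"
  proof -
    have "r \<in> commutant (commutant B)"
      unfolding r_def using EN sc by (intro orth_proj_commutant E commutant_subset N_adj)
    moreover have "r \<in> commutant B"
      unfolding r_def using EB sc B_bounded by (intro orth_proj_commutant E B_adj) auto
    ultimately show ?thesis
      using is_projection_orth_proj[OF E sc] double_commutant[OF vB] by (simp add: central_projection_def r_def)
  qed
  note rD = central_projectionD[OF r]
  have dr: "d (r h) = 0" for h
  proof -
    have "r h \<in> E" unfolding r_def by (rule orth_proj_in[OF sE cE])
    then have "d (id_blinfun (id_blinfun (r h))) = 0"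
      using von_neumann_algebraD(2)[OF vB] commutant_id unfolding E_def by blast
    then show ?thesis by simp
  qed
  have below_r: "r (c h) = c h" if c: "central_projection c" "\<And>h. d (c h) = 0" for c h
  proof -
    have "c h \<in> E"
      unfolding E_def using c(2) by (simp add: central_projectionD(7,8)[OF c(1), symmetric])
    then show ?thesis unfolding r_def by (rule orth_proj_fixed[OF sE cE])
  qed
  define q where "q = id_blinfun - r"
  have q: "central_projection q" unfolding q_def by (rule central_projection_compl[OF r])
  note qD = central_projectionD[OF q]
  have q_apply: "q h = h - r h" for h by (simp add: q_def blinfun.diff_left)
  have vanish: "c h = 0" if c: "central_projection c" "\<And>h. d (c h) = 0" "\<And>h. q (c h) = c h" for c h
    using below_r[OF c(1,2), of h] c(3)[of h] by (simp add: q_apply)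

  obtain z1 where z1: "central_projection z1" "\<And>h. blinfun_apply z1 ((adj v o\<^sub>L v) h) = (adj v o\<^sub>L v) h"
    "\<And>(w :: 'h \<Rightarrow>\<^sub>L 'h) h. (\<And>b k. b \<in> B \<Longrightarrow> blinfun_apply w (blinfun_apply b ((adj v o\<^sub>L v) k)) = 0) \<Longrightarrow> blinfun_apply w (blinfun_apply z1 h) = 0"
    using central_support_exists[OF vD(5)] by metis
  note z1D = central_projectionD[OF z1(1)]
  have source: "y (z1 k) = 0" if y: "y \<in> commutant B" "\<And>h. blinfun_apply y (adj v (v h)) = 0" for y k
    by (rule z1(3)) (simp add: commutant_apply[OF y(1)] y(2) blinfun.zero_right)
  have vz1: "v (z1 h) = v h" for h
  proof -
    have "adj v (v (z1 h)) = adj v (v h)" using z1(2)[of h] z1D(7)[OF vD(5), of h] by simp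
    then show ?thesis using vD(6) by metis
  qed
  \<comment> \<open>Off the central support \<open>z1\<close> of \<open>adj v o\<^sub>L v\<close>
    the operator \<open>v\<close> vanishes, hence so does \<open>d\<close>; maximality of
    \<open>r\<close> puts \<open>q\<close> below \<open>z1\<close>.\<close>
  have z1q: "z1 (q h) = q h" for h
  proof -
    define c where "c = q o\<^sub>L (id_blinfun - z1)"
    have c: "central_projection c"
      unfolding c_def by (intro central_projection_compose q central_projection_compl z1)
    have "c h = 0"
    proof (rule vanish[OF c])
      show "q (c h) = c h" for h by (simp add: c_def qD(6))
      have "c h = q h - z1 (q h)" for h
        by (simp add: c_def blinfun_apply_simps qD(7)[OF z1D(2)])
      then show "d (c h) = 0" for h
        by (simp add: d_apply blinfun.diff_right vz1 z1D(8)[OF xN, symmetric])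
    qed
    then have "q h = q (z1 h)" by (simp add: c_def blinfun_apply_simps)
    then show ?thesis by (simp add: qD(7)[OF z1D(2)])
  qed
  have faithful: "y (q k) = 0" if y: "y \<in> commutant B" "\<And>h. blinfun_apply y (adj v (v h)) = 0" for y k
    using source[OF y, of "q k"] by (simp add: z1q)
  \<comment> \<open>Such a \<open>c\<close> is killed by \<open>d\<close> by the swap argument, so
    it is zero by maximality of \<open>r\<close>.\<close>
  have no_swap: "c h = 0" if c: "central_projection c" "\<And>h. q (c h) = c h" "\<And>h. c (v (c h)) = 0" for c h
  proof (rule vanish[OF c(1) _ c(2)])
    have "y (c k) = 0" if y: "y \<in> commutant B" "\<And>h. y (adj v (v h)) = 0" for y k
      using faithful[OF y, of "c k"] by (simp add: c(2))
    then show "d (c h) = 0" for h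
      using fixed_point_commutes_swap[OF v c(1,3) _ x] by (simp add: d_apply)
  qed

  obtain q1 where q1: "central_projection q1" "\<And>h. blinfun_apply q1 (v h) = v (q h)"
    "\<And>(w :: 'h \<Rightarrow>\<^sub>L 'h) h. (\<And>b k. b \<in> B \<Longrightarrow> blinfun_apply w (blinfun_apply b (v (q (adj v k)))) = 0) \<Longrightarrow> blinfun_apply w (q1 h) = 0"
    using central_transport[OF v q] by metis
  obtain q2 where q2: "central_projection q2" "\<And>h. blinfun_apply q2 (adj v h) = adj v (q h)"
    using central_transport[OF groupoid_normalisers_adj[OF v] q] by metis
  note q1D = central_projectionD[OF q1(1)] and q2D = central_projectionD[OF q2(1)]
  have q2v: "q (v h) = v (q2 h)" for h
  proof (rule inner_left_eqI)
    fix k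
    have "inner k (q (v h)) = inner (adj v (q k)) h"
      by (simp add: is_projectionD(4)[OF qD(1), symmetric] adj_inner'[OF vD(2)])
    also have "\<dots> = inner k (v (q2 h))"
      by (simp add: q2(2)[symmetric] is_projectionD(4)[OF q2D(1)] adj_inner'[OF vD(2)])
    finally show "inner k (q (v h)) = inner k (v (q2 h))" .
  qed
  have qq1: "q (q1 h) = q h" for h
  proof -
    \<comment> \<open>\<open>v\<close> after \<open>t\<close> is q1 v (1 - q1), and \<open>t\<close>
      kills the range of \<open>q1\<close>. So \<open>t\<close> vanishes and \<open>q\<close> lies
      below its transport \<open>q1\<close>.\<close>
    define t where "t = q o\<^sub>L (id_blinfun - q1)"
    have t_apply: "t h = q h - q (q1 h)" for h by (simp add: t_def blinfun_apply_simps)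
    have "t h = 0"
    proof (rule no_swap)
      show "central_projection t"
        unfolding t_def by (intro central_projection_compose central_projection_compl q q1)
      show "q (t h) = t h" for h by (simp add: t_apply blinfun.diff_right qD(6))
      show "t (v (t h)) = 0" for h
      proof -
        have "v (t h) = q1 (v (h - q1 h))" by (simp add: t_apply q1(2) blinfun.diff_right)
        then show ?thesis by (simp add: t_apply q1D(6))
      qed
    qed
    then show ?thesis by (simp add: t_apply)
  qed
  have qvq: "q (v (q h)) = v (q h)" for h
  proof -
    \<comment> \<open>\<open>v\<close> after \<open>s\<close> is (1 - q) v q, which \<open>s\<close>
      kills. So \<open>q\<close> lies below \<open>q2\<close>, and \<open>v\<close> preserves the
      range of \<open>q\<close>.\<close>
    define s where "s = q o\<^sub>L (id_blinfun - q2)"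
    have s_apply: "s h = q h - q (q2 h)" for h by (simp add: s_def blinfun_apply_simps)
    have "s h = 0" for h
    proof (rule no_swap)
      show "central_projection s"
        unfolding s_def by (intro central_projection_compose central_projection_compl q q2)
      show "q (s h) = s h" for h by (simp add: s_apply blinfun.diff_right qD(6))
      show "s (v (s h)) = 0" for h
      proof -
        have "s h = q h - q2 (q h)" for h by (simp add: s_apply qD(7)[OF q2D(2)])
        then have "v (s h) = v (q h) - q (v (q h))" by (simp add: blinfun.diff_right q2v)
        moreover have "s (k - q k) = 0" for k
          by (simp add: s_apply blinfun.diff_right qD(6) qD(7)[OF q2D(2)])
        ultimately show ?thesis by simp
      qed
    qed
    then have "q h = q2 (q h)" by (simp add: s_apply qD(7)[OF q2D(2)])
    then show ?thesis by (simp add: q2v)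
  qed

  \<comment> \<open>Source and range of \<open>w\<close> both have central support \<open>q\<close>:
    the source because \<open>q\<close> lies below \<open>z1\<close>, the range because
    \<open>q\<close> lies below \<open>q1\<close> and \<open>v\<close> preserves the range of
    \<open>q\<close>.\<close>
  define w where "w = v o\<^sub>L q"
  have w_apply: "w h = v (q h)" for h by (simp add: w_def)
  have wM: "w \<in> M" unfolding w_def by (rule von_neumann_algebraD(5)[OF vM vD(1) BM[THEN subsetD, OF qD(2)]])
  have adj_w: "adj w = q o\<^sub>L adj v" unfolding w_def by (simp add: adj_compose vD(2) qD(4,5))
  have qe: "q (adj v (v h)) = adj v (v (q h))" for h using qD(7)[OF vD(5), of h] by simp
  have "w \<in> groupoid_normalisers M B"
  proof (rule groupoid_normalisersI[OF wM])
    show "w (adj w (w h)) = w h" for h by (simp add: adj_w w_apply qD(6) qe vD)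
    show "w o\<^sub>L b o\<^sub>L adj w \<in> B" if b: "b \<in> B" for b
      using vD(3)[of "q o\<^sub>L b o\<^sub>L q"] B_compose b qD(2) by (simp add: w_def adj_w[unfolded w_def] blinfun_compose_assoc)
    show "adj w o\<^sub>L b o\<^sub>L w \<in> B" if b: "b \<in> B" for b
      using B_compose[OF B_compose[OF qD(2) vD(4)[OF b]] qD(2)] by (simp add: w_def adj_w[unfolded w_def] blinfun_compose_assoc)
  qed
  then interpret full_groupoid_normaliser B M w q
  proof unfold_locales
    show "q (adj w (w h)) = adj w (w h)" for h by (simp add: adj_w qD(6))
    show "q (w (adj w h)) = w (adj w h)" for h by (simp add: adj_w w_apply qD(6) qvq)
    show "y (q k) = 0" if y: "y \<in> commutant B" "\<And>h. y (adj w (w h)) = 0" for y k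
    proof -
      have "(y o\<^sub>L q) (q k) = 0"
        by (rule faithful[OF commutant_compose[OF y(1) qD(3)]]) (use y(2) in \<open>simp add: adj_w w_apply qe qD(6)\<close>)
      then show ?thesis by (simp add: qD(6))
    qed
    show "y (q k) = 0" if y: "y \<in> commutant B" "\<And>h. y (w (adj w h)) = 0" for y k
    proof -
      have "y (v (q (adj v h))) = 0" for h using y(2)[of h] by (simp add: adj_w w_apply qD(6))
      then have "y (q1 (q k)) = 0" by (intro q1(3)) (simp add: commutant_apply[OF y(1)] blinfun.zero_right)
      then show ?thesis using qD(7)[OF q1D(2), of k] qq1 by simp
    qed
  qed (simp_all add: q)
  have "x (w h) = w (x h)" for h by (rule compose_eq_apply[OF fixed_point_commutes[OF x]])
  then have dq: "d (q h) = 0" for h by (simp add: d_apply w_apply qD(8)[OF xN])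
  have "q h = 0" for h by (rule vanish[OF q dq qD(6)])
  then have "r h = h" for h by (simp add: q_apply)
  then have "d h = 0" for h using dr by metis
  then show ?thesis by (intro blinfun_eqI) (simp add: d_apply)
qed

end

theorem theorem3p4:
  fixes B M :: "('h::complex_hilbert_space \<Rightarrow>\<^sub>L 'h) set"
  assumes "von_neumann_algebra B"
    and "von_neumann_algebra M"
    and "B \<subseteq> M"
    and "countably_decomposable B"
  shows "commutant (groupoid_normalisers M B) =
    fixed_points (commutant B) (automorphisms_fixing (commutant M) (commutant B))"
proof -
  interpret von_neumann_inclusion B M by unfold_locales fact+
  show ?thesis
  proof
    show "commutant (groupoid_normalisers M B) \<subseteq> fixed_points (commutant B) (automorphisms_fixing (commutant M) (commutant B))"
      using groupoid_normalisers_commutant_subset commutant_groupoid_normalisers_fixed by (auto simp: fixed_points_def)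
    show "fixed_points (commutant B) (automorphisms_fixing (commutant M) (commutant B)) \<subseteq> commutant (groupoid_normalisers M B)"
    proof
      fix x assume x: "x \<in> fixed_points (commutant B) (automorphisms_fixing (commutant M) (commutant B))"
      then have "x \<in> bounded_ops" using N_bounded by (simp add: fixed_points_def)
      then show "x \<in> commutant (groupoid_normalisers M B)"
        using fixed_point_commutes_groupoid_normaliser[OF x] by (simp add: commutant_def)
    qed
  qed
qed

end
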